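(* Let ${}_AE_A$ be the C*-correspondence of a monomial ideal $\mathcal I$ in $\mathbb C\langle x_1,\dots,x_d\rangle$. Then the tensor algebra $\mathcal T_E^+$ is hyperrigid.
   Context: $\mathbb F_+^d$ is the free monoid of words in $\{1,\dots,d\}$; for $\mu=\mu_1\cdots\mu_n$ put $x^\mu=x_{\mu_1}\cdots x_{\mu_n}$ in the ring $\mathbb C\langle x_1,\dots,x_d\rangle$ of polynomials in noncommuting variables. A monomial ideal is a two-sided ideal generated by monomials; throughout, monomial ideals are generated by monomials of degree at least 2 (the zero ideal is allowed). For a monomial ideal $\mathcal I$ put $\Lambda^*=\{\mu: x^\mu\notin\mathcal I\}$. $\mathcal F_X$ is the Hilbert space with orthonormal basis $\{e_\mu:\mu\in\Lambda^*\}$, and $T_ie_\nu=e_{i\nu}$ if $i\nu\in\Lambda^*$, $T_ie_\nu=0$ otherwise; $T_\mu=T_{\mu_1}\cdots T_{\mu_n}$, $T_\emptyset=I$. $A=C^*(T_\mu^*T_\mu:\mu\in\Lambda^* )$ is unital and commutative, and $E=\overline{\mathrm{span}}\{T_ia: a\in A,\ i=1,\dots,d\}$ is a C*-correspondence over $A$ with $a\cdot\xi\cdot b=a\xi b$, $\langle\xi,\eta\rangle=\xi^*\eta$ and left action $\phi_E$. A representation $(\pi,t)$ of $E$ consists of a $*$-representation $\pi$ of $A$ on $H$ and a linear map $t:E\to B(H)$ with $t(\xi)^*t(\eta)=\pi(\langle\xi,\eta\rangle)$, $\pi(a)t(\xi)=t(\phi_E(a)\xi)$; it induces $\psi_t(\Theta_{\xi,\eta})=t(\xi)t(\eta)^*$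 on $\mathcal K(E)$. $\mathcal T_E$ is the universal C*-algebra generated by $A$ and $E$ for all representations; $\mathcal O_E$ is the universal one for representations with $\pi(a)=\psi_t(\phi_E(a))$ for $a\in J_E=(\ker\phi_E)^\perp\cap\phi_E^{-1}(\mathcal K(E))$. $\mathcal T_E^+$ is the norm-closed subalgebra of $\mathcal T_E$ generated by $A$ and $E$; by Katsoulis–Kribs the quotient map $\mathcal T_E\to\mathcal O_E$ is completely isometric on $\mathcal T_E^+$ and $\mathcal O_E$ is its C*-envelope, and $\mathcal T_E^+$ is regarded as a generating subalgebra of $\mathcal O_E$. Representations of an operator algebra $\mathcal A$ are completely contractive homomorphisms. $\rho:\mathcal A\to B(K)$ is a dilation of $\phi:\mathcal A\to B(H)$ if $H\subseteq K$ and $P_H\rho(a)|_H=\phi(a)$ for all $a\in\mathcal A$; it is trivial if $H$ reduces $\rho(\mathcal A)$. $\phi$ is maximal if all its dilations are trivial. $\mathcal A\subseteq C^*(\mathcal A)$ is hyperrigid if for every faithful (unital) $*$-representation $\pi$ of $C^*(\mathcal A)$ the restriction $\pi|_{\mathcal A}$ is maximal. Here $C^*(\mathcal A)=\mathcal O_E$. *)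

theory Defs
  imports "HOL-Analysis.Analysis" "HOL-Library.Poly_Mapping"
begin

section \<open>Complex Hilbert spaces\<close>

text \<open>Inner products are linear in the second variable, as for Hilbert modules.\<close>

class chilbert_space = banach +
  fixes scaleC :: "complex \<Rightarrow> 'a \<Rightarrow> 'a" (infixr "*\<^sub>C" 75)
    and cinner :: "'a \<Rightarrow> 'a \<Rightarrow> complex"
  assumes scaleC_add_right: "c *\<^sub>C (x + y) = c *\<^sub>C x + c *\<^sub>C y"
    and scaleC_add_left: "(c + d) *\<^sub>C x = c *\<^sub>C x + d *\<^sub>C x"
    and scaleC_scaleC: "c *\<^sub>C (d *\<^sub>C x) = (c * d) *\<^sub>C x"
    and scaleR_scaleC: "r *\<^sub>R x = complex_of_real r *\<^sub>C x"
    and cinner_commute: "cinner x y = cnj (cinner y x)"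
    and cinner_add_right: "cinner x (y + z) = cinner x y + cinner x z"
    and cinner_scaleC_right: "cinner x (c *\<^sub>C y) = c * cinner x y"
    and norm_eq_sqrt_cinner: "norm x = sqrt (Re (cinner x x))"

lemma scaleC_one [simp]: "1 *\<^sub>C x = (x::'a::chilbert_space)"
  using scaleR_scaleC[of 1 x] by simp

lemma scaleC_zero_right [simp]: "c *\<^sub>C 0 = (0::'a::chilbert_space)"
  using scaleC_add_right[of c 0 "0::'a"] by simp

lemma cinner_add_left:
  "cinner (x + y) z = cinner x z + cinner y (z::'a::chilbert_space)"
  using cinner_commute[of "x + y" z] cinner_commute[of x z] cinner_commute[of y z]
  by (simp add: cinner_add_right)

lemma cinner_scaleC_left:
  "cinner (c *\<^sub>C x) y = cnj c * cinner x (y::'a::chilbert_space)"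
  using cinner_commute[of "c *\<^sub>C x" y] cinner_commute[of x y]
  by (simp add: cinner_scaleC_right)

lemma power2_norm_eq_cinner: "(norm x)\<^sup>2 = Re (cinner x (x::'a::chilbert_space))"
proof -
  have "0 \<le> sqrt (Re (cinner x x))" using norm_ge_zero[of x] by (simp only: norm_eq_sqrt_cinner)
  then show ?thesis by (simp add: norm_eq_sqrt_cinner)
qed

lemma cinner_same: "cinner x x = complex_of_real ((norm (x::'a::chilbert_space))\<^sup>2)"
proof -
  have "Im (cinner x x) = 0"
    using arg_cong[OF cinner_commute[of x x], of Im] by simp
  then show ?thesis by (simp add: complex_eq_iff power2_norm_eq_cinner)
qed

lemma norm_scaleC: "norm (c *\<^sub>C (x::'a::chilbert_space)) = cmod c * norm x"
proof -
  have "complex_of_real ((norm (c *\<^sub>C x))\<^sup>2) = complex_of_real ((cmod c * norm x)\<^sup>2)"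
    unfolding cinner_same[symmetric] cinner_scaleC_left cinner_scaleC_right
    by (simp only: cinner_same power_mult_distrib of_real_mult complex_norm_square mult_ac)
  then have "(norm (c *\<^sub>C x))\<^sup>2 = (cmod c * norm x)\<^sup>2" by (simp only: of_real_eq_iff)
  then show ?thesis by (simp add: power2_eq_iff_nonneg)
qed

lemma norm_cinner_le: "cmod (cinner x (y::'a::chilbert_space)) \<le> (norm x)\<^sup>2 + (norm y)\<^sup>2"
proof -
  define c where "c = - (if cinner x y = 0 then 0 else cnj (cinner x y) / cmod (cinner x y))"
  have c: "c * cinner x y = - complex_of_real (cmod (cinner x y))"
    using complex_norm_square[of "cinner x y"]
    by (auto simp: c_def power2_eq_square mult.commute[of "cnj (cinner x y)"] nonzero_divide_eq_eq)
  have c': "cnj c * cinner y x = - complex_of_real (cmod (cinner x y))"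
    using arg_cong[OF c, of cnj] cinner_commute[of y x] by simp
  have n: "cmod c \<le> 1" by (auto simp: c_def norm_divide)
  have "complex_of_real ((norm (x + c *\<^sub>C y))\<^sup>2)
      = complex_of_real ((norm x)\<^sup>2 - 2 * cmod (cinner x y) + (norm (c *\<^sub>C y))\<^sup>2)"
    unfolding of_real_add of_real_diff cinner_same[symmetric] cinner_add_left cinner_add_right
    using c c' by (simp add: cinner_scaleC_left cinner_scaleC_right)
  then have eq: "(norm (x + c *\<^sub>C y))\<^sup>2 = (norm x)\<^sup>2 - 2 * cmod (cinner x y) + (norm (c *\<^sub>C y))\<^sup>2"
    by (simp only: of_real_eq_iff)
  have "norm (c *\<^sub>C y) \<le> norm y"
    using mult_right_mono[OF n, of "norm y"] by (simp add: norm_scaleC)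
  then have "(norm (c *\<^sub>C y))\<^sup>2 \<le> (norm y)\<^sup>2" by simp
  moreover have "0 \<le> (norm (x + c *\<^sub>C y))\<^sup>2" "0 \<le> (norm x)\<^sup>2" "0 \<le> (norm y)\<^sup>2" by simp_all
  ultimately show ?thesis using eq norm_ge_zero[of "cinner x y"] by linarith
qed

instantiation complex :: chilbert_space
begin
definition scaleC_complex :: "complex \<Rightarrow> complex \<Rightarrow> complex" where "scaleC_complex c x = c * x"
definition cinner_complex :: "complex \<Rightarrow> complex \<Rightarrow> complex" where "cinner_complex x y = cnj x * y"
instance
  by standard
    (auto simp: scaleC_complex_def cinner_complex_def algebra_simps scaleR_conv_of_real
      cmod_def power2_eq_square)
end

subsection \<open>Hilbert direct sums\<close>

text \<open>The direct sum of copies of \<^typ>\<open>'h\<close> indexed by the whole type \<^typ>\<open>'i\<close>.\<close>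

typedef (overloaded) ('i, 'h::chilbert_space) hsum =
  "{f :: 'i \<Rightarrow> 'h. (\<lambda>i. (norm (f i))\<^sup>2) summable_on UNIV}"
  morphisms hcoord Abs_hsum
  by (rule exI[of _ "\<lambda>_. 0"]) simp

setup_lifting type_definition_hsum

lemma hsum_bdd_summable:
  fixes f :: "'i \<Rightarrow> 'h::chilbert_space"
  assumes "\<And>F. finite F \<Longrightarrow> (\<Sum>i\<in>F. (norm (f i))\<^sup>2) \<le> B"
  shows "(\<lambda>i. (norm (f i))\<^sup>2) summable_on UNIV"
  by (rule nonneg_bdd_above_summable_on) (auto intro!: bdd_aboveI2 assms)

lemma hsum_L2_set_le:
  fixes f :: "'i \<Rightarrow> 'h::chilbert_space"
  assumes "(\<lambda>i. (norm (f i))\<^sup>2) summable_on UNIV" "finite F"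
  shows "L2_set (\<lambda>i. norm (f i)) F \<le> sqrt (\<Sum>\<^sub>\<infinity>i. (norm (f i))\<^sup>2)"
  unfolding L2_set_def using assms by (auto intro!: finite_sum_le_infsum)

lemma hsum_L2_set_bdd:
  fixes f :: "'i \<Rightarrow> 'h::chilbert_space"
  assumes "\<And>F. finite F \<Longrightarrow> L2_set (\<lambda>i. norm (f i)) F \<le> B"
  shows "(\<lambda>i. (norm (f i))\<^sup>2) summable_on UNIV"
    and "sqrt (\<Sum>\<^sub>\<infinity>i. (norm (f i))\<^sup>2) \<le> B"
proof -
  have B: "0 \<le> B" using assms[of "{}"] by simp
  have le: "(\<Sum>i\<in>F. (norm (f i))\<^sup>2) \<le> B\<^sup>2" if "finite F" for F
    using assms[OF that] B unfolding L2_set_def by (simp add: sqrt_le_D)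
  show s: "(\<lambda>i. (norm (f i))\<^sup>2) summable_on UNIV" using le by (rule hsum_bdd_summable)
  have "(\<Sum>\<^sub>\<infinity>i. (norm (f i))\<^sup>2) \<le> B\<^sup>2"
    by (rule infsum_le_finite_sums[OF s]) (use le in auto)
  then show "sqrt (\<Sum>\<^sub>\<infinity>i. (norm (f i))\<^sup>2) \<le> B"
    using B by (simp add: real_le_lsqrt)
qed

lemma hsum_add:
  fixes f g :: "'i \<Rightarrow> 'h::chilbert_space"
  assumes f: "(\<lambda>i. (norm (f i))\<^sup>2) summable_on UNIV" and g: "(\<lambda>i. (norm (g i))\<^sup>2) summable_on UNIV"
  shows "(\<lambda>i. (norm (f i + g i))\<^sup>2) summable_on UNIV"
    and "sqrt (\<Sum>\<^sub>\<infinity>i. (norm (f i + g i))\<^sup>2)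
      \<le> sqrt (\<Sum>\<^sub>\<infinity>i. (norm (f i))\<^sup>2) + sqrt (\<Sum>\<^sub>\<infinity>i. (norm (g i))\<^sup>2)"
proof -
  have "L2_set (\<lambda>i. norm (f i + g i)) F
      \<le> sqrt (\<Sum>\<^sub>\<infinity>i. (norm (f i))\<^sup>2) + sqrt (\<Sum>\<^sub>\<infinity>i. (norm (g i))\<^sup>2)" if "finite F" for F
  proof -
    have "L2_set (\<lambda>i. norm (f i + g i)) F \<le> L2_set (\<lambda>i. norm (f i) + norm (g i)) F"
      by (rule L2_set_mono) (auto intro: norm_triangle_ineq)
    also have "\<dots> \<le> L2_set (\<lambda>i. norm (f i)) F + L2_set (\<lambda>i. norm (g i)) F"
      by (rule L2_set_triangle_ineq)
    finally show ?thesis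
      using hsum_L2_set_le[OF f that] hsum_L2_set_le[OF g that] by linarith
  qed
  from hsum_L2_set_bdd[OF this] show "(\<lambda>i. (norm (f i + g i))\<^sup>2) summable_on UNIV"
    and "sqrt (\<Sum>\<^sub>\<infinity>i. (norm (f i + g i))\<^sup>2)
      \<le> sqrt (\<Sum>\<^sub>\<infinity>i. (norm (f i))\<^sup>2) + sqrt (\<Sum>\<^sub>\<infinity>i. (norm (g i))\<^sup>2)" by auto
qed

lemma hsum_scaleC:
  fixes f :: "'i \<Rightarrow> 'h::chilbert_space"
  assumes "(\<lambda>i. (norm (f i))\<^sup>2) summable_on UNIV"
  shows "(\<lambda>i. (norm (c *\<^sub>C f i))\<^sup>2) summable_on UNIV"
  using summable_on_cmult_right[OF assms, of "(cmod c)\<^sup>2"]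
  by (simp add: norm_scaleC power_mult_distrib)

lemma hsum_cinner_summable:
  fixes f g :: "'i \<Rightarrow> 'h::chilbert_space"
  assumes f: "(\<lambda>i. (norm (f i))\<^sup>2) summable_on UNIV" and g: "(\<lambda>i. (norm (g i))\<^sup>2) summable_on UNIV"
  shows "(\<lambda>i. cinner (f i) (g i)) summable_on UNIV"
  by (rule abs_summable_summable,
      rule summable_on_comparison_test[OF summable_on_add[OF f g]])
    (auto intro: norm_cinner_le)

instantiation hsum :: (type, chilbert_space) real_normed_vector
begin
lift_definition zero_hsum :: "('a, 'b) hsum" is "\<lambda>_. 0" by simp
lift_definition plus_hsum :: "('a, 'b) hsum \<Rightarrow> ('a, 'b) hsum \<Rightarrow> ('a, 'b) hsum"
  is "\<lambda>f g i. f i + g i" by (rule hsum_add)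
lift_definition uminus_hsum :: "('a, 'b) hsum \<Rightarrow> ('a, 'b) hsum" is "\<lambda>f i. - f i" by simp
lift_definition minus_hsum :: "('a, 'b) hsum \<Rightarrow> ('a, 'b) hsum \<Rightarrow> ('a, 'b) hsum"
  is "\<lambda>f g i. f i - g i"
  subgoal for f g using hsum_add(1)[of f "\<lambda>i. - g i"] by simp
  done
lift_definition scaleR_hsum :: "real \<Rightarrow> ('a, 'b) hsum \<Rightarrow> ('a, 'b) hsum"
  is "\<lambda>r f i. r *\<^sub>R f i" by (simp add: scaleR_scaleC hsum_scaleC)
lift_definition norm_hsum :: "('a, 'b) hsum \<Rightarrow> real"
  is "\<lambda>f. sqrt (\<Sum>\<^sub>\<infinity>i. (norm (f i))\<^sup>2)" .
definition sgn_hsum :: "('a, 'b) hsum \<Rightarrow> ('a, 'b) hsum" where "sgn_hsum x = inverse (norm x) *\<^sub>R x"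
definition dist_hsum :: "('a, 'b) hsum \<Rightarrow> ('a, 'b) hsum \<Rightarrow> real" where "dist_hsum x y = norm (x - y)"
definition uniformity_hsum :: "(('a, 'b) hsum \<times> ('a, 'b) hsum) filter"
  where "uniformity_hsum = (INF e\<in>{0<..}. principal {(x, y). dist x y < e})"
definition open_hsum :: "('a, 'b) hsum set \<Rightarrow> bool"
  where "open_hsum U = (\<forall>x\<in>U. \<forall>\<^sub>F (x', y) in uniformity. x' = x \<longrightarrow> y \<in> U)"

instance
proof
  fix x y z :: "('a, 'b) hsum" and a b :: real
  show "dist x y = norm (x - y)" by (rule dist_hsum_def)
  show "sgn x = inverse (norm x) *\<^sub>R x" by (rule sgn_hsum_def)
  show "(uniformity :: (('a, 'b) hsum \<times> ('a, 'b) hsum) filter)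
      = (INF e\<in>{0<..}. principal {(x, y). dist x y < e})" by (rule uniformity_hsum_def)
  show "open U = (\<forall>x\<in>U. \<forall>\<^sub>F (x', y) in uniformity. x' = x \<longrightarrow> y \<in> U)" for U :: "('a, 'b) hsum set"
    by (rule open_hsum_def)
  show "x + y + z = x + (y + z)" by transfer (simp add: add.assoc)
  show "x + y = y + x" by transfer (simp add: add.commute)
  show "0 + x = x" by transfer simp
  show "- x + x = 0" by transfer simp
  show "x - y = x + - y" by transfer simp
  show "a *\<^sub>R (x + y) = a *\<^sub>R x + a *\<^sub>R y" by transfer (simp add: scaleR_right_distrib)
  show "(a + b) *\<^sub>R x = a *\<^sub>R x + b *\<^sub>R x" by transfer (simp add: scaleR_left_distrib)
  show "a *\<^sub>R b *\<^sub>R x = (a * b) *\<^sub>R x" by transfer simp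
  show "1 *\<^sub>R x = x" by transfer simp
  show "norm (x + y) \<le> norm x + norm y" by transfer (rule hsum_add)
  show "norm x = 0 \<longleftrightarrow> x = 0"
  proof transfer
    fix f :: "'a \<Rightarrow> 'b" assume f: "(\<lambda>i. (norm (f i))\<^sup>2) summable_on UNIV"
    show "sqrt (\<Sum>\<^sub>\<infinity>i. (norm (f i))\<^sup>2) = 0 \<longleftrightarrow> f = (\<lambda>_. 0)"
    proof
      assume "sqrt (\<Sum>\<^sub>\<infinity>i. (norm (f i))\<^sup>2) = 0"
      then have "(\<Sum>\<^sub>\<infinity>i. (norm (f i))\<^sup>2) \<le> 0" by simp
      then have "(norm (f i))\<^sup>2 = 0" for i
        by (rule nonneg_infsum_le_0D[OF _ f]) auto
      then show "f = (\<lambda>_. 0)" by auto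
    qed simp
  qed
  show "norm (a *\<^sub>R x) = \<bar>a\<bar> * norm x"
    by transfer (simp add: power_mult_distrib infsum_cmult_right' real_sqrt_mult)
qed
end

lemma norm_hcoord_le: "norm (hcoord x i) \<le> norm (x :: ('i, 'h::chilbert_space) hsum)"
proof transfer
  fix f :: "'i \<Rightarrow> 'h" and i assume "(\<lambda>i. (norm (f i))\<^sup>2) summable_on UNIV"
  from hsum_L2_set_le[OF this, of "{i}"] show "norm (f i) \<le> sqrt (\<Sum>\<^sub>\<infinity>i. (norm (f i))\<^sup>2)" by simp
qed

lemma L2_set_hcoord_le: "finite F \<Longrightarrow> L2_set (\<lambda>i. norm (hcoord x i)) F \<le> norm x"
  by transfer (rule hsum_L2_set_le)

instance hsum :: (type, chilbert_space) banach
proof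
  fix X :: "nat \<Rightarrow> ('a, 'b) hsum" assume C: "Cauchy X"
  have "Cauchy (\<lambda>n. hcoord (X n) i)" for i
  proof (rule CauchyI)
    fix e :: real assume "0 < e"
    then obtain M where "\<forall>m\<ge>M. \<forall>n\<ge>M. norm (X m - X n) < e" using CauchyD[OF C] by blast
    then have "\<forall>m\<ge>M. \<forall>n\<ge>M. norm (hcoord (X m) i - hcoord (X n) i) < e"
      using norm_hcoord_le[of "X m - X n" i for m n]
      by (metis (no_types, lifting) le_less_trans minus_hsum.rep_eq)
    then show "\<exists>M. \<forall>m\<ge>M. \<forall>n\<ge>M. norm (hcoord (X m) i - hcoord (X n) i) < e" by blast
  qed
  then have "\<exists>l. (\<lambda>n. hcoord (X n) i) \<longlonglongrightarrow> l" for i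
    using Cauchy_convergent_iff convergent_def by blast
  then obtain L where L: "(\<lambda>n. hcoord (X n) i) \<longlonglongrightarrow> L i" for i by metis
  have key: "L2_set (\<lambda>i. norm (hcoord (X n) i - L i)) F \<le> e"
    if M: "\<forall>m\<ge>M. \<forall>n\<ge>M. norm (X m - X n) < e" and "M \<le> n" "finite F" for M n F e
  proof (rule tendsto_upperbound)
    show "(\<lambda>m. L2_set (\<lambda>i. norm (hcoord (X n) i - hcoord (X m) i)) F)
        \<longlonglongrightarrow> L2_set (\<lambda>i. norm (hcoord (X n) i - L i)) F"
      unfolding L2_set_def by (intro tendsto_intros L)
    show "\<forall>\<^sub>F m in sequentially. L2_set (\<lambda>i. norm (hcoord (X n) i - hcoord (X m) i)) F \<le> e"
    proof (rule eventually_sequentiallyI[of M])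
      fix m assume "M \<le> m"
      then have "norm (X n - X m) < e" using M \<open>M \<le> n\<close> by blast
      then show "L2_set (\<lambda>i. norm (hcoord (X n) i - hcoord (X m) i)) F \<le> e"
        using L2_set_hcoord_le[OF \<open>finite F\<close>, of "X n - X m"] by (simp add: minus_hsum.rep_eq)
    qed
  qed simp
  obtain M0 where "\<forall>m\<ge>M0. \<forall>n\<ge>M0. norm (X m - X n) < 1" using CauchyD[OF C, of 1] by auto
  from hsum_L2_set_bdd(1)[OF key[OF this order_refl]]
  have "(\<lambda>i. (norm (hcoord (X M0) i - L i))\<^sup>2) summable_on UNIV" by simp
  with hcoord[of "X M0"] have "(\<lambda>i. (norm (hcoord (X M0) i + - (hcoord (X M0) i - L i)))\<^sup>2) summable_on UNIV"
    by (intro hsum_add(1)) (auto simp: norm_minus_commute)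
  then have "L \<in> {f. (\<lambda>i. (norm (f i))\<^sup>2) summable_on UNIV}" by simp
  then have l: "hcoord (Abs_hsum L) = L" by (rule Abs_hsum_inverse)
  have "X \<longlonglongrightarrow> Abs_hsum L"
  proof (rule LIMSEQ_I)
    fix r :: real assume "0 < r"
    then have "0 < r / 2" by simp
    then obtain M where M: "\<forall>m\<ge>M. \<forall>n\<ge>M. norm (X m - X n) < r / 2" using CauchyD[OF C] by blast
    have "norm (X n - Abs_hsum L) \<le> r / 2" if "M \<le> n" for n
      using hsum_L2_set_bdd(2)[OF key[OF M that]] by (simp add: norm_hsum.rep_eq minus_hsum.rep_eq l)
    with \<open>0 < r\<close> show "\<exists>no. \<forall>n\<ge>no. norm (X n - Abs_hsum L) < r" by fastforce
  qed
  then show "convergent X" by (rule convergentI)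
qed

instantiation hsum :: (type, chilbert_space) chilbert_space
begin
lift_definition scaleC_hsum :: "complex \<Rightarrow> ('a, 'b) hsum \<Rightarrow> ('a, 'b) hsum"
  is "\<lambda>c f i. c *\<^sub>C f i" by (rule hsum_scaleC)
lift_definition cinner_hsum :: "('a, 'b) hsum \<Rightarrow> ('a, 'b) hsum \<Rightarrow> complex"
  is "\<lambda>f g. \<Sum>\<^sub>\<infinity>i. cinner (f i) (g i)" .
instance
proof
  fix x y z :: "('a, 'b) hsum" and c d :: complex and r :: real
  show "c *\<^sub>C (x + y) = c *\<^sub>C x + c *\<^sub>C y" by transfer (simp add: scaleC_add_right)
  show "(c + d) *\<^sub>C x = c *\<^sub>C x + d *\<^sub>C x" by transfer (simp add: scaleC_add_left)
  show "c *\<^sub>C d *\<^sub>C x = (c * d) *\<^sub>C x" by transfer (simp add: scaleC_scaleC)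
  show "r *\<^sub>R x = complex_of_real r *\<^sub>C x" by transfer (simp add: scaleR_scaleC)
  show "cinner x y = cnj (cinner y x)"
    by transfer (simp add: infsum_cnj[symmetric] cinner_commute[symmetric] del: infsum_cnj)
  show "cinner x (y + z) = cinner x y + cinner x z"
    by transfer (simp add: cinner_add_right infsum_add hsum_cinner_summable)
  show "cinner x (c *\<^sub>C y) = c * cinner x y"
    by transfer (simp add: cinner_scaleC_right infsum_cmult_right')
  show "norm x = sqrt (Re (cinner x x))"
    by transfer (simp add: power2_norm_eq_cinner infsum_Re hsum_cinner_summable)
qed
end

type_synonym l2 = "(nat, complex) hsum"

section \<open>Operators and operator algebras\<close>

type_synonym 'h op = "'h \<Rightarrow> 'h"

definition bounded_clinear :: "('h::chilbert_space \<Rightarrow> 'k::chilbert_space) \<Rightarrow> bool"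
  where "bounded_clinear x \<longleftrightarrow> bounded_linear x \<and> (\<forall>c h. x (c *\<^sub>C h) = c *\<^sub>C x h)"

definition adj :: "'h::chilbert_space op \<Rightarrow> 'h op"
  where "adj x = (THE y. \<forall>g h. cinner (y g) h = cinner g (x h))"

definition closed_subspace :: "'h::chilbert_space op set \<Rightarrow> bool"
  where "closed_subspace M \<longleftrightarrow>
    (\<forall>x\<in>M. bounded_clinear x) \<and> (\<lambda>_. 0) \<in> M \<and>
    (\<forall>x\<in>M. \<forall>y\<in>M. (\<lambda>h. x h + y h) \<in> M) \<and> (\<forall>c. \<forall>x\<in>M. (\<lambda>h. c *\<^sub>C x h) \<in> M) \<and>
    (\<forall>x. bounded_clinear x \<and> (\<forall>\<epsilon>>0. \<exists>y\<in>M. onorm (\<lambda>h. x h - y h) < \<epsilon>) \<longrightarrow> x \<in> M)"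

definition closed_subalgebra :: "'h::chilbert_space op set \<Rightarrow> bool"
  where "closed_subalgebra M \<longleftrightarrow> closed_subspace M \<and> (\<forall>x\<in>M. \<forall>y\<in>M. x \<circ> y \<in> M)"

definition cstar_subalgebra :: "'h::chilbert_space op set \<Rightarrow> bool"
  where "cstar_subalgebra M \<longleftrightarrow> closed_subalgebra M \<and> (\<forall>x\<in>M. adj x \<in> M)"

definition linear_rep :: "'h::chilbert_space op set \<Rightarrow> ('h op \<Rightarrow> 'k::chilbert_space op) \<Rightarrow> bool"
  where "linear_rep M \<rho> \<longleftrightarrow>
    (\<forall>x\<in>M. bounded_clinear (\<rho> x)) \<and>
    (\<forall>x\<in>M. \<forall>y\<in>M. \<rho> (\<lambda>h. x h + y h) = (\<lambda>k. \<rho> x k + \<rho> y k)) \<and>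
    (\<forall>c. \<forall>x\<in>M. \<rho> (\<lambda>h. c *\<^sub>C x h) = (\<lambda>k. c *\<^sub>C \<rho> x k))"

definition homomorphism :: "'h::chilbert_space op set \<Rightarrow> ('h op \<Rightarrow> 'k::chilbert_space op) \<Rightarrow> bool"
  where "homomorphism M \<rho> \<longleftrightarrow>
    linear_rep M \<rho> \<and> (\<forall>x\<in>M. \<forall>y\<in>M. \<rho> (x \<circ> y) = \<rho> x \<circ> \<rho> y)"

definition star_rep :: "'h::chilbert_space op set \<Rightarrow> ('h op \<Rightarrow> 'k::chilbert_space op) \<Rightarrow> bool"
  where "star_rep M \<rho> \<longleftrightarrow> homomorphism M \<rho> \<and> (\<forall>x\<in>M. \<rho> (adj x) = adj (\<rho> x))"

text \<open>The identity of an algebra of operators need not be the identity operator.\<close>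

definition unital_on :: "'h::chilbert_space op set \<Rightarrow> ('h op \<Rightarrow> 'k::chilbert_space op) \<Rightarrow> bool"
  where "unital_on M \<rho> \<longleftrightarrow> (\<forall>u\<in>M. (\<forall>x\<in>M. u \<circ> x = x \<and> x \<circ> u = x) \<longrightarrow> \<rho> u = id)"

text \<open>\<open>mat_bounded n X C\<close>: the operator matrix \<open>X\<close> has norm at most \<open>\<bar>C\<bar>\<close> on the
  \<open>n\<close>-fold Hilbert space sum.\<close>

definition mat_bounded :: "nat \<Rightarrow> (nat \<Rightarrow> nat \<Rightarrow> 'h::chilbert_space op) \<Rightarrow> real \<Rightarrow> bool"
  where "mat_bounded n X C \<longleftrightarrow>
    (\<forall>v. (\<Sum>i<n. (norm (\<Sum>j<n. X i j (v j)))\<^sup>2) \<le> C\<^sup>2 * (\<Sum>j<n. (norm (v j))\<^sup>2))"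

definition completely_contractive ::
    "'h::chilbert_space op set \<Rightarrow> ('h op \<Rightarrow> 'k::chilbert_space op) \<Rightarrow> bool"
  where "completely_contractive M \<rho> \<longleftrightarrow>
    (\<forall>n X C. (\<forall>i<n. \<forall>j<n. X i j \<in> M) \<and> mat_bounded n X C
      \<longrightarrow> mat_bounded n (\<lambda>i j. \<rho> (X i j)) C)"

definition oa_rep :: "'h::chilbert_space op set \<Rightarrow> ('h op \<Rightarrow> 'k::chilbert_space op) \<Rightarrow> bool"
  where "oa_rep M \<rho> \<longleftrightarrow> homomorphism M \<rho> \<and> completely_contractive M \<rho>"

subsection \<open>Dilations and hyperrigidity\<close>

text \<open>The inclusion of \<open>H\<close> in \<open>K\<close> is given by a linear isometry \<open>V\<close>, so that
  \<open>P\<^sub>H \<rho>(a)|\<^sub>H\<close> is \<open>V\<^sup>* \<rho>(a) V\<close>.\<close>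

definition isometry :: "('h::chilbert_space \<Rightarrow> 'k::chilbert_space) \<Rightarrow> bool"
  where "isometry V \<longleftrightarrow> bounded_clinear V \<and> (\<forall>h. norm (V h) = norm h)"

definition dilation :: "'u::chilbert_space op set \<Rightarrow> ('h::chilbert_space \<Rightarrow> 'k::chilbert_space) \<Rightarrow>
    ('u op \<Rightarrow> 'k op) \<Rightarrow> ('u op \<Rightarrow> 'h op) \<Rightarrow> bool"
  where "dilation M V \<rho> \<phi> \<longleftrightarrow> oa_rep M \<rho> \<and> isometry V \<and>
    (\<forall>a\<in>M. \<forall>g h. cinner (V g) (\<rho> a (V h)) = cinner g (\<phi> a h))"

definition trivial_dilation :: "'u::chilbert_space op set \<Rightarrow>
    ('h::chilbert_space \<Rightarrow> 'k::chilbert_space) \<Rightarrow> ('u op \<Rightarrow> 'k op) \<Rightarrow> bool"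
  where "trivial_dilation M V \<rho> \<longleftrightarrow>
    (\<forall>a\<in>M. \<rho> a ` range V \<subseteq> range V \<and> adj (\<rho> a) ` range V \<subseteq> range V)"

text \<open>The type arguments name the Hilbert spaces of the dilations and of the
  \<open>*\<close>-representations; results are to be stated for arbitrary types.
  \<open>maximal_rep\<close> is meant for \<open>\<phi>\<close> that are representations of \<open>M\<close>, as restrictions of
  \<open>*\<close>-representations always are.\<close>

definition maximal_rep :: "'k::chilbert_space itself \<Rightarrow> 'u::chilbert_space op set \<Rightarrow>
    ('u op \<Rightarrow> 'h::chilbert_space op) \<Rightarrow> bool"
  where "maximal_rep _ M \<phi> \<longleftrightarrow>
    (\<forall>(V :: 'h \<Rightarrow> 'k) \<rho>. dilation M V \<rho> \<phi> \<longrightarrow> trivial_dilation M V \<rho>)"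

definition hyperrigid :: "'h::chilbert_space itself \<Rightarrow> 'k::chilbert_space itself \<Rightarrow>
    'u::chilbert_space op set \<Rightarrow> 'u op set \<Rightarrow> bool"
  where "hyperrigid _ _ C M \<longleftrightarrow> C = cstar_subalgebra hull M \<and>
    (\<forall>\<pi> :: 'u op \<Rightarrow> 'h op. star_rep C \<pi> \<and> inj_on \<pi> C \<and> unital_on C \<pi>
      \<longrightarrow> maximal_rep TYPE('k) M \<pi>)"

section \<open>C*-correspondences of operators and their algebras\<close>

text \<open>Here \<open>A\<close> is a C*-algebra of operators and \<open>E\<close> a closed space of operators with
  \<open>A E A \<subseteq> E\<close> and \<open>E\<^sup>* E \<subseteq> A\<close>, with the operations \<open>a \<cdot> \<xi> \<cdot> b = a \<xi> b\<close> and
  \<open>\<langle>\<xi>, \<eta>\<rangle> = \<xi>\<^sup>* \<eta>\<close>; the module norm of \<open>E\<close> is then the operator norm. Maps on \<open>E\<close> are taken to be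
  \<open>0\<close> outside \<open>E\<close>, so that equality of functions is equality on \<open>E\<close>.\<close>

definition on_E :: "'f::chilbert_space op set \<Rightarrow> ('f op \<Rightarrow> 'f op) \<Rightarrow> 'f op \<Rightarrow> 'f op"
  where "on_E E k = (\<lambda>\<zeta>. if \<zeta> \<in> E then k \<zeta> else (\<lambda>_. 0))"

definition left_action :: "'f::chilbert_space op set \<Rightarrow> 'f op \<Rightarrow> 'f op \<Rightarrow> 'f op"
  where "left_action E a = on_E E (\<lambda>\<zeta>. a \<circ> \<zeta>)"

definition theta :: "'f::chilbert_space op set \<Rightarrow> 'f op \<Rightarrow> 'f op \<Rightarrow> 'f op \<Rightarrow> 'f op"
  where "theta E \<xi> \<eta> = on_E E (\<lambda>\<zeta>. \<xi> \<circ> (adj \<eta> \<circ> \<zeta>))"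

text \<open>Scalars are absorbed in the \<open>\<xi> i\<close>, so this is the linear span of the \<open>theta\<close>.\<close>

definition finite_ranks :: "'f::chilbert_space op set \<Rightarrow> ('f op \<Rightarrow> 'f op) set"
  where "finite_ranks E =
    {(\<lambda>\<zeta> h. \<Sum>i<n. theta E (\<xi> i) (\<eta> i) \<zeta> h) | (n::nat) \<xi> \<eta>. \<forall>i<n. \<xi> i \<in> E \<and> \<eta> i \<in> E}"

text \<open>\<open>E_bounded E k b\<close>: the norm of \<open>k\<close> as an operator on the Banach space \<open>E\<close> is at most \<open>b\<close>.\<close>

definition E_bounded :: "'f::chilbert_space op set \<Rightarrow> ('f op \<Rightarrow> 'f op) \<Rightarrow> real \<Rightarrow> bool"
  where "E_bounded E k b \<longleftrightarrow> (\<forall>\<zeta>\<in>E. onorm (k \<zeta>) \<le> b * onorm \<zeta>)"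

definition compacts :: "'f::chilbert_space op set \<Rightarrow> ('f op \<Rightarrow> 'f op) set"
  where "compacts E = {k. k ` E \<subseteq> E \<and> on_E E k = k \<and>
    (\<forall>\<epsilon>>0. \<exists>f\<in>finite_ranks E. E_bounded E (\<lambda>\<zeta> h. k \<zeta> h - f \<zeta> h) \<epsilon>)}"

definition left_kernel :: "'f::chilbert_space op set \<Rightarrow> 'f op set \<Rightarrow> 'f op set"
  where "left_kernel A E = {a \<in> A. left_action E a = on_E E (\<lambda>_ _. 0)}"

definition katsura_ideal :: "'f::chilbert_space op set \<Rightarrow> 'f op set \<Rightarrow> 'f op set"
  where "katsura_ideal A E =
    {a \<in> A. (\<forall>b\<in>left_kernel A E. a \<circ> b = (\<lambda>_. 0)) \<and> left_action E a \<in> compacts E}"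

definition corr_rep :: "'f::chilbert_space op set \<Rightarrow> 'f op set \<Rightarrow>
    ('f op \<Rightarrow> 'h::chilbert_space op) \<Rightarrow> ('f op \<Rightarrow> 'h op) \<Rightarrow> bool"
  where "corr_rep A E \<pi> t \<longleftrightarrow> star_rep A \<pi> \<and> linear_rep E t \<and>
    (\<forall>\<xi>\<in>E. \<forall>\<eta>\<in>E. adj (t \<xi>) \<circ> t \<eta> = \<pi> (adj \<xi> \<circ> \<eta>)) \<and>
    (\<forall>a\<in>A. \<forall>\<xi>\<in>E. \<pi> a \<circ> t \<xi> = t (left_action E a \<xi>))"

text \<open>\<open>\<psi>\<close> is the map \<open>\<psi>\<^sub>t\<close> on the compact operators; being linear, continuous and prescribed on the
  \<open>theta\<close>, it is unique, and it exists for every representation.\<close>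

definition induced_map :: "'f::chilbert_space op set \<Rightarrow> ('f op \<Rightarrow> 'h::chilbert_space op) \<Rightarrow>
    (('f op \<Rightarrow> 'f op) \<Rightarrow> 'h op) \<Rightarrow> bool"
  where "induced_map E t \<psi> \<longleftrightarrow>
    (\<forall>k\<in>compacts E. bounded_clinear (\<psi> k)) \<and>
    (\<forall>k\<in>compacts E. \<forall>l\<in>compacts E. \<psi> (\<lambda>\<zeta> h. k \<zeta> h + l \<zeta> h) = (\<lambda>h. \<psi> k h + \<psi> l h)) \<and>
    (\<forall>c. \<forall>k\<in>compacts E. \<psi> (\<lambda>\<zeta> h. c *\<^sub>C k \<zeta> h) = (\<lambda>h. c *\<^sub>C \<psi> k h)) \<and>
    (\<exists>C. \<forall>k\<in>compacts E. \<forall>b\<ge>0. E_bounded E k b \<longrightarrow> onorm (\<psi> k) \<le> C * b) \<and>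
    (\<forall>\<xi>\<in>E. \<forall>\<eta>\<in>E. \<psi> (theta E \<xi> \<eta>) = t \<xi> \<circ> adj (t \<eta>))"

definition covariant_rep :: "'f::chilbert_space op set \<Rightarrow> 'f op set \<Rightarrow>
    ('f op \<Rightarrow> 'h::chilbert_space op) \<Rightarrow> ('f op \<Rightarrow> 'h op) \<Rightarrow> bool"
  where "covariant_rep A E \<pi> t \<longleftrightarrow> corr_rep A E \<pi> t \<and>
    (\<exists>\<psi>. induced_map E t \<psi> \<and> (\<forall>a\<in>katsura_ideal A E. \<pi> a = \<psi> (left_action E a)))"

subsection \<open>The universal algebras\<close>

text \<open>The universal C*-algebras are realised in the direct sum of all (covariant) representations
  on \<^typ>\<open>l2\<close>. For separable \<open>A\<close> and \<open>E\<close>, as here, this gives the universal object: norms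
  of elements in an arbitrary representation are determined by its separable subrepresentations, and
  those occur on \<^typ>\<open>l2\<close> because \<open>*\<close>-representations may be degenerate. The direct sum
  acts as zero on the coordinates that are not in \<open>R\<close>.\<close>

type_synonym 'f rep_index = "('f op \<Rightarrow> l2 op) \<times> ('f op \<Rightarrow> l2 op)"
type_synonym 'f univ_space = "('f rep_index, l2) hsum"

definition corr_reps :: "'f::chilbert_space op set \<Rightarrow> 'f op set \<Rightarrow> 'f rep_index set"
  where "corr_reps A E = {(\<pi>, t). corr_rep A E \<pi> t}"

definition covariant_reps :: "'f::chilbert_space op set \<Rightarrow> 'f op set \<Rightarrow> 'f rep_index set"
  where "covariant_reps A E = {(\<pi>, t). covariant_rep A E \<pi> t}"

definition dsum :: "'i set \<Rightarrow> ('i \<Rightarrow> 'h::chilbert_space op) \<Rightarrow> ('i, 'h) hsum op"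
  where "dsum R X = (\<lambda>f. Abs_hsum (\<lambda>r. if r \<in> R then X r (hcoord f r) else 0))"

definition univ_gens :: "'f::chilbert_space op set \<Rightarrow> 'f op set \<Rightarrow> 'f rep_index set \<Rightarrow>
    'f univ_space op set"
  where "univ_gens A E R =
    {dsum R (\<lambda>(\<pi>, t). \<pi> a) | a. a \<in> A} \<union> {dsum R (\<lambda>(\<pi>, t). t \<xi>) | \<xi>. \<xi> \<in> E}"

definition toeplitz_algebra :: "'f::chilbert_space op set \<Rightarrow> 'f op set \<Rightarrow> 'f univ_space op set"
  where "toeplitz_algebra A E = cstar_subalgebra hull univ_gens A E (corr_reps A E)"

definition cuntz_pimsner_algebra :: "'f::chilbert_space op set \<Rightarrow> 'f op set \<Rightarrow> 'f univ_space op set"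
  where "cuntz_pimsner_algebra A E = cstar_subalgebra hull univ_gens A E (covariant_reps A E)"

definition tensor_algebra :: "'f::chilbert_space op set \<Rightarrow> 'f op set \<Rightarrow> 'f univ_space op set"
  where "tensor_algebra A E = closed_subalgebra hull univ_gens A E (corr_reps A E)"

text \<open>The canonical quotient map from the Toeplitz algebra to the Cuntz-Pimsner algebra restricts
  a direct sum to its covariant coordinates.\<close>

definition cp_quotient :: "'f::chilbert_space op set \<Rightarrow> 'f op set \<Rightarrow>
    'f univ_space op \<Rightarrow> 'f univ_space op"
  where "cp_quotient A E x = dsum (covariant_reps A E) (\<lambda>_ h. h) \<circ> x"

section \<open>Monomial ideals\<close>

text \<open>Words under concatenation form the free monoid, whose monoid algebra
  \<^typ>\<open>'d list \<Rightarrow>\<^sub>0 complex\<close> is the ring of polynomials in noncommuting variables indexed by the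
  finite type \<^typ>\<open>'d\<close>.\<close>

instantiation list :: (type) monoid_add
begin
definition zero_list :: "'a list" where "zero_list = []"
definition plus_list :: "'a list \<Rightarrow> 'a list \<Rightarrow> 'a list" where "plus_list = (@)"
instance by standard (simp_all add: zero_list_def plus_list_def)
end

definition xmon :: "'d list \<Rightarrow> 'd list \<Rightarrow>\<^sub>0 complex"
  where "xmon \<mu> = Poly_Mapping.single \<mu> 1"

lemma xmon_Nil: "xmon [] = 1"
  by (simp add: xmon_def zero_list_def[symmetric])

lemma xmon_Cons: "xmon (i # \<mu>) = xmon [i] * xmon \<mu>"
  by (simp add: xmon_def mult_single plus_list_def)

definition two_sided_ideal :: "'r::ring_1 set \<Rightarrow> bool"
  where "two_sided_ideal I \<longleftrightarrow> 0 \<in> I \<and> (\<forall>p\<in>I. \<forall>q\<in>I. p + q \<in> I) \<and>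
    (\<forall>p\<in>I. \<forall>r. r * p \<in> I \<and> p * r \<in> I)"

definition monomial_ideal :: "('d list \<Rightarrow>\<^sub>0 complex) set \<Rightarrow> bool"
  where "monomial_ideal I \<longleftrightarrow>
    (\<exists>S. (\<forall>\<mu>\<in>S. 2 \<le> length \<mu>) \<and> I = two_sided_ideal hull (xmon ` S))"

definition allowed_words :: "('d list \<Rightarrow>\<^sub>0 complex) set \<Rightarrow> 'd list set"
  where "allowed_words I = {\<mu>. xmon \<mu> \<notin> I}"

definition orthonormal_basis :: "'i set \<Rightarrow> ('i \<Rightarrow> 'f::chilbert_space) \<Rightarrow> bool"
  where "orthonormal_basis L e \<longleftrightarrow>
    (\<forall>\<mu>\<in>L. \<forall>\<nu>\<in>L. cinner (e \<mu>) (e \<nu>) = (if \<mu> = \<nu> then 1 else 0)) \<and>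
    closure {\<Sum>\<mu>\<in>F. c \<mu> *\<^sub>C e \<mu> | F c. finite F \<and> F \<subseteq> L} = UNIV"

text \<open>The Hilbert space is \<^typ>\<open>'f\<close> with basis \<open>e \<mu>\<close> for the allowed words \<open>\<mu>\<close> (the values of
  \<open>e\<close> at other words play no role), and \<open>T\<close> is the tuple of shift operators, which is determined by
  \<open>I\<close> and \<open>e\<close>.\<close>

definition monomial_shifts :: "('d list \<Rightarrow>\<^sub>0 complex) set \<Rightarrow> ('d list \<Rightarrow> 'f::chilbert_space) \<Rightarrow>
    ('d \<Rightarrow> 'f op) \<Rightarrow> bool"
  where "monomial_shifts I e T \<longleftrightarrow> orthonormal_basis (allowed_words I) e \<and>
    (\<forall>i. bounded_clinear (T i) \<and>
      (\<forall>\<nu>\<in>allowed_words I. T i (e \<nu>) = (if i # \<nu> \<in> allowed_words I then e (i # \<nu>) else 0)))"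

definition word_op :: "('d \<Rightarrow> 'f op) \<Rightarrow> 'd list \<Rightarrow> 'f op"
  where "word_op T \<mu> = foldr (\<lambda>i x. T i \<circ> x) \<mu> id"

definition monomial_A :: "('d list \<Rightarrow>\<^sub>0 complex) set \<Rightarrow> ('d \<Rightarrow> 'f::chilbert_space op) \<Rightarrow> 'f op set"
  where "monomial_A I T =
    cstar_subalgebra hull {adj (word_op T \<mu>) \<circ> word_op T \<mu> | \<mu>. \<mu> \<in> allowed_words I}"

definition monomial_E :: "('d list \<Rightarrow>\<^sub>0 complex) set \<Rightarrow> ('d \<Rightarrow> 'f::chilbert_space op) \<Rightarrow> 'f op set"
  where "monomial_E I T = closed_subspace hull {T i \<circ> a | i a. a \<in> monomial_A I T}"

end

theory Submission
  imports Defs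
begin

text \<open>
  The identity of \<open>E\<close> is the left action of an element of Katsura's ideal, and this is what makes every
  dilation trivial. The shifts satisfy \<open>T\<^sub>i\<^sup>* T\<^sub>j = 0\<close> for \<open>i \<noteq> j\<close>, and they form a finite frame of \<open>E\<close>: its
  identity is the compact operator \<open>\<Sum>\<^sub>i \<Theta>\<^sub>i\<close>, where \<open>\<Theta>\<^sub>i\<close> is the rank-one operator of the pair \<open>T\<^sub>i\<close>, \<open>T\<^sub>i\<close>.
  The kernel of the left action lives on the vacuum vector: it is zero, or it consists of the
  multiples of the vacuum projection. So \<open>1\<close>, or \<open>1\<close> minus the vacuum projection, is an element \<open>p\<close> of
  Katsura's ideal that acts as the identity. Covariance at \<open>p\<close> says that \<open>P = \<Sum>\<^sub>i S\<^sub>i S\<^sub>i\<^sup>*\<close> in the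
  Cuntz-Pimsner algebra, where \<open>P\<close> and \<open>S\<^sub>i\<close> are the images of \<open>p\<close> and \<open>T\<^sub>i\<close> (\<open>univ_covariance\<close>).

  Let \<open>\<rho>\<close> be a dilation, through an isometry \<open>V\<close>, of the restriction of a \<open>*\<close>-representation \<open>\<pi>\<close>. The
  algebra \<open>A\<close> is generated, as a closed algebra, by the projections \<open>T\<^sub>\<mu>\<^sup>* T\<^sub>\<mu>\<close>. Their images under \<open>\<rho>\<close> are
  contractive idempotents, hence self-adjoint, and the range of \<open>V\<close> reduces a projection whose
  compression is a projection (\<open>reduces_projection\<close>). Two norm comparisons treat the \<open>S\<^sub>i\<close>
  (\<open>reduces_row\<close>). Since \<open>S\<^sub>i\<^sup>* S\<^sub>i\<close> is the image of a projection \<open>Q\<^sub>i\<close> of \<open>A\<close> with \<open>S\<^sub>i Q\<^sub>i = S\<^sub>i\<close>, the norm of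
  \<open>\<rho>(S\<^sub>i) V h\<close> is at most that of its compression \<open>\<pi>(S\<^sub>i) h\<close>, so that \<open>\<rho>(S\<^sub>i) V h = V \<pi>(S\<^sub>i) h\<close>. For the
  adjoints, the row of all \<open>S\<^sub>i\<close> is a contraction and \<open>P S\<^sub>i = S\<^sub>i\<close>, so complete contractivity of \<open>\<rho>\<close> gives
  \<open>\<Sum>\<^sub>i \<parallel>\<rho>(S\<^sub>i)\<^sup>* V h\<parallel>\<^sup>2 \<le> \<parallel>\<pi>(P) h\<parallel>\<^sup>2 = \<Sum>\<^sub>i \<parallel>\<pi>(S\<^sub>i)\<^sup>* h\<parallel>\<^sup>2\<close>, where the equality is covariance. Again the vectors
  on the left are no longer than their compressions on the right, and lie in the range of \<open>V\<close>. The
  elements of the tensor algebra that the range of \<open>V\<close> reduces form a closed subalgebra, and it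
  contains the generators (\<open>maximal\<close>).

  The universal algebras consist of direct sums over all representations on a fixed space, and these
  sums are bounded operators because \<open>*\<close>-representations of \<open>A\<close> are contractive
  (\<open>star_rep_contractive\<close>). Adjoints exist by the Riesz representation theorem.
\<close>

section \<open>Geometry of complex Hilbert spaces\<close>

lemma scaleC_minus1: "(- 1) *\<^sub>C x = - (x::'a::chilbert_space)"
  using scaleR_scaleC[of "-1" x] by simp

lemma scaleC_zero_left [simp]: "0 *\<^sub>C x = (0::'a::chilbert_space)"
  using scaleR_scaleC[of 0 x] by simp

lemma cinner_zero_right [simp]: "cinner x (0::'a::chilbert_space) = 0"
  using cinner_scaleC_right[of x 0 0] by simp

lemma cinner_zero_left [simp]: "cinner (0::'a::chilbert_space) x = 0"
  using cinner_scaleC_left[of 0 0 x] by simp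

lemma cinner_minus_right: "cinner x (- y) = - cinner x (y::'a::chilbert_space)"
  using cinner_scaleC_right[of x "-1" y] by (simp add: scaleC_minus1)

lemma cinner_minus_left: "cinner (- x) y = - cinner x (y::'a::chilbert_space)"
  using cinner_scaleC_left[of "-1" x y] by (simp add: scaleC_minus1)

lemma cinner_diff_right: "cinner x (y - z) = cinner x y - cinner x (z::'a::chilbert_space)"
  using cinner_add_right[of x y "- z"] by (simp add: cinner_minus_right)

lemma cinner_diff_left: "cinner (x - y) z = cinner x z - cinner y (z::'a::chilbert_space)"
  using cinner_add_left[of x "- y" z] by (simp add: cinner_minus_left)

lemma cinner_sum_right: "cinner x (\<Sum>i\<in>F. f i) = (\<Sum>i\<in>F. cinner x (f i :: 'a::chilbert_space))"
  by (induction F rule: infinite_finite_induct) (auto simp: cinner_add_right)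

lemma cinner_sum_left: "cinner (\<Sum>i\<in>F. f i) x = (\<Sum>i\<in>F. cinner (f i :: 'a::chilbert_space) x)"
  by (induction F rule: infinite_finite_induct) (auto simp: cinner_add_left)

lemma scaleC_diff_right: "c *\<^sub>C (x - y) = c *\<^sub>C x - c *\<^sub>C (y::'a::chilbert_space)"
  using scaleC_add_right[of c "x - y" y] by (simp add: algebra_simps)

lemma Re_cinner_commute: "Re (cinner x y) = Re (cinner y (x::'a::chilbert_space))"
  using cinner_commute[of x y] by simp

lemma norm_add_sq:
  "(norm (x + y))\<^sup>2 = (norm x)\<^sup>2 + 2 * Re (cinner x y) + (norm (y::'a::chilbert_space))\<^sup>2"
  by (simp add: power2_norm_eq_cinner cinner_add_left cinner_add_right Re_cinner_commute[of y x])

lemma norm_diff_sq: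
  "(norm (x - y))\<^sup>2 = (norm x)\<^sup>2 - 2 * Re (cinner x y) + (norm (y::'a::chilbert_space))\<^sup>2"
  using norm_add_sq[of x "- y"] by (simp add: cinner_minus_right)

lemma cinner_ext:
  assumes "\<And>z. cinner z x = cinner z (y::'a::chilbert_space)"
  shows "x = y"
  using assms[of "x - y"] cinner_same[of "x - y"] by (simp add: cinner_diff_right)

text \<open>First-order optimality: the linear part of a quadratic function with a minimum at \<open>0\<close>
  vanishes, as seen along the direction \<open>- cnj w\<close>.\<close>

lemma linear_part_zero:
  fixes w :: complex
  assumes "\<And>c. 0 \<le> 2 * Re (c * w) + (cmod c)\<^sup>2 * B"
  shows "w = 0"
proof -
  define s where "s = 1 / (\<bar>B\<bar> + 1)"
  have s: "0 < s" "s * \<bar>B\<bar> < 1" by (auto simp: s_def divide_simps)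
  have "Re (- complex_of_real s * cnj w * w) = - s * (cmod w)\<^sup>2"
    unfolding cmod_power2 by (simp add: power2_eq_square algebra_simps)
  moreover have "(cmod (- complex_of_real s * cnj w))\<^sup>2 = s\<^sup>2 * (cmod w)\<^sup>2"
    using s by (simp add: norm_mult power_mult_distrib)
  ultimately have "0 \<le> 2 * (- s * (cmod w)\<^sup>2) + s\<^sup>2 * (cmod w)\<^sup>2 * B"
    using assms[of "- complex_of_real s * cnj w"] by simp
  also have "\<dots> = s * (cmod w)\<^sup>2 * (s * B - 2)" by (simp add: power2_eq_square algebra_simps)
  finally have "0 \<le> (s * (cmod w)\<^sup>2) * (s * B - 2)" .
  moreover have "s * B - 2 < 0" using s abs_ge_self[of B]
    by (smt (verit) mult_left_mono)
  ultimately have "s * (cmod w)\<^sup>2 \<le> 0" by (simp add: zero_le_mult_iff)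
  with s show ?thesis by (simp add: mult_le_0_iff)
qed

lemma orthogonal_if_minimal:
  fixes u w :: "'a::chilbert_space"
  assumes "\<And>c. norm u \<le> norm (u + c *\<^sub>C w)"
  shows "cinner u w = 0"
proof (rule linear_part_zero)
  fix c
  have "(norm u)\<^sup>2 \<le> (norm (u + c *\<^sub>C w))\<^sup>2" using assms by (simp add: power_mono)
  then show "0 \<le> 2 * Re (c * cinner u w) + (cmod c)\<^sup>2 * (norm w)\<^sup>2"
    by (simp add: norm_add_sq cinner_scaleC_right norm_scaleC power_mult_distrib)
qed

lemma cinner_cauchy_schwarz: "cmod (cinner x y) \<le> norm x * norm (y::'a::chilbert_space)"
proof (cases "x = 0 \<or> y = 0")
  case False
  then have nz: "norm x \<noteq> 0" "norm y \<noteq> 0" by auto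
  \<comment> \<open>Normalise, rotate \<open>y\<close> so that the inner product is nonnegative, and expand the squared distance.\<close>
  define a where "a = (1 / norm x) *\<^sub>R x"
  define z where "z = cinner a ((1 / norm y) *\<^sub>R y)"
  define u where "u = (if z = 0 then 1 else cnj z / cmod z)"
  define b where "b = u *\<^sub>C ((1 / norm y) *\<^sub>R y)"
  have u: "cmod u = 1" "u * z = complex_of_real (cmod z)"
    using complex_norm_square[of z]
    by (auto simp: u_def norm_divide power2_eq_square mult.commute[of "cnj z"] nonzero_divide_eq_eq)
  have "norm a = 1" "norm b = 1" using nz u by (auto simp: a_def b_def norm_scaleC)
  moreover have "cinner a b = complex_of_real (cmod z)"
    using u by (simp add: b_def z_def cinner_scaleC_right)
  ultimately have "cmod z \<le> 1" using norm_diff_sq[of a b] by (smt (verit) Re_complex_of_real one_power2 zero_le_power2)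
  moreover have "z = cinner x y / (norm x * norm y)"
    by (simp add: z_def a_def scaleR_scaleC cinner_scaleC_left cinner_scaleC_right)
  ultimately show ?thesis using nz by (simp add: norm_divide norm_mult divide_simps split: if_splits)
qed auto

subsection \<open>Bounded operators\<close>

lemma bounded_clinear_linear:
  assumes "bounded_clinear x"
  shows bounded_clinear_bounded: "bounded_linear x"
    and bounded_clinear_add: "x (h + g) = x h + x g"
    and bounded_clinear_diff: "x (h - g) = x h - x g"
    and bounded_clinear_scaleC: "x (c *\<^sub>C h) = c *\<^sub>C x h"
    and bounded_clinear_zero: "x 0 = 0"
    and bounded_clinear_sum: "x (\<Sum>i\<in>F. f i) = (\<Sum>i\<in>F. x (f i))"
proof -
  show b: "bounded_linear x" using assms by (simp add: bounded_clinear_def)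
  interpret bounded_linear x by (rule b)
  show "x (h + g) = x h + x g" "x (h - g) = x h - x g" "x 0 = 0"
    "x (\<Sum>i\<in>F. f i) = (\<Sum>i\<in>F. x (f i))" by (auto simp: add diff sum)
  show "x (c *\<^sub>C h) = c *\<^sub>C x h" using assms by (simp add: bounded_clinear_def)
qed

lemma bounded_clinearI:
  assumes "\<And>g h. x (g + h) = x g + x h" "\<And>c h. x (c *\<^sub>C h) = c *\<^sub>C x h"
    "\<And>h. norm (x h) \<le> B * norm h"
  shows "bounded_clinear x"
  unfolding bounded_clinear_def
  using assms by (auto simp: scaleR_scaleC mult.commute intro!: bounded_linear_intro[where K = B])

lemma bounded_clinear_norm_le:
  "bounded_clinear x \<Longrightarrow> norm (x h) \<le> onorm x * norm h"
  by (auto simp: bounded_clinear_def intro: onorm)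

lemma bounded_clinear_onorm_nonneg: "bounded_clinear x \<Longrightarrow> 0 \<le> onorm x"
  by (auto simp: bounded_clinear_def intro: onorm_pos_le)

lemma bounded_clinear_id [simp]: "bounded_clinear id" "bounded_clinear (\<lambda>h. h)"
  by (auto simp: bounded_clinear_def id_def)

lemma bounded_clinear_const_zero [simp]: "bounded_clinear (\<lambda>_. 0)"
  by (simp add: bounded_clinear_def)

lemma bounded_clinear_comp: "bounded_clinear x \<Longrightarrow> bounded_clinear y \<Longrightarrow> bounded_clinear (x \<circ> y)"
  using bounded_linear_compose[of x y] by (auto simp: bounded_clinear_def o_def)

lemma bounded_clinear_plus:
  "bounded_clinear x \<Longrightarrow> bounded_clinear y \<Longrightarrow> bounded_clinear (\<lambda>h. x h + y h)"
  by (auto simp: bounded_clinear_def bounded_linear_add scaleC_add_right)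

lemma bounded_clinear_scale:
  assumes "bounded_clinear x" shows "bounded_clinear (\<lambda>h. c *\<^sub>C x h)"
proof (rule bounded_clinearI)
  show "norm (c *\<^sub>C x h) \<le> (cmod c * onorm x) * norm h" for h
    using bounded_clinear_norm_le[OF assms, of h] by (simp add: norm_scaleC mult_left_mono mult.assoc)
qed (use assms in \<open>auto simp: bounded_clinear_add bounded_clinear_scaleC scaleC_add_right
  scaleC_scaleC mult.commute\<close>)

lemma bounded_clinear_minus:
  "bounded_clinear x \<Longrightarrow> bounded_clinear y \<Longrightarrow> bounded_clinear (\<lambda>h. x h - y h)"
  by (auto simp: bounded_clinear_def bounded_linear_sub scaleC_diff_right)

subsection \<open>The Riesz representation theorem and adjoints\<close>

text \<open>A minimising sequence is Cauchy, by the parallelogram law.\<close>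

lemma minimizer_exists:
  fixes f :: "'h::chilbert_space \<Rightarrow> complex"
  assumes add: "\<And>g h. f (g + h) = f g + f h" and sc: "\<And>c h. f (c *\<^sub>C h) = c * f h"
    and bd: "\<And>h. cmod (f h) \<le> B * norm h"
  shows "\<exists>y. \<forall>h. (norm y)\<^sup>2 - 2 * Re (f y) \<le> (norm h)\<^sup>2 - 2 * Re (f h)"
proof -
  define J where "J h = (norm h)\<^sup>2 - 2 * Re (f h)" for h
  have fR: "f (r *\<^sub>R h) = r * f h" for r h using sc by (simp add: scaleR_scaleC)
  have fdiff: "f (g - h) = f g - f h" for g h
    using add[of "g - h" h] by simp
  have low: "- B\<^sup>2 \<le> J h" for h
  proof -
    have "Re (f h) \<le> B * norm h" using complex_Re_le_cmod bd order_trans by blast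
    moreover have "0 \<le> (norm h - B)\<^sup>2" by simp
    ultimately show ?thesis by (simp add: J_def power2_eq_square algebra_simps)
  qed
  define m where "m = Inf (range J)"
  have bb: "bdd_below (range J)" using low by (intro bdd_belowI[of _ "- B\<^sup>2"]) auto
  have m_le: "m \<le> J h" for h unfolding m_def using bb by (intro cInf_lower) auto
  have "\<exists>h. J h < m + e" if "0 < e" for e
    using that cInf_lessD[of "range J" "m + e"] by (auto simp: m_def)
  then have "\<exists>h. J h < m + 1 / real (Suc n)" for n by simp
  then obtain X where X: "\<And>n. J (X n) < m + 1 / real (Suc n)" by metis
  have par: "(norm (g - h))\<^sup>2 \<le> 2 * (J g - m) + 2 * (J h - m)" for g h
  proof -
    have "4 * J ((1/2) *\<^sub>R (g + h)) = (norm (g + h))\<^sup>2 - 4 * Re (f g + f h)"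
    proof -
      have "norm ((1/2) *\<^sub>R (g + h)) = norm (g + h) / 2" by simp
      moreover have "f ((1/2) *\<^sub>R (g + h)) = (f g + f h) / 2" using fR[of "1/2" "g + h"] add by simp
      ultimately show ?thesis by (simp only: J_def power_divide) (simp add: field_simps)
    qed
    moreover have "(norm (g + h))\<^sup>2 + (norm (g - h))\<^sup>2 = 2 * (norm g)\<^sup>2 + 2 * (norm h)\<^sup>2"
      by (simp add: norm_add_sq norm_diff_sq)
    ultimately show ?thesis using m_le[of "(1/2) *\<^sub>R (g + h)"] by (simp add: J_def)
  qed
  have "Cauchy X"
  proof (rule CauchyI)
    fix e :: real assume "0 < e"
    then obtain N where N: "inverse (real (Suc N)) < e\<^sup>2 / 4"
      using reals_Archimedean[of "e\<^sup>2 / 4"] by auto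
    have "norm (X k - X n) < e" if "N \<le> k" "N \<le> n" for k n
    proof -
      have J: "J (X j) - m < e\<^sup>2 / 4" if "N \<le> j" for j
      proof -
        have "1 / real (Suc j) \<le> 1 / real (Suc N)" using that by (intro divide_left_mono) auto
        then show ?thesis using X[of j] N by (simp add: inverse_eq_divide)
      qed
      have "(norm (X k - X n))\<^sup>2 < e\<^sup>2"
      proof -
        have "2 * (J (X k) - m) + 2 * (J (X n) - m) < 2 * (e\<^sup>2 / 4) + 2 * (e\<^sup>2 / 4)"
          by (intro add_strict_mono mult_strict_left_mono J that) auto
        also have "\<dots> = e\<^sup>2" by simp
        finally show ?thesis using par[of "X k" "X n"] by (rule le_less_trans[rotated])
      qed
      then show ?thesis using \<open>0 < e\<close> by (simp add: power2_less_imp_less)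
    qed
    then show "\<exists>M. \<forall>k\<ge>M. \<forall>n\<ge>M. norm (X k - X n) < e" by blast
  qed
  then obtain y where y: "X \<longlonglongrightarrow> y" using Cauchy_convergent_iff convergent_def by blast
  have "(\<lambda>n. f (X n) - f y) \<longlonglongrightarrow> 0"
  proof (rule Lim_null_comparison)
    show "\<forall>\<^sub>F n in sequentially. norm (f (X n) - f y) \<le> B * norm (X n - y)"
      using bd by (simp add: fdiff[symmetric])
    show "(\<lambda>n. B * norm (X n - y)) \<longlonglongrightarrow> 0"
      using tendsto_mult_right_zero[OF tendsto_norm_zero[OF LIM_zero[OF y]]] by simp
  qed
  then have "(\<lambda>n. f (X n)) \<longlonglongrightarrow> f y" by (rule LIM_zero_cancel)
  then have "(\<lambda>n. J (X n)) \<longlonglongrightarrow> J y" unfolding J_def by (intro tendsto_intros y)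
  moreover have "(\<lambda>n. m + 1 / real (Suc n)) \<longlonglongrightarrow> m"
    using tendsto_add[OF tendsto_const lim_1_over_n[THEN LIMSEQ_Suc], of m] by simp
  ultimately have "J y \<le> m"
    by (rule LIMSEQ_le) (use X in \<open>auto intro: less_imp_le\<close>)
  then have "J y \<le> J h" for h using m_le order_trans by blast
  then show ?thesis unfolding J_def by blast
qed

text \<open>The representing vector is the minimiser of \<open>\<parallel>h\<parallel>\<^sup>2 - 2 Re (f h)\<close>, by first-order optimality.\<close>

lemma riesz_representation:
  fixes f :: "'h::chilbert_space \<Rightarrow> complex"
  assumes add: "\<And>g h. f (g + h) = f g + f h" and sc: "\<And>c h. f (c *\<^sub>C h) = c * f h"
    and bd: "\<And>h. cmod (f h) \<le> B * norm h"
  shows "\<exists>y. \<forall>h. f h = cinner y h"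
proof -
  obtain y where y: "\<And>h. (norm y)\<^sup>2 - 2 * Re (f y) \<le> (norm h)\<^sup>2 - 2 * Re (f h)"
    using minimizer_exists[OF assms] by blast
  have "cinner y h - f h = 0" for h
  proof (rule linear_part_zero)
    fix c
    show "0 \<le> 2 * Re (c * (cinner y h - f h)) + (cmod c)\<^sup>2 * (norm h)\<^sup>2"
      using y[of "y + c *\<^sub>C h"]
      by (simp add: norm_add_sq cinner_scaleC_right add sc norm_scaleC power_mult_distrib algebra_simps)
  qed
  then show ?thesis by (metis eq_iff_diff_eq_0)
qed

lemma adj_eqI:
  assumes "\<And>g h. cinner (y g) h = cinner g (x h)"
  shows "adj x = y"
  unfolding adj_def
proof (rule the_equality)
  fix z assume "\<forall>g h. cinner (z g) h = cinner g (x h)"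
  then have "cinner (z g) h = cinner (y g) h" for g h using assms by simp
  then show "z = y"
    by (metis cinner_commute cinner_ext ext)
qed (use assms in auto)

lemma cinner_adj_left:
  assumes "bounded_clinear x"
  shows "cinner (adj x g) h = cinner g (x h)"
proof -
  have "\<exists>y. \<forall>h. cinner g (x h) = cinner y h" for g
  proof (rule riesz_representation[where f = "\<lambda>h. cinner g (x h)" and B = "norm g * onorm x"])
    show "cmod (cinner g (x h)) \<le> norm g * onorm x * norm h" for h
      using order_trans[OF cinner_cauchy_schwarz mult_left_mono[OF bounded_clinear_norm_le[OF assms]]]
      by (simp add: mult.assoc)
  qed (use assms in \<open>simp_all add: bounded_clinear_add bounded_clinear_scaleC cinner_add_right
    cinner_scaleC_right\<close>)
  then obtain y where "\<And>g h. cinner g (x h) = cinner (y g) h" by metis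
  then show ?thesis using adj_eqI[of y x] by simp
qed

lemma cinner_adj_right:
  assumes "bounded_clinear x"
  shows "cinner g (adj x h) = cinner (x g) h"
  using cinner_adj_left[OF assms, of h g] by (metis cinner_commute)

lemma norm_adj_le:
  assumes x: "bounded_clinear x" and B: "0 \<le> B" "\<And>h. norm (x h) \<le> B * norm h"
  shows "norm (adj x g) \<le> B * norm g"
proof -
  have "(norm (adj x g))\<^sup>2 = cmod (cinner g (x (adj x g)))"
    using cinner_same[of "adj x g"] by (simp add: cinner_adj_left[OF x] norm_power)
  also have "\<dots> \<le> norm g * norm (x (adj x g))" by (rule cinner_cauchy_schwarz)
  also have "\<dots> \<le> norm g * (B * norm (adj x g))" using B by (intro mult_left_mono) auto
  finally have "norm (adj x g) * norm (adj x g) \<le> (B * norm g) * norm (adj x g)"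
    by (simp add: power2_eq_square ac_simps)
  then show ?thesis
    using B(1) by (cases "norm (adj x g) = 0") (auto simp: mult_le_cancel_right)
qed

lemma bounded_clinear_adj:
  assumes x: "bounded_clinear x"
  shows "bounded_clinear (adj x)"
proof (rule bounded_clinearI)
  show "norm (adj x g) \<le> onorm x * norm g" for g
    using x by (intro norm_adj_le) (auto intro: bounded_clinear_norm_le bounded_clinear_onorm_nonneg)
  show "adj x (g + h) = adj x g + adj x h" for g h
    by (rule cinner_ext) (simp add: cinner_adj_right[OF x] cinner_add_right)
  show "adj x (c *\<^sub>C h) = c *\<^sub>C adj x h" for c h
    by (rule cinner_ext) (simp add: cinner_adj_right[OF x] cinner_scaleC_right)
qed

lemma adj_adj: "bounded_clinear x \<Longrightarrow> adj (adj x) = x"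
  by (rule adj_eqI) (simp add: cinner_adj_right)

lemma adj_comp: "bounded_clinear x \<Longrightarrow> bounded_clinear y \<Longrightarrow> adj (x \<circ> y) = adj y \<circ> adj x"
  by (rule adj_eqI) (simp add: cinner_adj_left)

lemma adj_plus:
  "bounded_clinear x \<Longrightarrow> bounded_clinear y \<Longrightarrow> adj (\<lambda>h. x h + y h) = (\<lambda>h. adj x h + adj y h)"
  by (rule adj_eqI) (simp add: cinner_adj_left cinner_add_left cinner_add_right)

lemma adj_minus:
  "bounded_clinear x \<Longrightarrow> bounded_clinear y \<Longrightarrow> adj (\<lambda>h. x h - y h) = (\<lambda>h. adj x h - adj y h)"
  by (rule adj_eqI) (simp add: cinner_adj_left cinner_diff_left cinner_diff_right)

lemma adj_scale: "bounded_clinear x \<Longrightarrow> adj (\<lambda>h. c *\<^sub>C x h) = (\<lambda>h. cnj c *\<^sub>C adj x h)"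
  by (rule adj_eqI) (simp add: cinner_adj_left cinner_scaleC_left cinner_scaleC_right)

lemma adj_id [simp]: "adj id = id" "adj (\<lambda>h. h) = (\<lambda>h. h)"
  by (auto intro: adj_eqI)

lemma adj_const_zero [simp]: "adj (\<lambda>_. 0) = (\<lambda>_. 0)"
  by (rule adj_eqI) simp

lemma norm_sq_eq_adj:
  "bounded_clinear x \<Longrightarrow> complex_of_real ((norm (x h))\<^sup>2) = cinner h (adj x (x h))"
  by (simp add: cinner_adj_right cinner_same)

lemma norm_sq_eq_Re_adj: "bounded_clinear x \<Longrightarrow> (norm (x h))\<^sup>2 = Re (cinner h (adj x (x h)))"
  using norm_sq_eq_adj[of x h] by (metis Re_complex_of_real)

lemma onorm_adj_diff_le:
  assumes "bounded_clinear x" "bounded_clinear y"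
  shows "norm (adj x g - adj y g) \<le> onorm (\<lambda>h. x h - y h) * norm g"
proof -
  have b: "bounded_clinear (\<lambda>h. x h - y h)" using assms by (rule bounded_clinear_minus)
  have "norm (adj (\<lambda>h. x h - y h) g) \<le> onorm (\<lambda>h. x h - y h) * norm g"
    using b by (intro norm_adj_le) (auto intro: bounded_clinear_norm_le[OF b] bounded_clinear_onorm_nonneg)
  then show ?thesis by (simp add: adj_minus[OF assms])
qed

section \<open>Closed spaces and algebras of operators\<close>

lemma closed_subspace_bounded: "closed_subspace M \<Longrightarrow> x \<in> M \<Longrightarrow> bounded_clinear x"
  unfolding closed_subspace_def by blast

lemma closed_subspace_zero: "closed_subspace M \<Longrightarrow> (\<lambda>_. 0) \<in> M"
  unfolding closed_subspace_def by blast

lemma closed_subspace_plus: "closed_subspace M \<Longrightarrow> x \<in> M \<Longrightarrow> y \<in> M \<Longrightarrow> (\<lambda>h. x h + y h) \<in> M"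
  unfolding closed_subspace_def by blast

lemma closed_subspace_scale: "closed_subspace M \<Longrightarrow> x \<in> M \<Longrightarrow> (\<lambda>h. c *\<^sub>C x h) \<in> M"
  unfolding closed_subspace_def by blast

lemma closed_subspace_minus:
  assumes "closed_subspace M" "x \<in> M" "y \<in> M"
  shows "(\<lambda>h. x h - y h) \<in> M"
  using closed_subspace_plus[OF assms(1,2) closed_subspace_scale[OF assms(1,3), of "-1"]]
  by (simp add: scaleC_minus1)

lemma closed_subspace_sum:
  assumes "closed_subspace M" "\<And>i. i \<in> F \<Longrightarrow> x i \<in> M"
  shows "(\<lambda>h. \<Sum>i\<in>F. x i h) \<in> M"
  using assms(2)
  by (induction F rule: infinite_finite_induct)
    (auto intro: closed_subspace_zero closed_subspace_plus assms(1))

lemma closed_subspace_limit: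
  assumes "closed_subspace M" "bounded_clinear x"
    and appr: "\<And>\<epsilon>. \<epsilon> > 0 \<Longrightarrow> \<exists>y\<in>M. \<forall>h. norm (x h - y h) \<le> \<epsilon> * norm h"
  shows "x \<in> M"
proof -
  have "\<exists>y\<in>M. onorm (\<lambda>h. x h - y h) < \<epsilon>" if e: "\<epsilon> > 0" for \<epsilon>
  proof -
    obtain y where "y \<in> M" "\<forall>h. norm (x h - y h) \<le> \<epsilon> / 2 * norm h"
      using appr[OF half_gt_zero[OF e]] by blast
    then have "onorm (\<lambda>h. x h - y h) \<le> \<epsilon> / 2" using that by (intro onorm_bound) auto
    then show ?thesis using \<open>y \<in> M\<close> that by (intro bexI[of _ y]) auto
  qed
  with assms(1,2) show ?thesis unfolding closed_subspace_def by blast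
qed

lemma closed_subspaceI:
  assumes bd: "\<And>x. x \<in> M \<Longrightarrow> bounded_clinear x" and zero: "(\<lambda>_. 0) \<in> M"
    and add: "\<And>x y. x \<in> M \<Longrightarrow> y \<in> M \<Longrightarrow> (\<lambda>h. x h + y h) \<in> M"
    and sc: "\<And>c x. x \<in> M \<Longrightarrow> (\<lambda>h. c *\<^sub>C x h) \<in> M"
    and lim: "\<And>x. bounded_clinear x \<Longrightarrow> (\<And>\<epsilon>. \<epsilon> > 0 \<Longrightarrow> \<exists>y\<in>M. onorm (\<lambda>h. x h - y h) < \<epsilon>) \<Longrightarrow> x \<in> M"
  shows "closed_subspace M"
  using assms unfolding closed_subspace_def by blast

lemma closed_subalgebraI:
  "closed_subspace M \<Longrightarrow> (\<And>x y. x \<in> M \<Longrightarrow> y \<in> M \<Longrightarrow> x \<circ> y \<in> M) \<Longrightarrow> closed_subalgebra M"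
  by (simp add: closed_subalgebra_def)

lemma closed_subalgebra_subspace: "closed_subalgebra M \<Longrightarrow> closed_subspace M"
  by (simp add: closed_subalgebra_def)

lemma closed_subalgebra_comp: "closed_subalgebra M \<Longrightarrow> x \<in> M \<Longrightarrow> y \<in> M \<Longrightarrow> x \<circ> y \<in> M"
  by (simp add: closed_subalgebra_def)

lemma norm_le_onorm_diff:
  assumes "bounded_clinear x" "bounded_clinear y"
  shows "norm (x h - y h) \<le> onorm (\<lambda>h. x h - y h) * norm h"
  using bounded_clinear_norm_le[OF bounded_clinear_minus[OF assms]] .

text \<open>If no structured set contains the generators, then the hull is \<open>UNIV\<close>, which contains unbounded
  maps. So the intersection property is only asked for nonempty families.\<close>

lemma hull_structured:
  assumes "\<And>\<T>. \<T> \<noteq> {} \<Longrightarrow> (\<And>M. M \<in> \<T> \<Longrightarrow> S M) \<Longrightarrow> S (\<Inter>\<T>)" "S M" "s \<subseteq> M"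
  shows "S (S hull s)"
  unfolding hull_def by (rule assms(1)) (use assms(2,3) in auto)

lemma closed_subspace_Inter:
  assumes "\<T> \<noteq> {}" "\<And>M. M \<in> \<T> \<Longrightarrow> closed_subspace M"
  shows "closed_subspace (\<Inter>\<T>)"
proof (rule closed_subspaceI)
  fix x assume x: "bounded_clinear x" "\<And>\<epsilon>. \<epsilon> > 0 \<Longrightarrow> \<exists>y\<in>\<Inter>\<T>. onorm (\<lambda>h. x h - y h) < \<epsilon>"
  show "x \<in> \<Inter>\<T>"
  proof
    fix M assume "M \<in> \<T>"
    with x(2) have "\<forall>\<epsilon>>0. \<exists>y\<in>M. onorm (\<lambda>h. x h - y h) < \<epsilon>" by (meson InterD)
    with x(1) assms(2)[OF \<open>M \<in> \<T>\<close>] show "x \<in> M" unfolding closed_subspace_def by blast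
  qed
qed (use assms in \<open>auto intro: closed_subspace_bounded closed_subspace_zero closed_subspace_plus
  closed_subspace_scale\<close>)

lemma closed_subalgebra_Inter:
  assumes "\<T> \<noteq> {}" "\<And>M. M \<in> \<T> \<Longrightarrow> closed_subalgebra M"
  shows "closed_subalgebra (\<Inter>\<T>)"
  using assms closed_subspace_Inter[OF assms(1)] unfolding closed_subalgebra_def by blast

lemma cstar_subalgebra_Inter:
  assumes "\<T> \<noteq> {}" "\<And>M. M \<in> \<T> \<Longrightarrow> cstar_subalgebra M"
  shows "cstar_subalgebra (\<Inter>\<T>)"
  using assms closed_subalgebra_Inter[OF assms(1)] unfolding cstar_subalgebra_def by blast

lemma cstar_subalgebra_bounded_ops: "cstar_subalgebra {x. bounded_clinear x}"
  unfolding cstar_subalgebra_def closed_subalgebra_def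
  by (auto intro!: closed_subspaceI bounded_clinear_comp bounded_clinear_adj bounded_clinear_plus
      bounded_clinear_scale)

lemma cstarD:
  assumes "cstar_subalgebra M"
  shows cstar_closed_subalgebra: "closed_subalgebra M" and cstar_closed_subspace: "closed_subspace M"
    and cstar_adj: "x \<in> M \<Longrightarrow> adj x \<in> M" and cstar_comp: "x \<in> M \<Longrightarrow> y \<in> M \<Longrightarrow> x \<circ> y \<in> M"
    and cstar_bounded: "x \<in> M \<Longrightarrow> bounded_clinear x"
proof -
  show M: "closed_subalgebra M" using assms by (simp add: cstar_subalgebra_def)
  show s: "closed_subspace M" using M by (rule closed_subalgebra_subspace)
  show "x \<in> M \<Longrightarrow> adj x \<in> M" using assms by (simp add: cstar_subalgebra_def)
  show "x \<in> M \<Longrightarrow> y \<in> M \<Longrightarrow> x \<circ> y \<in> M" using M by (rule closed_subalgebra_comp)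
  show "x \<in> M \<Longrightarrow> bounded_clinear x" using s by (rule closed_subspace_bounded)
qed

lemma hulls_structured:
  assumes "\<And>x. x \<in> s \<Longrightarrow> bounded_clinear x"
  shows closed_subspace_hull: "closed_subspace (closed_subspace hull s)"
    and closed_subalgebra_hull: "closed_subalgebra (closed_subalgebra hull s)"
    and cstar_subalgebra_hull: "cstar_subalgebra (cstar_subalgebra hull s)"
proof -
  have s: "s \<subseteq> {x. bounded_clinear x}" using assms by auto
  note B = cstar_subalgebra_bounded_ops
  show "closed_subspace (closed_subspace hull s)"
    by (rule hull_structured[OF closed_subspace_Inter cstar_closed_subspace[OF B] s])
  show "closed_subalgebra (closed_subalgebra hull s)"
    by (rule hull_structured[OF closed_subalgebra_Inter cstar_closed_subalgebra[OF B] s])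
  show "cstar_subalgebra (cstar_subalgebra hull s)"
    by (rule hull_structured[OF cstar_subalgebra_Inter B s])
qed

text \<open>The tool for showing that all of a space of operators has a property that its generators
  have. The maps \<open>f\<close> of interest are multiplications and the adjoint; \<open>g\<close> is complex conjugation for
  the latter.\<close>

lemma closed_subspace_vimage:
  assumes N: "closed_subspace N" and M: "closed_subspace M"
    and bd: "\<And>x. x \<in> N \<Longrightarrow> bounded_clinear (f x)"
    and add: "\<And>x y. x \<in> N \<Longrightarrow> y \<in> N \<Longrightarrow> f (\<lambda>h. x h + y h) = (\<lambda>h. f x h + f y h)"
    and sc: "\<And>c x. x \<in> N \<Longrightarrow> f (\<lambda>h. c *\<^sub>C x h) = (\<lambda>h. g c *\<^sub>C f x h)"
    and lip: "\<And>x y k. x \<in> N \<Longrightarrow> y \<in> N \<Longrightarrow> norm (f x k - f y k) \<le> B * onorm (\<lambda>h. x h - y h) * norm k"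
  shows "closed_subspace {x \<in> N. f x \<in> M}"
proof (rule closed_subspaceI)
  have "f (\<lambda>_. 0) = (\<lambda>h. f (\<lambda>_. 0) h + f (\<lambda>_. 0) h)"
    using add[OF closed_subspace_zero[OF N] closed_subspace_zero[OF N]] by simp
  then have "f (\<lambda>_. 0) = (\<lambda>_. 0)" by (metis add_cancel_right_right)
  then show "(\<lambda>_. 0) \<in> {x \<in> N. f x \<in> M}" by (simp add: N M closed_subspace_zero)
next
  fix x
  assume x: "bounded_clinear x"
    and appr: "\<And>\<epsilon>. \<epsilon> > 0 \<Longrightarrow> \<exists>y\<in>{x \<in> N. f x \<in> M}. onorm (\<lambda>h. x h - y h) < \<epsilon>"
  have xN: "x \<in> N" using N x appr unfolding closed_subspace_def by blast
  have "f x \<in> M"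
  proof (rule closed_subspace_limit[OF M bd[OF xN]])
    fix \<epsilon> :: real assume e: "\<epsilon> > 0"
    then have "\<epsilon> / (\<bar>B\<bar> + 1) > 0" by simp
    then obtain y where y: "y \<in> N" "f y \<in> M" "onorm (\<lambda>h. x h - y h) < \<epsilon> / (\<bar>B\<bar> + 1)"
      using appr by blast
    have nn: "0 \<le> onorm (\<lambda>h. x h - y h)"
      using N x y(1) by (intro bounded_clinear_onorm_nonneg bounded_clinear_minus)
        (auto dest: closed_subspace_bounded)
    have "B * onorm (\<lambda>h. x h - y h) \<le> (\<bar>B\<bar> + 1) * onorm (\<lambda>h. x h - y h)"
      using nn by (intro mult_right_mono) auto
    also have "\<dots> \<le> \<epsilon>" using y(3) by (simp add: field_simps)
    finally have "norm (f x k - f y k) \<le> \<epsilon> * norm k" for k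
      using lip[OF xN y(1), of k] by (meson mult_right_mono norm_ge_zero order_trans)
    with y(2) show "\<exists>y\<in>M. \<forall>h. norm (f x h - y h) \<le> \<epsilon> * norm h" by blast
  qed
  with xN show "x \<in> {x \<in> N. f x \<in> M}" by simp
qed (use N M in \<open>auto simp: add sc intro: closed_subspace_bounded closed_subspace_plus
  closed_subspace_scale\<close>)

lemma closed_subspace_left_mult_vimage:
  assumes "closed_subspace N" "closed_subspace M" "bounded_clinear b"
  shows "closed_subspace {x \<in> N. b \<circ> x \<in> M}"
proof (rule closed_subspace_vimage[where g = "\<lambda>c. c" and B = "onorm b"])
  fix x y k assume xy: "x \<in> N" "y \<in> N"
  then have "bounded_clinear x" "bounded_clinear y" using assms(1) by (auto dest: closed_subspace_bounded)
  note d = norm_le_onorm_diff[OF this, of k]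
  have "norm ((b \<circ> x) k - (b \<circ> y) k) = norm (b (x k - y k))"
    by (simp add: bounded_clinear_diff[OF assms(3)])
  also have "\<dots> \<le> onorm b * norm (x k - y k)" by (rule bounded_clinear_norm_le[OF assms(3)])
  also have "\<dots> \<le> onorm b * (onorm (\<lambda>h. x h - y h) * norm k)"
    using d by (intro mult_left_mono bounded_clinear_onorm_nonneg assms(3))
  finally show "norm ((b \<circ> x) k - (b \<circ> y) k) \<le> onorm b * onorm (\<lambda>h. x h - y h) * norm k"
    by (simp add: mult.assoc)
next
  show "bounded_clinear (b \<circ> x)" if "x \<in> N" for x
    using that assms by (intro bounded_clinear_comp) (auto dest: closed_subspace_bounded)
qed (use assms in \<open>auto simp: bounded_clinear_add bounded_clinear_scaleC\<close>)

lemma closed_subspace_adj_vimage: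
  assumes "closed_subspace N" "closed_subspace M"
  shows "closed_subspace {x \<in> N. adj x \<in> M}"
proof (rule closed_subspace_vimage[where g = cnj and B = 1])
  show "norm (adj x k - adj y k) \<le> 1 * onorm (\<lambda>h. x h - y h) * norm k" if "x \<in> N" "y \<in> N" for x y k
    using onorm_adj_diff_le[of x y k] that by (simp add: closed_subspace_bounded[OF assms(1)])
qed (use assms in \<open>auto intro!: bounded_clinear_adj adj_plus adj_scale dest: closed_subspace_bounded\<close>)

text \<open>Generation by self-adjoint elements needs no adjoints, because the adjoints of products are
  the reversed products.\<close>

lemma cstar_hull_selfadjoint:
  assumes "\<And>x. x \<in> s \<Longrightarrow> bounded_clinear x" "\<And>x. x \<in> s \<Longrightarrow> adj x = x"
  shows "cstar_subalgebra hull s = closed_subalgebra hull s"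
proof
  let ?N = "closed_subalgebra hull s"
  have N: "closed_subalgebra ?N" by (rule closed_subalgebra_hull) (rule assms(1))
  then have Ns: "closed_subspace ?N" by (rule closed_subalgebra_subspace)
  have "closed_subalgebra {x \<in> ?N. adj x \<in> ?N}"
  proof (rule closed_subalgebraI)
    fix x y assume xy: "x \<in> {x \<in> ?N. adj x \<in> ?N}" "y \<in> {x \<in> ?N. adj x \<in> ?N}"
    then have "bounded_clinear x" "bounded_clinear y" using Ns by (auto dest: closed_subspace_bounded)
    then have "adj (x \<circ> y) = adj y \<circ> adj x" by (rule adj_comp)
    with xy show "x \<circ> y \<in> {x \<in> ?N. adj x \<in> ?N}" by (simp add: closed_subalgebra_comp[OF N])
  qed (rule closed_subspace_adj_vimage[OF Ns Ns])
  then have "?N \<subseteq> {x \<in> ?N. adj x \<in> ?N}"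
    by (rule hull_minimal[rotated]) (auto simp: assms(2) intro: hull_inc)
  with N have "cstar_subalgebra ?N" by (auto simp: cstar_subalgebra_def)
  then show "cstar_subalgebra hull s \<subseteq> ?N" by (intro hull_minimal) (auto intro: hull_inc)
  have "closed_subalgebra (cstar_subalgebra hull s)"
    by (intro cstar_closed_subalgebra cstar_subalgebra_hull assms(1))
  then show "?N \<subseteq> cstar_subalgebra hull s" by (intro hull_minimal) (auto intro: hull_inc)
qed

text \<open>Commutation relations of generators with a self-adjoint operator pass to the algebra that they
  generate. This is used for the projections onto basis vectors and onto the covariant summands.\<close>

lemma cstar_subalgebra_commutant:
  assumes q: "bounded_clinear q" "adj q = q"
  shows "cstar_subalgebra {x. bounded_clinear x \<and> x \<circ> q = q \<circ> x}"
  unfolding cstar_subalgebra_def closed_subalgebra_def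
proof (intro conjI ballI)
  let ?M = "{x. bounded_clinear x \<and> x \<circ> q = q \<circ> x}"
  show "closed_subspace ?M"
  proof (rule closed_subspaceI)
    fix x assume x: "bounded_clinear x"
      and appr: "\<And>\<epsilon>. \<epsilon> > 0 \<Longrightarrow> \<exists>y\<in>?M. onorm (\<lambda>h. x h - y h) < \<epsilon>"
    have "x (q h) = q (x h)" for h
    proof -
      have "norm (x (q h) - q (x h)) \<le> 0"
      proof (rule field_le_epsilon)
        fix \<epsilon> :: real assume e: "\<epsilon> > 0"
        define C where "C = norm (q h) + onorm q * norm h"
        have C: "0 \<le> C" by (simp add: C_def bounded_clinear_onorm_nonneg[OF q(1)])
        with e have "\<epsilon> / (C + 1) > 0" by simp
        then obtain y where y: "bounded_clinear y" "y \<circ> q = q \<circ> y"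
          and le: "onorm (\<lambda>h. x h - y h) < \<epsilon> / (C + 1)" using appr by blast
        let ?d = "onorm (\<lambda>h. x h - y h)"
        have eq: "x (q h) - q (x h) = (x (q h) - y (q h)) - q (x h - y h)"
          using fun_cong[OF y(2), of h] by (simp add: bounded_clinear_diff[OF q(1)])
        have "norm (x (q h) - q (x h)) \<le> norm (x (q h) - y (q h)) + norm (q (x h - y h))"
          unfolding eq by (rule norm_triangle_ineq4)
        also have "norm (q (x h - y h)) \<le> onorm q * (?d * norm h)"
          by (rule order_trans[OF bounded_clinear_norm_le[OF q(1)]])
            (intro mult_left_mono norm_le_onorm_diff x y(1) bounded_clinear_onorm_nonneg q(1))
        also have "norm (x (q h) - y (q h)) \<le> ?d * norm (q h)" by (rule norm_le_onorm_diff[OF x y(1)])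
        finally have "norm (x (q h) - q (x h)) \<le> ?d * C" by (simp add: C_def algebra_simps)
        also have "\<dots> \<le> \<epsilon> / (C + 1) * C" using le C by (intro mult_right_mono) auto
        also have "\<dots> \<le> \<epsilon>" using e C by (simp add: field_simps)
        finally show "norm (x (q h) - q (x h)) \<le> 0 + \<epsilon>" by simp
      qed
      then show ?thesis by simp
    qed
    with x show "x \<in> ?M" by auto
  qed (auto simp: bounded_clinear_add[OF q(1)] bounded_clinear_scaleC[OF q(1)] fun_eq_iff
      bounded_clinear_zero[OF q(1)] intro: bounded_clinear_plus bounded_clinear_scale)
  fix x y assume x: "x \<in> ?M"
  then have "adj x \<circ> q = q \<circ> adj x" using adj_comp[of x q] adj_comp[of q x] q by auto
  with x show "adj x \<in> ?M" by (auto intro: bounded_clinear_adj)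
  assume y: "y \<in> ?M"
  have "(x \<circ> y) \<circ> q = q \<circ> (x \<circ> y)" using x y by (simp add: fun_eq_iff)
  with x y show "x \<circ> y \<in> ?M" by (auto intro: bounded_clinear_comp)
qed

subsection \<open>Representations\<close>

lemma linear_repD:
  assumes "linear_rep M \<rho>"
  shows linear_rep_bounded: "x \<in> M \<Longrightarrow> bounded_clinear (\<rho> x)"
    and linear_rep_plus: "x \<in> M \<Longrightarrow> y \<in> M \<Longrightarrow> \<rho> (\<lambda>h. x h + y h) = (\<lambda>k. \<rho> x k + \<rho> y k)"
    and linear_rep_scale: "x \<in> M \<Longrightarrow> \<rho> (\<lambda>h. c *\<^sub>C x h) = (\<lambda>k. c *\<^sub>C \<rho> x k)"
  using assms by (auto simp: linear_rep_def)

lemma linear_rep_zero: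
  assumes "linear_rep M \<rho>" "closed_subspace M"
  shows "\<rho> (\<lambda>_. 0) = (\<lambda>_. 0)"
  using linear_rep_scale[OF assms(1) closed_subspace_zero[OF assms(2)], of 0] by simp

lemma linear_rep_minus:
  assumes "linear_rep M \<rho>" "closed_subspace M" "x \<in> M" "y \<in> M"
  shows "\<rho> (\<lambda>h. x h - y h) = (\<lambda>k. \<rho> x k - \<rho> y k)"
  using linear_rep_plus[OF assms(1,3) closed_subspace_scale[OF assms(2,4), of "-1"]]
    linear_rep_scale[OF assms(1,4), of "-1"]
  by (simp add: scaleC_minus1)

lemma linear_rep_sum:
  assumes "linear_rep M \<rho>" "closed_subspace M" "finite F" "\<And>i. i \<in> F \<Longrightarrow> x i \<in> M"
  shows "\<rho> (\<lambda>h. \<Sum>i\<in>F. x i h) = (\<lambda>k. \<Sum>i\<in>F. \<rho> (x i) k)"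
  using assms(3,4)
  by (induction F)
    (auto simp: linear_rep_zero[OF assms(1,2)] linear_rep_plus[OF assms(1)]
      closed_subspace_sum[OF assms(2)])

lemma star_repD:
  assumes "star_rep M \<rho>"
  shows star_rep_linear: "linear_rep M \<rho>"
    and star_rep_comp: "x \<in> M \<Longrightarrow> y \<in> M \<Longrightarrow> \<rho> (x \<circ> y) = \<rho> x \<circ> \<rho> y"
    and star_rep_adj: "x \<in> M \<Longrightarrow> \<rho> (adj x) = adj (\<rho> x)"
    and star_rep_bounded: "x \<in> M \<Longrightarrow> bounded_clinear (\<rho> x)"
  using assms by (auto simp: star_rep_def homomorphism_def linear_rep_def)

section \<open>Contractivity of *-representations\<close>

text \<open>The Neumann series.\<close>

lemma neumann_inverse:
  assumes A: "closed_subalgebra A" "id \<in> A" and d: "d \<in> A"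
    and r: "0 \<le> r" "r < 1" and bd: "\<And>h. norm (d h) \<le> r * norm h"
  shows "\<exists>b\<in>A. \<forall>h. b (h - d h) = h"
proof -
  note As = closed_subalgebra_subspace[OF A(1)]
  have dl: "bounded_clinear d" using As d by (rule closed_subspace_bounded)
  have pow_A: "d ^^ k \<in> A" for k
  proof (induction k)
    case 0
    show ?case using A(2) by (simp only: funpow.simps)
  next
    case (Suc k)
    with d show ?case unfolding funpow.simps by (rule closed_subalgebra_comp[OF A(1)])
  qed
  then have pow_l: "bounded_clinear (d ^^ k)" for k using As closed_subspace_bounded by blast
  have pow_bd: "norm ((d ^^ k) h) \<le> norm h * r ^ k" for k h
  proof (induction k)
    case (Suc k)
    have "norm (d ((d ^^ k) h)) \<le> r * norm ((d ^^ k) h)" by (rule bd)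
    also have "\<dots> \<le> r * (norm h * r ^ k)" by (rule mult_left_mono[OF Suc r(1)])
    finally show ?case by (simp add: ac_simps)
  qed simp
  have geo: "summable (\<lambda>k. norm h * r ^ k)" for h :: 'a
    using r by (intro summable_mult summable_geometric) auto
  have summ: "summable (\<lambda>k. (d ^^ k) h)" for h
    by (rule summable_comparison_test[OF _ geo]) (use pow_bd in auto)
  define b where "b h = suminf (\<lambda>k. (d ^^ k) h)" for h
  have b_bd: "norm (b h - (\<Sum>k<n. (d ^^ k) h)) \<le> r ^ n / (1 - r) * norm h" for n h
  proof -
    have "norm (suminf (\<lambda>k. (d ^^ (k + n)) h)) \<le> suminf (\<lambda>k. norm h * r ^ n * r ^ k)"
    proof (rule norm_suminf_le)
      show "norm ((d ^^ (k + n)) h) \<le> norm h * r ^ n * r ^ k" for k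
        using pow_bd[of "k + n" h] by (simp add: power_add ac_simps)
    qed (use r in \<open>auto intro!: summable_mult summable_geometric\<close>)
    also have "\<dots> = r ^ n / (1 - r) * norm h"
      using r by (simp add: suminf_mult summable_geometric suminf_geometric)
    finally show ?thesis
      using suminf_minus_initial_segment[OF summ[of h], of n] by (simp add: b_def)
  qed
  have b_l: "bounded_clinear b"
  proof (rule bounded_clinearI)
    show "b (g + h) = b g + b h" for g h
      by (simp add: b_def bounded_clinear_add[OF pow_l] suminf_add[OF summ summ])
    show "b (c *\<^sub>C h) = c *\<^sub>C b h" for c h
    proof -
      have "bounded_linear (\<lambda>x::'a. c *\<^sub>C x)"
        using bounded_clinear_scale[OF bounded_clinear_id(2)] by (rule bounded_clinear_bounded)
      from bounded_linear.suminf[OF this summ] show ?thesis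
        by (simp add: b_def bounded_clinear_scaleC[OF pow_l])
    qed
    show "norm (b h) \<le> 1 / (1 - r) * norm h" for h using b_bd[of h 0] by simp
  qed
  have "b \<in> A"
  proof (rule closed_subspace_limit[OF As b_l])
    fix \<epsilon> :: real assume "\<epsilon> > 0"
    then have "0 < \<epsilon> * (1 - r)" using r by simp
    then obtain n where "r ^ n < \<epsilon> * (1 - r)" using real_arch_pow_inv r(2) by blast
    then have "r ^ n / (1 - r) \<le> \<epsilon>" using r by (simp add: field_simps)
    then have "norm (b h - (\<Sum>k<n. (d ^^ k) h)) \<le> \<epsilon> * norm h" for h
      using b_bd[of h n] by (meson mult_right_mono norm_ge_zero order_trans)
    moreover have "(\<lambda>h. \<Sum>k<n. (d ^^ k) h) \<in> A" by (intro closed_subspace_sum[OF As] pow_A)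
    ultimately show "\<exists>y\<in>A. \<forall>h. norm (b h - y h) \<le> \<epsilon> * norm h" by (rule_tac bexI) auto
  qed
  moreover have "b (h - d h) = h" for h
  proof -
    have "(d ^^ k) (h - d h) = (d ^^ k) h - (d ^^ Suc k) h" for k
      by (simp add: bounded_clinear_diff[OF pow_l] funpow_swap1)
    then have "b (h - d h) = b h - suminf (\<lambda>k. (d ^^ Suc k) h)"
      unfolding b_def using suminf_diff[OF summ[of h], of "\<lambda>k. (d ^^ Suc k) h"]
      by (simp add: summable_Suc_iff[of "\<lambda>k. (d ^^ k) h"] summ del: funpow.simps)
    also have "\<dots> = h"
      unfolding b_def using suminf_split_head[OF summ[of h]] by (simp del: funpow.simps)
    finally show ?thesis .
  qed
  ultimately show ?thesis by blast
qed

text \<open>The norm of \<open>x = \<pi> a\<close> is the square root of an approximate eigenvalue of \<open>x\<^sup>* x\<close>: where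
  \<open>\<parallel>x h\<parallel>\<close> is nearly \<open>\<parallel>x\<parallel> \<parallel>h\<parallel>\<close>, the operator \<open>\<parallel>x\<parallel>\<^sup>2 - x\<^sup>* x\<close> is nearly zero. If \<open>\<parallel>x\<parallel> > \<parallel>a\<parallel>\<close>, then
  \<open>\<parallel>x\<parallel>\<^sup>2 - a\<^sup>* a\<close> is invertible in the algebra, and the image of the inverse makes
  \<open>\<parallel>x\<parallel>\<^sup>2 - x\<^sup>* x\<close> bounded below.\<close>

theorem star_rep_contractive:
  assumes A: "cstar_subalgebra A" "id \<in> A" and \<pi>: "star_rep A \<pi>" and a: "a \<in> A"
  shows "norm (\<pi> a h) \<le> onorm a * norm h"
proof -
  define x where "x = \<pi> a"
  have al: "bounded_clinear a" using A(1) a by (rule cstar_bounded)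
  have xl: "bounded_clinear x" unfolding x_def using \<pi> a by (rule star_rep_bounded)
  have a0: "0 \<le> onorm a" and x0: "0 \<le> onorm x"
    by (auto intro: bounded_clinear_onorm_nonneg al xl)
  have "onorm x \<le> onorm a"
  proof (rule ccontr)
    assume "\<not> onorm x \<le> onorm a"
    then have lt: "onorm a < onorm x" by simp
    define N where "N = (onorm x)\<^sup>2"
    have N: "0 < N" "(onorm a)\<^sup>2 < N" using lt a0 by (auto simp: N_def power_strict_mono)
    define d where "d = (\<lambda>h. complex_of_real (1 / N) *\<^sub>C (adj a \<circ> a) h)"
    have aa: "adj a \<circ> a \<in> A" using A(1) a by (auto intro: cstar_adj cstar_comp)
    then have dA: "d \<in> A" unfolding d_def by (intro closed_subspace_scale cstar_closed_subspace A(1))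
    have "norm (adj a (a h)) \<le> onorm a * (onorm a * norm h)" for h
      by (rule order_trans[OF norm_adj_le[OF al a0 bounded_clinear_norm_le[OF al]]])
        (intro mult_left_mono a0 bounded_clinear_norm_le al)
    then have "norm (d h) \<le> (onorm a)\<^sup>2 / N * norm h" for h
      using N(1) by (simp add: d_def norm_scaleC norm_divide divide_simps power2_eq_square mult.assoc)
    from neumann_inverse[OF cstar_closed_subalgebra[OF A(1)] A(2) dA _ _ this] N
    obtain b where b: "b \<in> A" "\<And>h. b (h - d h) = h" by (auto simp: divide_simps)
    have idd: "(\<lambda>h. id h - d h) \<in> A"
      by (intro closed_subspace_minus cstar_closed_subspace A dA)
    have "b \<circ> (\<lambda>h. id h - d h) = id" using b(2) by (auto simp: fun_eq_iff)
    then have "\<pi> b \<circ> \<pi> (\<lambda>h. id h - d h) = \<pi> id" using star_rep_comp[OF \<pi> b(1) idd] by simp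
    moreover have "\<pi> (\<lambda>h. id h - d h) = (\<lambda>k. \<pi> id k - \<pi> d k)"
      by (rule linear_rep_minus[OF star_rep_linear[OF \<pi>] cstar_closed_subspace[OF A(1)] A(2) dA])
    moreover have "\<pi> d = (\<lambda>k. complex_of_real (1 / N) *\<^sub>C adj x (x k))"
      unfolding d_def using linear_rep_scale[OF star_rep_linear[OF \<pi>] aa, of "complex_of_real (1 / N)"]
        star_rep_comp[OF \<pi> cstar_adj[OF A(1) a] a] star_rep_adj[OF \<pi> a] by (simp add: x_def)
    ultimately have inv: "\<pi> b (\<pi> id k - complex_of_real (1 / N) *\<^sub>C adj x (x k)) = \<pi> id k" for k
      by (simp add: fun_eq_iff)
    define e where "e = \<pi> id"
    have el: "bounded_clinear e" unfolding e_def using \<pi> A(2) by (rule star_rep_bounded)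
    have ee: "e \<circ> e = e" "adj e = e" "x \<circ> e = x"
      using star_rep_comp[OF \<pi> A(2) A(2)] star_rep_adj[OF \<pi> A(2)] star_rep_comp[OF \<pi> a A(2)]
      by (simp_all add: e_def x_def)
    have e_le: "norm (e h) \<le> norm h" for h
    proof -
      have "(norm (e h))\<^sup>2 = cmod (cinner h (e h))"
        using norm_sq_eq_adj[OF el, of h] fun_cong[OF ee(1), of h] ee(2)
        by (metis comp_apply norm_of_real abs_power2)
      also have "\<dots> \<le> norm h * norm (e h)" by (rule cinner_cauchy_schwarz)
      finally show ?thesis by (cases "e h = 0") (auto simp: power2_eq_square)
    qed
    define B where "B = onorm (\<pi> b)"
    have bl: "bounded_clinear (\<pi> b)" using \<pi> b(1) by (rule star_rep_bounded)
    have B: "0 \<le> B" "\<And>k. norm (\<pi> b k) \<le> B * norm k"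
      by (auto simp: B_def intro: bounded_clinear_onorm_nonneg bounded_clinear_norm_le bl)
    define K where "K = B\<^sup>2"
    have K: "0 \<le> K" by (simp add: K_def)
    have key: "(norm (x h))\<^sup>2 \<le> N * (K * ((norm h)\<^sup>2 - (norm (x h))\<^sup>2 / N))" for h
    proof -
      \<comment> \<open>The inverse only inverts on the range of \<open>e\<close>, and \<open>x h\<close> depends on the component there.\<close>
      define u where "u = e h"
      define w where "w = complex_of_real (1 / N) *\<^sub>C adj x (x u)"
      have xu: "x u = x h" and eu: "e u = u"
        using fun_cong[OF ee(3), of h] fun_cong[OF ee(1), of h] by (auto simp: u_def)
      have "(norm w)\<^sup>2 \<le> (norm (x u))\<^sup>2 / N"
      proof -
        have "norm (adj x (x u)) \<le> onorm x * norm (x u)"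
          by (intro norm_adj_le xl x0 bounded_clinear_norm_le)
        then have "(norm (adj x (x u)))\<^sup>2 \<le> N * (norm (x u))\<^sup>2"
          by (metis N_def norm_ge_zero power_mono power_mult_distrib)
        then show ?thesis
          using N(1) by (simp add: w_def norm_scaleC norm_divide power_divide power2_eq_square divide_simps ac_simps)
      qed
      moreover have "Re (cinner u w) = (norm (x u))\<^sup>2 / N"
        by (simp add: w_def cinner_scaleC_right norm_sq_eq_adj[OF xl, symmetric])
      ultimately have "(norm (u - w))\<^sup>2 \<le> (norm u)\<^sup>2 - (norm (x h))\<^sup>2 / N"
        by (simp add: norm_diff_sq xu)
      also have "\<dots> \<le> (norm h)\<^sup>2 - (norm (x h))\<^sup>2 / N" using e_le[of h] by (simp add: u_def)
      finally have uw: "(norm (u - w))\<^sup>2 \<le> (norm h)\<^sup>2 - (norm (x h))\<^sup>2 / N" .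
      have "u = \<pi> b (u - w)" using inv[of u] eu by (simp add: e_def w_def)
      then have "norm u \<le> B * norm (u - w)" using B(2) by metis
      then have "(norm u)\<^sup>2 \<le> K * (norm (u - w))\<^sup>2"
        unfolding K_def by (metis norm_ge_zero power_mono power_mult_distrib)
      also have "\<dots> \<le> K * ((norm h)\<^sup>2 - (norm (x h))\<^sup>2 / N)" using uw K by (rule mult_left_mono)
      finally have u_le: "(norm u)\<^sup>2 \<le> K * ((norm h)\<^sup>2 - (norm (x h))\<^sup>2 / N)" .
      have "norm (x h) \<le> onorm x * norm u" using bounded_clinear_norm_le[OF xl, of u] xu by simp
      then have "(norm (x h))\<^sup>2 \<le> N * (norm u)\<^sup>2"
        unfolding N_def by (metis norm_ge_zero power_mono power_mult_distrib)
      also have "\<dots> \<le> N * (K * ((norm h)\<^sup>2 - (norm (x h))\<^sup>2 / N))"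
        using u_le N(1) by (intro mult_left_mono) auto
      finally show ?thesis .
    qed
    define s where "s = sqrt (K / (1 + K))"
    have s: "0 \<le> s" "s < 1" using K by (auto simp: s_def divide_simps)
    have "norm (x h) \<le> s * onorm x * norm h" for h
    proof -
      have "(1 + K) * (norm (x h))\<^sup>2 \<le> K * (N * (norm h)\<^sup>2)"
      proof -
        have "N * (K * ((norm h)\<^sup>2 - (norm (x h))\<^sup>2 / N)) = K * (N * (norm h)\<^sup>2) - K * (norm (x h))\<^sup>2"
          using N(1) by (simp add: field_simps)
        with key[of h] show ?thesis by (simp add: distrib_right)
      qed
      then have "(norm (x h))\<^sup>2 \<le> K / (1 + K) * (N * (norm h)\<^sup>2)"
        using K by (simp add: field_simps)
      also have "\<dots> = (s * onorm x * norm h)\<^sup>2"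
        using K by (simp add: s_def N_def power_mult_distrib)
      finally show ?thesis by (rule power2_le_imp_le) (simp add: s x0)
    qed
    then have "onorm x \<le> s * onorm x" using s x0 by (intro onorm_bound) auto
    moreover have "s * onorm x < 1 * onorm x" using s lt a0 by (intro mult_strict_right_mono) auto
    ultimately show False by simp
  qed
  then have "onorm x * norm h \<le> onorm a * norm h" by (intro mult_right_mono) auto
  then show ?thesis using bounded_clinear_norm_le[OF xl, of h] by (simp add: x_def)
qed

section \<open>Direct sums of operators\<close>

text \<open>A family without a common bound has no direct sum: the square-summability in \<open>dsum\<close> can fail.\<close>

definition uniformly_bounded :: "'i set \<Rightarrow> ('i \<Rightarrow> 'h::chilbert_space op) \<Rightarrow> real \<Rightarrow> bool"
  where "uniformly_bounded R X B \<longleftrightarrow>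
    0 \<le> B \<and> (\<forall>r\<in>R. bounded_clinear (X r) \<and> (\<forall>h. norm (X r h) \<le> B * norm h))"

lemma hsum_eqI: "(\<And>i. hcoord x i = hcoord y i) \<Longrightarrow> x = y"
  by (metis ext hcoord_inject)

lemma hcoord_dsum:
  assumes X: "uniformly_bounded R X B"
  shows "hcoord (dsum R X f) i = (if i \<in> R then X i (hcoord f i) else 0)"
proof -
  have "(\<lambda>i. (norm (if i \<in> R then X i (hcoord f i) else 0))\<^sup>2) summable_on UNIV"
  proof (rule summable_on_comparison_test)
    have f: "(\<lambda>i. (norm (hcoord f i))\<^sup>2) summable_on UNIV" using hcoord[of f] by simp
    show "(\<lambda>i. B\<^sup>2 * (norm (hcoord f i))\<^sup>2) summable_on UNIV"
      by (rule summable_on_cmult_right[OF f])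
    show "(norm (if i \<in> R then X i (hcoord f i) else 0))\<^sup>2 \<le> B\<^sup>2 * (norm (hcoord f i))\<^sup>2" for i
    proof (cases "i \<in> R")
      case True
      then have "norm (X i (hcoord f i)) \<le> B * norm (hcoord f i)"
        using X by (simp add: uniformly_bounded_def)
      from power_mono[OF this norm_ge_zero, of 2] show ?thesis
        using True by (simp add: power_mult_distrib)
    qed simp
  qed auto
  then show ?thesis by (simp add: dsum_def Abs_hsum_inverse)
qed

lemma norm_dsum_le:
  assumes X: "uniformly_bounded R X B"
  shows "norm (dsum R X f) \<le> B * norm f"
proof -
  have B: "0 \<le> B" using X by (simp add: uniformly_bounded_def)
  have s: "(\<lambda>i. (norm (hcoord x i))\<^sup>2) summable_on UNIV" for x :: "('a, 'b) hsum"
    using hcoord[of x] by simp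
  have "(\<Sum>\<^sub>\<infinity>i. (norm (hcoord (dsum R X f) i))\<^sup>2) \<le> (\<Sum>\<^sub>\<infinity>i. B\<^sup>2 * (norm (hcoord f i))\<^sup>2)"
  proof (rule infsum_mono[OF s summable_on_cmult_right[OF s]])
    show "(norm (hcoord (dsum R X f) i))\<^sup>2 \<le> B\<^sup>2 * (norm (hcoord f i))\<^sup>2" for i
    proof (cases "i \<in> R")
      case True
      then have "norm (X i (hcoord f i)) \<le> B * norm (hcoord f i)"
        using X by (simp add: uniformly_bounded_def)
      from power_mono[OF this norm_ge_zero, of 2] show ?thesis
        using True by (simp add: hcoord_dsum[OF X] power_mult_distrib)
    qed (simp add: hcoord_dsum[OF X])
  qed
  then have "sqrt (\<Sum>\<^sub>\<infinity>i. (norm (hcoord (dsum R X f) i))\<^sup>2) \<le> sqrt (B\<^sup>2 * (\<Sum>\<^sub>\<infinity>i. (norm (hcoord f i))\<^sup>2))"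
    by (simp add: infsum_cmult_right')
  then show ?thesis using B by (simp add: norm_hsum.rep_eq real_sqrt_mult)
qed

lemma bounded_clinear_dsum:
  assumes X: "uniformly_bounded R X B"
  shows "bounded_clinear (dsum R X)"
proof (rule bounded_clinearI)
  have l: "bounded_clinear (X i)" if "i \<in> R" for i using X that by (simp add: uniformly_bounded_def)
  show "dsum R X (f + g) = dsum R X f + dsum R X g" for f g
    by (rule hsum_eqI) (auto simp: hcoord_dsum[OF X] plus_hsum.rep_eq bounded_clinear_add[OF l])
  show "dsum R X (c *\<^sub>C f) = c *\<^sub>C dsum R X f" for c f
    by (rule hsum_eqI) (auto simp: hcoord_dsum[OF X] scaleC_hsum.rep_eq bounded_clinear_scaleC[OF l])
  show "norm (dsum R X f) \<le> B * norm f" for f by (rule norm_dsum_le[OF X])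
qed

lemma onorm_dsum_le: "uniformly_bounded R X B \<Longrightarrow> onorm (dsum R X) \<le> B"
  by (rule onorm_bound) (auto simp: norm_dsum_le, simp add: uniformly_bounded_def)

lemma uniformly_bounded_adj:
  "uniformly_bounded R X B \<Longrightarrow> uniformly_bounded R (\<lambda>r. adj (X r)) B"
  by (auto simp: uniformly_bounded_def intro: bounded_clinear_adj norm_adj_le)

lemma adj_dsum:
  assumes X: "uniformly_bounded R X B"
  shows "adj (dsum R X) = dsum R (\<lambda>r. adj (X r))"
proof (rule adj_eqI)
  fix f g
  have "cinner (hcoord (dsum R (\<lambda>r. adj (X r)) f) i) (hcoord g i)
      = cinner (hcoord f i) (hcoord (dsum R X g) i)" for i
    using X by (simp add: hcoord_dsum[OF X] hcoord_dsum[OF uniformly_bounded_adj[OF X]]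
        cinner_adj_left uniformly_bounded_def)
  then show "cinner (dsum R (\<lambda>r. adj (X r)) f) g = cinner f (dsum R X g)"
    by (simp add: cinner_hsum.rep_eq)
qed

lemma uniformly_bounded_comp:
  assumes X: "uniformly_bounded R X B" and Y: "uniformly_bounded S Y C"
  shows "uniformly_bounded (R \<inter> S) (\<lambda>r. X r \<circ> Y r) (B * C)"
  unfolding uniformly_bounded_def
proof (intro conjI ballI allI)
  have BC: "0 \<le> B" "0 \<le> C" using X Y by (auto simp: uniformly_bounded_def)
  then show "0 \<le> B * C" by simp
  fix r h assume r: "r \<in> R \<inter> S"
  with X Y show "bounded_clinear (X r \<circ> Y r)"
    by (auto simp: uniformly_bounded_def intro: bounded_clinear_comp)
  have "norm (X r (Y r h)) \<le> B * norm (Y r h)" using X r by (auto simp: uniformly_bounded_def)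
  also have "\<dots> \<le> B * (C * norm h)" using Y r BC by (intro mult_left_mono) (auto simp: uniformly_bounded_def)
  finally show "norm ((X r \<circ> Y r) h) \<le> B * C * norm h" by (simp add: mult.assoc)
qed

lemma dsum_comp:
  assumes X: "uniformly_bounded R X B" and Y: "uniformly_bounded S Y C"
  shows "dsum R X \<circ> dsum S Y = dsum (R \<inter> S) (\<lambda>r. X r \<circ> Y r)"
proof (intro ext hsum_eqI)
  fix f i
  have "X i 0 = 0" if "i \<in> R" using X that by (auto simp: uniformly_bounded_def intro: bounded_clinear_zero)
  then show "hcoord ((dsum R X \<circ> dsum S Y) f) i = hcoord (dsum (R \<inter> S) (\<lambda>r. X r \<circ> Y r) f) i"
    by (simp add: hcoord_dsum[OF X] hcoord_dsum[OF Y] hcoord_dsum[OF uniformly_bounded_comp[OF X Y]])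
qed

lemma dsum_cong: "(\<And>r. r \<in> R \<Longrightarrow> X r = Y r) \<Longrightarrow> dsum R X = dsum R Y"
  unfolding dsum_def by (intro ext arg_cong[of _ _ Abs_hsum]) auto

lemma dsum_plus:
  assumes X: "uniformly_bounded R X B" and Y: "uniformly_bounded R Y C"
  shows "dsum R (\<lambda>r h. X r h + Y r h) = (\<lambda>f. dsum R X f + dsum R Y f)"
proof (intro ext hsum_eqI)
  have "norm (X r h + Y r h) \<le> (B + C) * norm h" if "r \<in> R" for r h
  proof -
    have "norm (X r h) \<le> B * norm h" "norm (Y r h) \<le> C * norm h"
      using X Y that by (auto simp: uniformly_bounded_def)
    then show ?thesis using norm_triangle_ineq[of "X r h" "Y r h"] by (simp add: distrib_right)
  qed
  then have XY: "uniformly_bounded R (\<lambda>r h. X r h + Y r h) (B + C)"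
    using X Y by (auto simp: uniformly_bounded_def intro: bounded_clinear_plus)
  show "hcoord (dsum R (\<lambda>r h. X r h + Y r h) f) i = hcoord (dsum R X f + dsum R Y f) i" for f i
    by (simp add: hcoord_dsum[OF X] hcoord_dsum[OF Y] hcoord_dsum[OF XY] plus_hsum.rep_eq)
qed

lemma dsum_scale:
  assumes X: "uniformly_bounded R X B"
  shows "dsum R (\<lambda>r h. c *\<^sub>C X r h) = (\<lambda>f. c *\<^sub>C dsum R X f)"
proof (intro ext hsum_eqI)
  have cX: "uniformly_bounded R (\<lambda>r h. c *\<^sub>C X r h) (cmod c * B)"
    using X by (auto simp: uniformly_bounded_def norm_scaleC mult_left_mono mult.assoc
        intro: bounded_clinear_scale)
  show "hcoord (dsum R (\<lambda>r h. c *\<^sub>C X r h) f) i = hcoord (c *\<^sub>C dsum R X f) i" for f i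
    by (simp add: hcoord_dsum[OF X] hcoord_dsum[OF cX] scaleC_hsum.rep_eq)
qed

section \<open>Reducing subspaces of dilations\<close>

text \<open>The range of \<open>V\<close> reduces \<open>y\<close>, with \<open>z\<close> as the restriction.\<close>

definition reduces :: "('h::chilbert_space \<Rightarrow> 'k::chilbert_space) \<Rightarrow> 'k op \<Rightarrow> 'h op \<Rightarrow> bool"
  where "reduces V y z \<longleftrightarrow> (\<forall>h. y (V h) = V (z h)) \<and> (\<forall>h. adj y (V h) = V (adj z h))"

lemma reduces_comp:
  assumes "bounded_clinear y" "bounded_clinear y'" "bounded_clinear z" "bounded_clinear z'"
    and "reduces V y z" "reduces V y' z'"
  shows "reduces V (y \<circ> y') (z \<circ> z')"
  using assms by (simp add: reduces_def adj_comp)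

lemma eq_zero_if_norm_le_eps:
  fixes d :: "'a::real_normed_vector" and h :: "'b::real_normed_vector"
  assumes "\<And>\<epsilon>. \<epsilon> > 0 \<Longrightarrow> norm d \<le> 2 * (\<epsilon> * norm h)"
  shows "d = 0"
proof -
  have "norm d \<le> 0"
  proof (rule field_le_epsilon)
    fix \<delta> :: real assume "\<delta> > 0"
    moreover define n where "n = norm h + 1"
    moreover have n: "0 < n" "norm h \<le> n" by (auto simp: n_def add_nonneg_pos)
    ultimately have "norm d \<le> 2 * (\<delta> / 2 / n * norm h)" by (intro assms) simp
    also have "\<dots> = \<delta> * (norm h / n)" by simp
    also have "\<dots> \<le> \<delta> * 1" using \<open>\<delta> > 0\<close> n by (intro mult_left_mono) auto
    finally show "norm d \<le> 0 + \<delta>" by simp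
  qed
  then show ?thesis by simp
qed

lemma closed_subspace_reduces:
  assumes N: "closed_subspace N" and \<rho>: "linear_rep N \<rho>" and \<phi>: "linear_rep N \<phi>"
    and \<rho>_le: "\<And>x k. x \<in> N \<Longrightarrow> norm (\<rho> x k) \<le> onorm x * norm k"
    and \<phi>_le: "\<And>x h. x \<in> N \<Longrightarrow> norm (\<phi> x h) \<le> onorm x * norm h"
    and V: "isometry V"
  shows "closed_subspace {x \<in> N. reduces V (\<rho> x) (\<phi> x)}"
proof (rule closed_subspaceI)
  have Vl: "bounded_clinear V" and Vn: "\<And>h. norm (V h) = norm h" using V by (auto simp: isometry_def)
  note Vs = bounded_clinear_add[OF Vl] bounded_clinear_diff[OF Vl] bounded_clinear_scaleC[OF Vl]
    bounded_clinear_zero[OF Vl]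
  note l = linear_rep_bounded[OF \<rho>] linear_rep_bounded[OF \<phi>]
  show "bounded_clinear x" if "x \<in> {x \<in> N. reduces V (\<rho> x) (\<phi> x)}" for x
    using that N by (auto dest: closed_subspace_bounded)
  show "(\<lambda>_. 0) \<in> {x \<in> N. reduces V (\<rho> x) (\<phi> x)}"
    by (simp add: reduces_def closed_subspace_zero[OF N] linear_rep_zero[OF \<rho> N]
        linear_rep_zero[OF \<phi> N] Vs)
  fix x
  {
    fix y assume "x \<in> {x \<in> N. reduces V (\<rho> x) (\<phi> x)}" "y \<in> {x \<in> N. reduces V (\<rho> x) (\<phi> x)}"
    then show "(\<lambda>h. x h + y h) \<in> {x \<in> N. reduces V (\<rho> x) (\<phi> x)}"
      by (simp add: reduces_def closed_subspace_plus[OF N] linear_rep_plus[OF \<rho>]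
          linear_rep_plus[OF \<phi>] adj_plus l Vs)
  }
  {
    fix c assume "x \<in> {x \<in> N. reduces V (\<rho> x) (\<phi> x)}"
    then show "(\<lambda>h. c *\<^sub>C x h) \<in> {x \<in> N. reduces V (\<rho> x) (\<phi> x)}"
      by (simp add: reduces_def closed_subspace_scale[OF N] linear_rep_scale[OF \<rho>]
          linear_rep_scale[OF \<phi>] adj_scale l Vs)
  }
  assume x: "bounded_clinear x"
    and appr: "\<And>\<epsilon>. \<epsilon> > 0 \<Longrightarrow> \<exists>y\<in>{x \<in> N. reduces V (\<rho> x) (\<phi> x)}. onorm (\<lambda>h. x h - y h) < \<epsilon>"
  have xN: "x \<in> N" using N x appr unfolding closed_subspace_def by blast
  have close: "norm (\<rho> x (V h) - V (\<phi> x h)) \<le> 2 * (\<epsilon> * norm h)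
      \<and> norm (adj (\<rho> x) (V h) - V (adj (\<phi> x) h)) \<le> 2 * (\<epsilon> * norm h)" if "\<epsilon> > 0" for \<epsilon> h
  proof -
    obtain y where y: "y \<in> N" "reduces V (\<rho> y) (\<phi> y)" "onorm (\<lambda>h. x h - y h) < \<epsilon>"
      using appr[OF \<open>\<epsilon> > 0\<close>] by blast
    have dN: "(\<lambda>h. x h - y h) \<in> N" using N xN y(1) by (rule closed_subspace_minus)
    have "norm (\<rho> x k - \<rho> y k) \<le> onorm (\<lambda>h. x h - y h) * norm k" for k
      using \<rho>_le[OF dN, of k] by (simp add: linear_rep_minus[OF \<rho> N xN y(1)])
    then have 1: "norm (\<rho> x k - \<rho> y k) \<le> \<epsilon> * norm k" for k
      using y(3) by (meson less_imp_le mult_right_mono norm_ge_zero order_trans)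
    have "norm (\<phi> x k - \<phi> y k) \<le> onorm (\<lambda>h. x h - y h) * norm k" for k
      using \<phi>_le[OF dN, of k] by (simp add: linear_rep_minus[OF \<phi> N xN y(1)])
    then have 2: "norm (\<phi> x k - \<phi> y k) \<le> \<epsilon> * norm k" for k
      using y(3) by (meson less_imp_le mult_right_mono norm_ge_zero order_trans)
    have 3: "norm (adj (\<rho> x) k - adj (\<rho> y) k) \<le> \<epsilon> * norm k" for k
      using norm_adj_le[OF bounded_clinear_minus[OF l(1)[OF xN] l(1)[OF y(1)]] _ 1] \<open>\<epsilon> > 0\<close>
      by (simp add: adj_minus[OF l(1)[OF xN] l(1)[OF y(1)]])
    have 4: "norm (adj (\<phi> x) k - adj (\<phi> y) k) \<le> \<epsilon> * norm k" for k
      using norm_adj_le[OF bounded_clinear_minus[OF l(2)[OF xN] l(2)[OF y(1)]] _ 2] \<open>\<epsilon> > 0\<close>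
      by (simp add: adj_minus[OF l(2)[OF xN] l(2)[OF y(1)]])
    have "norm (\<rho> x (V h) - V (\<phi> x h)) = norm ((\<rho> x (V h) - \<rho> y (V h)) - V (\<phi> x h - \<phi> y h))"
      using y(2) by (simp add: reduces_def Vs)
    also have "\<dots> \<le> \<epsilon> * norm h + \<epsilon> * norm h"
      using norm_triangle_ineq4 add_mono[OF 1[of "V h"] 2[of h]] by (metis Vn order_trans)
    finally have a: "norm (\<rho> x (V h) - V (\<phi> x h)) \<le> 2 * (\<epsilon> * norm h)" by simp
    have "norm (adj (\<rho> x) (V h) - V (adj (\<phi> x) h))
        = norm ((adj (\<rho> x) (V h) - adj (\<rho> y) (V h)) - V (adj (\<phi> x) h - adj (\<phi> y) h))"
      using y(2) by (simp add: reduces_def Vs)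
    also have "\<dots> \<le> \<epsilon> * norm h + \<epsilon> * norm h"
      using norm_triangle_ineq4 add_mono[OF 3[of "V h"] 4[of h]] by (metis Vn order_trans)
    finally show ?thesis using a by simp
  qed
  have "\<rho> x (V h) - V (\<phi> x h) = 0" "adj (\<rho> x) (V h) - V (adj (\<phi> x) h) = 0" for h
    using close by (blast intro: eq_zero_if_norm_le_eps)+
  then show "x \<in> {x \<in> N. reduces V (\<rho> x) (\<phi> x)}" using xN by (simp add: reduces_def)
qed

text \<open>Vectors that are not longer than their compressions lie in the subspace: the squared distance of
  \<open>w\<close> to \<open>V z\<close> is the difference of the squared norms. Only the total over \<open>F\<close> is needed, since each
  difference is nonnegative; for row contractions only the total is available.\<close>

lemma compression_norm_preserved:
  assumes V: "isometry V" and F: "finite F"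
    and c: "\<And>j g. j \<in> F \<Longrightarrow> cinner (V g) (w j) = cinner g (z j)"
    and n: "(\<Sum>j\<in>F. (norm (w j))\<^sup>2) \<le> (\<Sum>j\<in>F. (norm (z j))\<^sup>2)"
    and j: "j \<in> F"
  shows "w j = V (z j)"
proof -
  have Vn: "\<And>h. norm (V h) = norm h" using V by (simp add: isometry_def)
  have "(norm (w i - V (z i)))\<^sup>2 = (norm (w i))\<^sup>2 - (norm (z i))\<^sup>2" if "i \<in> F" for i
    using c[OF that, of "z i"]
    by (simp add: norm_diff_sq Re_cinner_commute[of "w i"] Vn cinner_same)
  then have "(\<Sum>i\<in>F. (norm (w i - V (z i)))\<^sup>2) \<le> 0" using n by (simp add: sum_subtractf)
  then have "(\<Sum>i\<in>F. (norm (w i - V (z i)))\<^sup>2) = 0" by (simp add: order_antisym sum_nonneg)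
  then show ?thesis using F j by (simp add: sum_nonneg_eq_0_iff)
qed

text \<open>Adding a vector of the kernel to a vector \<open>e g\<close> of the range cannot make it shorter, so the range
  and the kernel are orthogonal.\<close>

lemma contractive_idempotent_selfadjoint:
  assumes e: "bounded_clinear e" "e \<circ> e = e" and le: "\<And>h. norm (e h) \<le> norm h"
  shows "adj e = e"
proof (rule adj_eqI)
  have ee: "e (e h) = e h" for h using fun_cong[OF e(2), of h] by simp
  have orth: "cinner (e g) (h - e h) = 0" for g h
  proof (rule orthogonal_if_minimal)
    fix c
    have "e (e g + c *\<^sub>C (h - e h)) = e g"
      by (simp add: bounded_clinear_add[OF e(1)] bounded_clinear_scaleC[OF e(1)]
          bounded_clinear_diff[OF e(1)] ee)
    then show "norm (e g) \<le> norm (e g + c *\<^sub>C (h - e h))" using le by metis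
  qed
  fix g h
  have "cinner (e g) h = cinner (e g) (e h)" using orth[of g h] by (simp add: cinner_diff_right)
  moreover have "cinner g (e h) = cinner (e g) (e h)"
    using orth[of h g] cinner_commute[of "g - e g" "e h"] by (simp add: cinner_diff_left)
  ultimately show "cinner (e g) h = cinner g (e h)" by simp
qed

text \<open>As \<open>y\<close> is self-adjoint, the squared norm of \<open>y (V h)\<close> is its inner product with \<open>V h\<close>, which the
  compression determines.\<close>

lemma reduces_projection:
  assumes V: "isometry V"
    and y: "bounded_clinear y" "y \<circ> y = y" and y_le: "\<And>k. norm (y k) \<le> norm k"
    and z: "bounded_clinear z" "z \<circ> z = z" "adj z = z"
    and c: "\<And>g h. cinner (V g) (y (V h)) = cinner g (z h)"
  shows "reduces V y z"
proof -
  have ya: "adj y = y" by (rule contractive_idempotent_selfadjoint[OF y y_le])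
  have "y (V h) = V (z h)" for h
  proof (rule compression_norm_preserved[OF V, of "{()}" "\<lambda>_. y (V h)" "\<lambda>_. z h" "()"])
    have "complex_of_real ((norm (y (V h)))\<^sup>2) = cinner (V h) (y (V h))"
      using norm_sq_eq_adj[OF y(1), of "V h"] fun_cong[OF y(2), of "V h"] by (simp add: ya)
    also have "\<dots> = complex_of_real ((norm (z h))\<^sup>2)"
      using norm_sq_eq_adj[OF z(1), of h] fun_cong[OF z(2), of h] by (simp add: z(3) c)
    finally have "(norm (y (V h)))\<^sup>2 = (norm (z h))\<^sup>2" by (simp only: of_real_eq_iff)
    then show "(\<Sum>j\<in>{()}. (norm (y (V h)))\<^sup>2) \<le> (\<Sum>j\<in>{()}. (norm (z h))\<^sup>2)" by simp
  qed (simp_all add: c)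
  then show ?thesis by (simp add: reduces_def ya z(3))
qed

text \<open>The bound comes from \<open>0 \<le> \<parallel>k - w\<parallel>\<^sup>2\<close> for \<open>w = \<Sum>\<^sub>j y\<^sub>j y\<^sub>j\<^sup>* k\<close>.\<close>

lemma row_contraction_adj:
  assumes F: "finite F" and y: "\<And>j. j \<in> F \<Longrightarrow> bounded_clinear (y j)"
    and row: "\<And>v. (norm (\<Sum>j\<in>F. y j (v j)))\<^sup>2 \<le> (\<Sum>j\<in>F. (norm (v j))\<^sup>2)"
  shows "(\<Sum>j\<in>F. (norm (adj (y j) k))\<^sup>2) \<le> (norm k)\<^sup>2"
proof -
  define w where "w = (\<Sum>j\<in>F. y j (adj (y j) k))"
  have "cinner k w = (\<Sum>j\<in>F. complex_of_real ((norm (adj (y j) k))\<^sup>2))"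
    unfolding w_def cinner_sum_right
  proof (rule sum.cong[OF refl])
    fix j assume "j \<in> F"
    then show "cinner k (y j (adj (y j) k)) = complex_of_real ((norm (adj (y j) k))\<^sup>2)"
      by (simp only: cinner_adj_left[OF y, symmetric] cinner_same)
  qed
  then have "Re (cinner k w) = (\<Sum>j\<in>F. (norm (adj (y j) k))\<^sup>2)" by simp
  moreover have "(norm w)\<^sup>2 \<le> (\<Sum>j\<in>F. (norm (adj (y j) k))\<^sup>2)" unfolding w_def by (rule row)
  moreover have "0 \<le> (norm (k - w))\<^sup>2" by simp
  ultimately show ?thesis by (simp add: norm_diff_sq)
qed

text \<open>The heart of the matter. The initial projections \<open>z\<^sub>j\<^sup>* z\<^sub>j\<close> make \<open>V\<close> intertwine the \<open>y\<^sub>j\<close> and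
  \<open>z\<^sub>j\<close>, because \<open>\<parallel>y\<^sub>j V h\<parallel>\<close> cannot exceed \<open>\<parallel>z\<^sub>j h\<parallel>\<close>. For the adjoints, the row contraction gives one
  inequality for all of the \<open>y\<^sub>j\<^sup>* V h\<close> together, and \<open>Pz = \<Sum>\<^sub>j z\<^sub>j z\<^sub>j\<^sup>*\<close> makes its right-hand side the
  sum of the norms of the compressions.\<close>

lemma reduces_row:
  assumes V: "isometry V" and F: "finite F"
    and y: "\<And>j. j \<in> F \<Longrightarrow> bounded_clinear (y j)" and z: "\<And>j. j \<in> F \<Longrightarrow> bounded_clinear (z j)"
    and c: "\<And>j g h. j \<in> F \<Longrightarrow> cinner (V g) (y j (V h)) = cinner g (z j h)"
    and y_le: "\<And>j k. j \<in> F \<Longrightarrow> norm (y j k) \<le> norm k"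
    and row: "\<And>v. (norm (\<Sum>j\<in>F. y j (v j)))\<^sup>2 \<le> (\<Sum>j\<in>F. (norm (v j))\<^sup>2)"
    and Q: "\<And>j. j \<in> F \<Longrightarrow> reduces V (Qy j) (Qz j)" "\<And>j. j \<in> F \<Longrightarrow> y j \<circ> Qy j = y j"
      "\<And>j. j \<in> F \<Longrightarrow> adj (z j) \<circ> z j = Qz j" "\<And>j. j \<in> F \<Longrightarrow> z j \<circ> Qz j = z j"
    and P: "bounded_clinear Py" "reduces V Py Pz" "\<And>j. j \<in> F \<Longrightarrow> Py \<circ> y j = y j"
      "\<And>j. j \<in> F \<Longrightarrow> Pz \<circ> z j = z j" "\<And>h. Pz h = (\<Sum>j\<in>F. z j (adj (z j) h))"
      "bounded_clinear Pz"
    and i: "i \<in> F"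
  shows "reduces V (y i) (z i)"
proof -
  have Vn: "\<And>h. norm (V h) = norm h" using V by (simp add: isometry_def)
  have "y i (V h) = V (z i h)" for h
  proof (rule compression_norm_preserved[OF V, of "{i}" "\<lambda>_. y i (V h)" "\<lambda>_. z i h" i])
    have "y i (V h) = y i (V (Qz i h))"
      using fun_cong[OF Q(2)[OF i], of "V h"] Q(1)[OF i] by (simp add: reduces_def)
    then have "norm (y i (V h)) \<le> norm (Qz i h)" using y_le[OF i] Vn by metis
    moreover have "complex_of_real ((norm (Qz i h))\<^sup>2) = complex_of_real ((norm (z i h))\<^sup>2)"
    proof -
      have Qzh: "Qz i g = adj (z i) (z i g)" for g using fun_cong[OF Q(3)[OF i], of g] by simp
      have "complex_of_real ((norm (Qz i h))\<^sup>2) = cinner (z i h) (z i (Qz i h))"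
        using cinner_same[of "Qz i h"] by (metis Qzh cinner_adj_left z[OF i])
      also have "z i (Qz i h) = z i h" using fun_cong[OF Q(4)[OF i], of h] by simp
      finally show ?thesis by (simp only: cinner_same)
    qed
    ultimately show "(\<Sum>j\<in>{i}. (norm (y i (V h)))\<^sup>2) \<le> (\<Sum>j\<in>{i}. (norm (z i h))\<^sup>2)"
      by (simp only: of_real_eq_iff) (simp add: power_mono)
  qed (use c i in auto)
  moreover have "adj (y i) (V h) = V (adj (z i) h)" for h
  proof (rule compression_norm_preserved[OF V F, where w = "\<lambda>j. adj (y j) (V h)" and z = "\<lambda>j. adj (z j) h"])
    show "cinner (V g) (adj (y j) (V h)) = cinner g (adj (z j) h)" if "j \<in> F" for j g
      using c[OF that, of h g] cinner_commute[of "y j (V g)" "V h"] cinner_commute[of "z j g" h]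
      by (simp add: cinner_adj_right[OF y[OF that]] cinner_adj_right[OF z[OF that]])
    have Pza: "adj Pz = Pz"
    proof (rule adj_eqI)
      show "cinner (Pz g) h = cinner g (Pz h)" for g h
        by (simp add: P(5) cinner_sum_left cinner_sum_right)
          (intro sum.cong refl, metis cinner_adj_left cinner_adj_right z)
    qed
    have "adj (y j) (V h) = adj (y j) (V (Pz h))" if "j \<in> F" for j
    proof -
      have "adj (y j) = adj (y j) \<circ> adj Py" using adj_comp[OF P(1) y[OF that]] P(3)[OF that] by simp
      moreover have "adj Py (V h) = V (Pz h)" using P(2) by (simp add: reduces_def Pza)
      ultimately show ?thesis by (metis comp_apply)
    qed
    then have "(\<Sum>j\<in>F. (norm (adj (y j) (V h)))\<^sup>2) = (\<Sum>j\<in>F. (norm (adj (y j) (V (Pz h))))\<^sup>2)"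
      by simp
    also have "\<dots> \<le> (norm (Pz h))\<^sup>2" using row_contraction_adj[OF F y row, of "V (Pz h)"] by (simp add: Vn)
    also have "(norm (Pz h))\<^sup>2 = (\<Sum>j\<in>F. (norm (adj (z j) h))\<^sup>2)"
    proof -
      have "Pz (Pz h) = Pz h"
        using fun_cong[OF P(4)] by (simp add: P(5)[of h] bounded_clinear_sum[OF P(6)])
      then have "complex_of_real ((norm (Pz h))\<^sup>2) = cinner h (Pz h)"
        by (simp only: norm_sq_eq_adj[OF P(6)] Pza)
      also have "\<dots> = (\<Sum>j\<in>F. complex_of_real ((norm (adj (z j) h))\<^sup>2))"
        unfolding P(5)[of h] cinner_sum_right
      proof (rule sum.cong[OF refl])
        fix j assume "j \<in> F"
        then show "cinner h (z j (adj (z j) h)) = complex_of_real ((norm (adj (z j) h))\<^sup>2)"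
          by (simp only: cinner_adj_left[OF z, symmetric] cinner_same)
      qed
      finally show ?thesis by (simp only: of_real_sum[symmetric] of_real_eq_iff)
    qed
    finally show "(\<Sum>j\<in>F. (norm (adj (y j) (V h)))\<^sup>2) \<le> (\<Sum>j\<in>F. (norm (adj (z j) h))\<^sup>2)" .
  qed (rule i)
  ultimately show ?thesis by (simp add: reduces_def)
qed

section \<open>The correspondence of a monomial ideal\<close>

subsection \<open>Allowed words\<close>

lemma two_sided_ideal_hull: "two_sided_ideal (two_sided_ideal hull S)"
  by (rule hull_in) (auto simp: two_sided_ideal_def)

lemma monomial_ideal_two_sided: "monomial_ideal I \<Longrightarrow> two_sided_ideal I"
  by (auto simp: monomial_ideal_def two_sided_ideal_hull)

text \<open>The polynomials without terms of degree less than two form an ideal, which contains the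
  generators.\<close>

lemma monomial_ideal_length:
  assumes "monomial_ideal I" "p \<in> I" "w \<in> Poly_Mapping.keys p"
  shows "2 \<le> length w"
proof -
  let ?J = "{p :: 'a list \<Rightarrow>\<^sub>0 complex. \<forall>w\<in>Poly_Mapping.keys p. 2 \<le> length w}"
  obtain S where S: "\<forall>\<mu>\<in>S. 2 \<le> length \<mu>" "I = two_sided_ideal hull (xmon ` S)"
    using assms(1) by (auto simp: monomial_ideal_def)
  have mult: "2 \<le> length w" if pq: "w \<in> Poly_Mapping.keys (p * q)"
    "(\<forall>w\<in>Poly_Mapping.keys p. 2 \<le> length w) \<or> (\<forall>w\<in>Poly_Mapping.keys q. 2 \<le> length w)" for w and p q :: "'a list \<Rightarrow>\<^sub>0 complex"
  proof -
    obtain u v where "w = u + v" "u \<in> Poly_Mapping.keys p" "v \<in> Poly_Mapping.keys q" using pq(1) keys_mult[of p q] by blast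
    with pq(2) show ?thesis by (auto simp: plus_list_def)
  qed
  have "two_sided_ideal ?J"
    unfolding two_sided_ideal_def
  proof (intro conjI ballI allI)
    show "p + q \<in> ?J" if "p \<in> ?J" "q \<in> ?J" for p q using that keys_add[of p q] by blast
  qed (auto intro: mult)
  moreover have "xmon ` S \<subseteq> ?J" using S(1) by (auto simp: xmon_def)
  ultimately have "I \<subseteq> ?J" unfolding S(2) by (intro hull_minimal)
  with assms(2,3) show ?thesis by auto
qed

lemma short_words_allowed:
  assumes "monomial_ideal I" "length \<mu> < 2"
  shows "\<mu> \<in> allowed_words I"
  using monomial_ideal_length[OF assms(1), of "xmon \<mu>" \<mu>] assms(2)
  by (auto simp: allowed_words_def xmon_def)

lemma allowed_words_suffix:
  assumes "monomial_ideal I" "i # \<nu> \<in> allowed_words I"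
  shows "\<nu> \<in> allowed_words I"
  using monomial_ideal_two_sided[OF assms(1)] assms(2)
  by (auto simp: allowed_words_def two_sided_ideal_def xmon_Cons[of i \<nu>])

subsection \<open>Orthonormal bases\<close>

lemma orthonormal_basis_ext:
  assumes e: "orthonormal_basis L e" and x: "bounded_clinear x" and y: "bounded_clinear y"
    and eq: "\<And>\<nu>. \<nu> \<in> L \<Longrightarrow> x (e \<nu>) = y (e \<nu>)"
  shows "x = y"
proof -
  have "closed {h. x h = y h}"
    by (intro closed_Collect_eq linear_continuous_on bounded_clinear_bounded x y)
  moreover have "{\<Sum>\<mu>\<in>F. c \<mu> *\<^sub>C e \<mu> | F c. finite F \<and> F \<subseteq> L} \<subseteq> {h. x h = y h}"
    by (auto simp: bounded_clinear_sum[OF x] bounded_clinear_sum[OF y] bounded_clinear_scaleC[OF x]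
        bounded_clinear_scaleC[OF y] eq subset_iff intro!: sum.cong)
  ultimately have "closure {\<Sum>\<mu>\<in>F. c \<mu> *\<^sub>C e \<mu> | F c. finite F \<and> F \<subseteq> L} \<subseteq> {h. x h = y h}"
    by (rule closure_minimal[rotated])
  with e show ?thesis by (auto simp: orthonormal_basis_def)
qed

lemma bounded_clinear_rank_one: "bounded_clinear (\<lambda>h. cinner g h *\<^sub>C k)"
proof (rule bounded_clinearI)
  show "norm (cinner g h *\<^sub>C k) \<le> (norm g * norm k) * norm h" for h
    using mult_right_mono[OF cinner_cauchy_schwarz[of g h] norm_ge_zero[of k]]
    by (simp add: norm_scaleC ac_simps)
qed (simp_all add: cinner_add_right cinner_scaleC_right scaleC_add_left scaleC_scaleC)

lemma orthonormal_basis_cinner_ext: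
  assumes e: "orthonormal_basis L e" and eq: "\<And>\<nu>. \<nu> \<in> L \<Longrightarrow> cinner (e \<nu>) g = cinner (e \<nu>) h"
  shows "g = h"
proof -
  have "cinner (g - h) (e \<nu>) = 0" if "\<nu> \<in> L" for \<nu>
    using eq[OF that] cinner_commute[of "g - h" "e \<nu>"] by (simp add: cinner_diff_right)
  then have "(\<lambda>k. cinner (g - h) k *\<^sub>C (g - h)) = (\<lambda>_. 0)"
    by (intro orthonormal_basis_ext[OF e bounded_clinear_rank_one bounded_clinear_const_zero]) simp
  from fun_cong[OF this, of "g - h"] have "cmod (cinner (g - h) (g - h)) * norm (g - h) = 0"
    by (simp add: norm_scaleC[symmetric])
  then show ?thesis by (simp add: cinner_same)
qed

lemma bounded_clinear_sum_ops:
  fixes x :: "'i \<Rightarrow> 'h::chilbert_space op"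
  assumes "\<And>i. i \<in> F \<Longrightarrow> bounded_clinear (x i)"
  shows "bounded_clinear (\<lambda>h. \<Sum>i\<in>F. x i h)"
  using closed_subspace_sum[OF cstar_closed_subspace[OF cstar_subalgebra_bounded_ops], of F x] assms
  by simp

lemma closed_subspace_zero_space: "closed_subspace {\<lambda>_. 0}"
proof (rule closed_subspaceI)
  fix x :: "'a op" assume x: "bounded_clinear x"
    and appr: "\<And>\<epsilon>. \<epsilon> > 0 \<Longrightarrow> \<exists>y\<in>{\<lambda>_. 0}. onorm (\<lambda>h. x h - y h) < \<epsilon>"
  have "onorm x \<le> 0" by (rule field_le_epsilon) (use appr in fastforce)
  then have "x h = 0" for h
    using bounded_clinear_norm_le[OF x, of h] bounded_clinear_onorm_nonneg[OF x] by simp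
  then show "x \<in> {\<lambda>_. 0}" by auto
qed auto

subsection \<open>The C*-algebra and the module\<close>

locale monomial_correspondence =
  fixes I :: "('d::finite list \<Rightarrow>\<^sub>0 complex) set"
    and e :: "'d list \<Rightarrow> 'f::chilbert_space"
    and T :: "'d \<Rightarrow> 'f op"
    and A E :: "'f op set"
  assumes I: "monomial_ideal I" and shifts: "monomial_shifts I e T"
    and A_def: "A = monomial_A I T" and E_def: "E = monomial_E I T"
begin

abbreviation L where "L \<equiv> allowed_words I"

lemma Nil_allowed: "[] \<in> L" and single_allowed: "[i] \<in> L"
  by (rule short_words_allowed[OF I], simp)+

lemma basis: "orthonormal_basis L e"
  using shifts by (simp add: monomial_shifts_def)

lemma cinner_basis: "\<mu> \<in> L \<Longrightarrow> \<nu> \<in> L \<Longrightarrow> cinner (e \<mu>) (e \<nu>) = (if \<mu> = \<nu> then 1 else 0)"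
  using basis by (simp add: orthonormal_basis_def)

lemmas op_ext = orthonormal_basis_ext[OF basis]
lemmas basis_cinner_ext = orthonormal_basis_cinner_ext[OF basis]

lemma T_bounded: "bounded_clinear (T i)"
  using shifts by (simp add: monomial_shifts_def)

lemma T_basis: "\<nu> \<in> L \<Longrightarrow> T i (e \<nu>) = (if i # \<nu> \<in> L then e (i # \<nu>) else 0)"
  using shifts by (simp add: monomial_shifts_def)

lemma word_op_Cons: "word_op T (i # \<mu>) = T i \<circ> word_op T \<mu>"
  by (simp add: word_op_def)

lemma word_op_bounded: "bounded_clinear (word_op T \<mu>)"
proof (induction \<mu>)
  case Nil
  show ?case by (simp add: word_op_def)
next
  case (Cons i \<mu>)
  then show ?case unfolding word_op_Cons by (rule bounded_clinear_comp[OF T_bounded])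
qed

lemma word_op_basis:
  assumes "\<nu> \<in> L"
  shows "word_op T \<mu> (e \<nu>) = (if \<mu> @ \<nu> \<in> L then e (\<mu> @ \<nu>) else 0)"
proof (induction \<mu>)
  case Nil
  then show ?case using assms by (simp add: word_op_def)
next
  case (Cons i \<mu>)
  then show ?case
    using allowed_words_suffix[OF I, of i "\<mu> @ \<nu>"]
    by (auto simp: word_op_Cons T_basis bounded_clinear_zero[OF T_bounded])
qed

lemma word_op_single: "word_op T [i] = T i"
  by (simp add: word_op_def)

definition proj where "proj \<mu> = adj (word_op T \<mu>) \<circ> word_op T \<mu>"

lemma proj_bounded: "bounded_clinear (proj \<mu>)"
  unfolding proj_def by (intro bounded_clinear_comp bounded_clinear_adj word_op_bounded)

lemma proj_basis:
  assumes \<nu>: "\<nu> \<in> L"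
  shows "proj \<mu> (e \<nu>) = (if \<mu> @ \<nu> \<in> L then e \<nu> else 0)"
proof (rule basis_cinner_ext)
  fix \<kappa> assume "\<kappa> \<in> L"
  then show "cinner (e \<kappa>) (proj \<mu> (e \<nu>)) = cinner (e \<kappa>) (if \<mu> @ \<nu> \<in> L then e \<nu> else 0)"
    using \<nu> by (simp add: proj_def cinner_adj_right[OF word_op_bounded] word_op_basis cinner_basis)
qed

lemma proj_adj: "adj (proj \<mu>) = proj \<mu>"
  unfolding proj_def
  by (simp add: adj_comp bounded_clinear_adj word_op_bounded adj_adj)

lemma proj_idem: "proj \<mu> \<circ> proj \<mu> = proj \<mu>"
  by (rule op_ext) (auto intro!: bounded_clinear_comp proj_bounded
    simp: proj_basis bounded_clinear_zero[OF proj_bounded])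

lemma A_eq: "A = cstar_subalgebra hull (proj ` L)"
  unfolding A_def monomial_A_def by (rule arg_cong[of _ _ "(hull) cstar_subalgebra"]) (auto simp: proj_def)

lemma A_cstar: "cstar_subalgebra A"
  unfolding A_eq by (rule cstar_subalgebra_hull) (auto simp: proj_bounded)

lemmas A_closed = cstar_closed_subspace[OF A_cstar]

text \<open>In this form generation can be used for maps that need not preserve adjoints, such as the
  dilations of representations.\<close>

lemma A_eq_projections: "A = closed_subalgebra hull (proj ` L)"
  unfolding A_eq by (rule cstar_hull_selfadjoint) (auto simp: proj_bounded proj_adj)

lemma proj_A: "\<mu> \<in> L \<Longrightarrow> proj \<mu> \<in> A"
  unfolding A_eq by (auto intro: hull_inc)

lemma id_A: "id \<in> A"
  using proj_A[OF Nil_allowed] by (simp add: proj_def word_op_def)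

lemma T_T: "adj (T i) \<circ> T j = (if i = j then proj [i] else (\<lambda>_. 0))"
proof (cases "i = j")
  case False
  have "adj (T i) \<circ> T j = (\<lambda>_. 0)"
  proof (rule op_ext)
    show "bounded_clinear (adj (T i) \<circ> T j)"
      by (intro bounded_clinear_comp bounded_clinear_adj T_bounded)
    fix \<nu> assume \<nu>: "\<nu> \<in> L"
    show "(adj (T i) \<circ> T j) (e \<nu>) = 0"
      by (rule basis_cinner_ext) (use False \<nu> in
        \<open>simp add: cinner_adj_right[OF T_bounded] T_basis cinner_basis\<close>)
  qed simp
  with False show ?thesis by simp
qed (simp add: proj_def word_op_single)

lemma T_T_A: "adj (T i) \<circ> T j \<in> A"
  by (simp add: T_T proj_A single_allowed closed_subspace_zero[OF A_closed])

lemma T_proj: "T i \<circ> proj [i] = T i"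
  by (rule op_ext) (auto intro!: bounded_clinear_comp proj_bounded T_bounded
    simp: proj_basis T_basis bounded_clinear_zero[OF T_bounded])

lemma A_bounded: "a \<in> A \<Longrightarrow> bounded_clinear a"
  by (rule cstar_bounded[OF A_cstar])

lemma E_closed: "closed_subspace E"
  unfolding E_def monomial_E_def
  by (rule closed_subspace_hull) (auto simp: A_def[symmetric] A_bounded bounded_clinear_comp T_bounded)

lemma E_bounded: "\<xi> \<in> E \<Longrightarrow> bounded_clinear \<xi>"
  by (rule closed_subspace_bounded[OF E_closed])

lemma T_A_E: "a \<in> A \<Longrightarrow> T i \<circ> a \<in> E"
  unfolding E_def monomial_E_def by (rule hull_inc) (auto simp: A_def)

lemma T_E: "T i \<in> E"
  using T_A_E[OF id_A] by simp

lemma E_induct: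
  assumes "closed_subspace {\<xi> \<in> E. P \<xi>}" and gen: "\<And>i a. a \<in> A \<Longrightarrow> P (T i \<circ> a)" and "\<xi> \<in> E"
  shows "P \<xi>"
proof -
  have "E \<subseteq> {\<xi> \<in> E. P \<xi>}"
    unfolding E_def monomial_E_def
    by (rule hull_minimal) (use assms(1) T_A_E gen in \<open>auto simp: E_def monomial_E_def A_def\<close>)
  with assms(3) show ?thesis by blast
qed

text \<open>The generators are taken in one argument at a time; taking adjoints exchanges the arguments.\<close>

lemma E_E_A:
  assumes \<xi>: "\<xi> \<in> E" and \<eta>: "\<eta> \<in> E"
  shows "adj \<eta> \<circ> \<xi> \<in> A"
proof -
  have gen: "adj (T i \<circ> a) \<circ> \<zeta> \<in> A" if a: "a \<in> A" and "\<zeta> \<in> E" for i a \<zeta>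
    using _ _ \<open>\<zeta> \<in> E\<close>
  proof (rule E_induct)
    show "closed_subspace {\<zeta> \<in> E. adj (T i \<circ> a) \<circ> \<zeta> \<in> A}"
      by (intro closed_subspace_left_mult_vimage E_closed A_closed bounded_clinear_adj
          bounded_clinear_comp T_bounded A_bounded a)
    fix j b assume b: "b \<in> A"
    have "adj (T i \<circ> a) \<circ> (T j \<circ> b) = adj a \<circ> ((adj (T i) \<circ> T j) \<circ> b)"
      by (simp add: adj_comp T_bounded A_bounded a fun_eq_iff)
    then show "adj (T i \<circ> a) \<circ> (T j \<circ> b) \<in> A"
      using cstar_comp[OF A_cstar cstar_adj[OF A_cstar a] cstar_comp[OF A_cstar T_T_A b]] by simp
  qed
  have "adj \<xi> \<circ> \<eta> \<in> A"
    using _ _ \<eta>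
  proof (rule E_induct)
    show "closed_subspace {\<zeta> \<in> E. adj \<xi> \<circ> \<zeta> \<in> A}"
      by (intro closed_subspace_left_mult_vimage E_closed A_closed bounded_clinear_adj E_bounded \<xi>)
    fix i a assume a: "a \<in> A"
    have bd: "bounded_clinear (T i \<circ> a)" by (intro E_bounded T_A_E a)
    have "adj (adj (T i \<circ> a) \<circ> \<xi>) = adj \<xi> \<circ> (T i \<circ> a)"
      using adj_comp[OF bounded_clinear_adj[OF bd] E_bounded[OF \<xi>]] by (simp only: adj_adj[OF bd])
    with cstar_adj[OF A_cstar gen[OF a \<xi>]] show "adj \<xi> \<circ> (T i \<circ> a) \<in> A" by metis
  qed
  moreover have "adj (adj \<xi> \<circ> \<eta>) = adj \<eta> \<circ> \<xi>"
    using adj_comp[OF bounded_clinear_adj[OF E_bounded[OF \<xi>]] E_bounded[OF \<eta>]]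
    by (simp only: adj_adj[OF E_bounded[OF \<xi>]])
  ultimately show ?thesis using cstar_adj[OF A_cstar] by metis
qed

text \<open>The \<open>T\<^sub>i\<close> are a frame of \<open>E\<close>: \<open>\<Sum>\<^sub>i T\<^sub>i T\<^sub>i\<^sup>*\<close> is the projection onto the orthogonal complement of
  the vacuum vector, which fixes every \<open>T\<^sub>i\<close>.\<close>

lemma frame:
  assumes "\<zeta> \<in> E"
  shows "(\<Sum>i\<in>UNIV. T i (adj (T i) (\<zeta> h))) = \<zeta> h"
proof -
  define S where "S = (\<lambda>h. (\<Sum>i\<in>UNIV. (T i \<circ> adj (T i)) h) - id h)"
  have S_b: "bounded_clinear S"
    unfolding S_def
    by (intro bounded_clinear_minus bounded_clinear_sum_ops bounded_clinear_comp bounded_clinear_adj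
        T_bounded bounded_clinear_id)
  have ST: "S (T j h) = 0" for j h
  proof -
    have "(\<Sum>i\<in>UNIV. T i ((adj (T i) \<circ> T j) h)) = (\<Sum>i\<in>UNIV. if i = j then T j h else 0)"
      using fun_cong[OF T_proj, of _ h]
      by (intro sum.cong refl) (auto simp: T_T bounded_clinear_zero[OF T_bounded] simp del: o_apply, simp)
    then show ?thesis by (simp add: S_def)
  qed
  have "S \<circ> \<zeta> \<in> {\<lambda>_. 0}"
    using _ _ assms
  proof (rule E_induct)
    show "closed_subspace {\<zeta> \<in> E. S \<circ> \<zeta> \<in> {\<lambda>_. 0}}"
      by (rule closed_subspace_left_mult_vimage[OF E_closed closed_subspace_zero_space S_b])
  qed (auto simp: ST)
  then have "S (\<zeta> h) = 0" by (auto simp: fun_eq_iff)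
  then show ?thesis by (simp add: S_def)
qed

text \<open>\<open>A\<close> is diagonal, as its generators commute with the rank-one projections of the basis.\<close>

lemma A_diagonal:
  assumes a: "a \<in> A" and \<nu>: "\<nu> \<in> L"
  shows "\<exists>c. a (e \<nu>) = c *\<^sub>C e \<nu>"
proof -
  define q where "q = (\<lambda>h. cinner (e \<nu>) h *\<^sub>C e \<nu>)"
  have q: "bounded_clinear q" unfolding q_def by (rule bounded_clinear_rank_one)
  have qa: "adj q = q"
    by (rule adj_eqI) (simp add: q_def cinner_scaleC_left cinner_scaleC_right
      cinner_commute[symmetric] mult.commute)
  have "A \<subseteq> {x. bounded_clinear x \<and> x \<circ> q = q \<circ> x}"
    unfolding A_eq
  proof (intro hull_minimal cstar_subalgebra_commutant q qa image_subsetI CollectI)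
    fix \<mu>
    have "proj \<mu> (q h) = q (proj \<mu> h)" for h
    proof -
      have "cinner (e \<nu>) (proj \<mu> h) = cinner (proj \<mu> (e \<nu>)) h"
        using cinner_adj_right[OF proj_bounded, of "e \<nu>" \<mu> h] by (simp add: proj_adj)
      then show ?thesis
        by (simp add: q_def bounded_clinear_scaleC[OF proj_bounded] proj_basis[OF \<nu>])
    qed
    then show "bounded_clinear (proj \<mu>) \<and> proj \<mu> \<circ> q = q \<circ> proj \<mu>"
      by (auto simp: proj_bounded)
  qed
  then have "a \<circ> q = q \<circ> a" using a by blast
  from fun_cong[OF this, of "e \<nu>"] show ?thesis by (auto simp: q_def cinner_basis \<nu>)
qed

lemma left_kernel_iff: "b \<in> left_kernel A E \<longleftrightarrow> b \<in> A \<and> (\<forall>\<zeta>\<in>E. b \<circ> \<zeta> = (\<lambda>_. 0))"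
proof -
  have "left_action E b = on_E E (\<lambda>_ _. 0) \<longleftrightarrow> (\<forall>\<zeta>\<in>E. b \<circ> \<zeta> = (\<lambda>_. 0))"
    unfolding left_action_def on_E_def fun_eq_iff by auto
  then show ?thesis by (simp add: left_kernel_def)
qed

lemma left_kernel_basis:
  assumes b: "b \<in> left_kernel A E"
  shows "\<exists>c. \<forall>\<nu>\<in>L. b (e \<nu>) = (if \<nu> = [] then c *\<^sub>C e [] else 0)"
proof -
  obtain c where c: "b (e []) = c *\<^sub>C e []"
    using A_diagonal[of b "[]"] b Nil_allowed by (auto simp: left_kernel_iff)
  have "b (e \<nu>) = 0" if \<nu>: "\<nu> \<in> L" "\<nu> \<noteq> []" for \<nu>
  proof -
    obtain i \<nu>' where \<nu>': "\<nu> = i # \<nu>'" using \<nu>(2) by (cases \<nu>) auto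
    have "b \<circ> T i = (\<lambda>_. 0)" using b T_E by (simp add: left_kernel_iff)
    from fun_cong[OF this, of "e \<nu>'"] show ?thesis
      using \<nu>(1) allowed_words_suffix[OF I, of i \<nu>'] by (simp add: \<nu>' T_basis)
  qed
  with c show ?thesis by auto
qed

text \<open>Elements of the left kernel vanish off the vacuum vector. So either the kernel is zero, or it
  consists of the multiples of the vacuum projection, whose complement acts as the identity on \<open>E\<close>.\<close>

lemma identity_on_E_orthogonal_to_kernel:
  obtains p where "p \<in> A" "\<And>b. b \<in> left_kernel A E \<Longrightarrow> p \<circ> b = (\<lambda>_. 0)" "\<And>\<zeta>. \<zeta> \<in> E \<Longrightarrow> p \<circ> \<zeta> = \<zeta>"
proof (cases "left_kernel A E \<subseteq> {\<lambda>_. 0}")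
  case True
  show ?thesis by (rule that[of id]) (use True id_A in auto)
next
  case False
  then obtain b where b: "b \<in> left_kernel A E" "b \<noteq> (\<lambda>_. 0)" by auto
  have bA: "b \<in> A" using b(1) by (simp add: left_kernel_iff)
  obtain c where c: "\<And>\<nu>. \<nu> \<in> L \<Longrightarrow> b (e \<nu>) = (if \<nu> = [] then c *\<^sub>C e [] else 0)"
    using left_kernel_basis[OF b(1)] by blast
  have c0: "c \<noteq> 0"
  proof
    assume "c = 0"
    then have "b = (\<lambda>_. 0)" by (intro op_ext A_bounded[OF bA] bounded_clinear_const_zero) (auto simp: c)
    with b(2) show False by simp
  qed
  define p where "p = (\<lambda>h. id h - (1 / c) *\<^sub>C b h)"
  have pA: "p \<in> A"
    unfolding p_def by (intro closed_subspace_minus closed_subspace_scale A_closed id_A bA)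
  show ?thesis
  proof (rule that[OF pA])
    fix b' assume b': "b' \<in> left_kernel A E"
    obtain c' where c': "\<And>\<nu>. \<nu> \<in> L \<Longrightarrow> b' (e \<nu>) = (if \<nu> = [] then c' *\<^sub>C e [] else 0)"
      using left_kernel_basis[OF b'] by blast
    have "b' \<in> A" using b' by (simp add: left_kernel_iff)
    then show "p \<circ> b' = (\<lambda>_. 0)"
      using c0 by (intro op_ext bounded_clinear_comp A_bounded pA bounded_clinear_const_zero)
        (auto simp: c' p_def bounded_clinear_scaleC[OF A_bounded[OF bA]] c Nil_allowed scaleC_scaleC
          bounded_clinear_zero[OF A_bounded[OF bA]])
  next
    fix \<zeta> assume "\<zeta> \<in> E"
    then have "b (\<zeta> h) = 0" for h using b(1) by (auto simp: left_kernel_iff fun_eq_iff)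
    then show "p \<circ> \<zeta> = \<zeta>" by (auto simp: p_def)
  qed
qed

text \<open>The identity of \<open>E\<close> for \<open>F = UNIV\<close>. The other sets \<open>F\<close> serve to compute the induced map by
  induction, which has to stay within the compact operators.\<close>

definition frame_op :: "'d set \<Rightarrow> 'f op \<Rightarrow> 'f op"
  where "frame_op F = (\<lambda>\<zeta> h. \<Sum>i\<in>F. theta E (T i) (T i) \<zeta> h)"

lemma theta_E: "\<zeta> \<in> E \<Longrightarrow> theta E (T i) (T i) \<zeta> \<in> E"
  by (simp add: theta_def on_E_def T_A_E E_E_A T_E)

lemma theta_not_E: "\<zeta> \<notin> E \<Longrightarrow> theta E \<xi> \<eta> \<zeta> = (\<lambda>_. 0)"
  by (simp add: theta_def on_E_def)

lemma frame_op_compact: "frame_op F \<in> compacts E"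
proof -
  obtain f where f: "bij_betw f {..<card F} F"
    using ex_bij_betw_nat_finite[of F] by (auto simp: atLeast0LessThan)
  have "frame_op F = (\<lambda>\<zeta> h. \<Sum>j<card F. theta E (T (f j)) (T (f j)) \<zeta> h)"
    unfolding frame_op_def
    by (intro ext sum.reindex_bij_betw[OF f, symmetric])
  then have fr: "frame_op F \<in> finite_ranks E"
    unfolding finite_ranks_def mem_Collect_eq
    by (intro exI[of _ "card F"] exI[of _ "\<lambda>j. T (f j)"]) (auto simp: T_E)
  show ?thesis
    unfolding compacts_def mem_Collect_eq
  proof (intro conjI allI impI)
    show "frame_op F ` E \<subseteq> E"
      unfolding frame_op_def by (auto intro!: closed_subspace_sum[OF E_closed] theta_E)
    show "on_E E (frame_op F) = frame_op F"
      by (auto simp: on_E_def frame_op_def theta_not_E fun_eq_iff)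
    fix \<epsilon> :: real assume "0 < \<epsilon>"
    then show "\<exists>k\<in>finite_ranks E. Defs.E_bounded E (\<lambda>\<zeta> h. frame_op F \<zeta> h - k \<zeta> h) \<epsilon>"
      by (intro bexI[OF _ fr]) (auto simp: Defs.E_bounded_def onorm_zero
        intro!: mult_nonneg_nonneg bounded_clinear_onorm_nonneg E_bounded)
  qed
qed

lemma left_action_identity:
  assumes "\<And>\<zeta>. \<zeta> \<in> E \<Longrightarrow> p \<circ> \<zeta> = \<zeta>"
  shows "left_action E p = frame_op UNIV"
proof
  fix \<zeta>
  show "left_action E p \<zeta> = frame_op UNIV \<zeta>"
  proof (cases "\<zeta> \<in> E")
    case True
    then show ?thesis
      using frame[OF True] assms by (auto simp: left_action_def frame_op_def theta_def on_E_def)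
  qed (simp add: left_action_def frame_op_def on_E_def theta_not_E)
qed

subsection \<open>Representations of the correspondence\<close>

lemma corr_repD:
  assumes "corr_rep A E \<pi> t"
  shows corr_rep_star: "star_rep A \<pi>" and corr_rep_linear: "linear_rep E t"
    and corr_rep_inner: "\<xi> \<in> E \<Longrightarrow> \<eta> \<in> E \<Longrightarrow> adj (t \<xi>) \<circ> t \<eta> = \<pi> (adj \<xi> \<circ> \<eta>)"
    and corr_rep_left: "a \<in> A \<Longrightarrow> \<xi> \<in> E \<Longrightarrow> \<pi> a \<circ> t \<xi> = t (left_action E a \<xi>)"
  using assms by (auto simp: corr_rep_def)

text \<open>The bounds do not depend on the representation, as is necessary for direct sums over all of
  them.\<close>

lemma corr_rep_A_le:
  assumes "corr_rep A E \<pi> t" "a \<in> A"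
  shows "norm (\<pi> a h) \<le> onorm a * norm h"
  by (rule star_rep_contractive[OF A_cstar id_A corr_rep_star[OF assms(1)] assms(2)])

lemma corr_rep_E_le:
  assumes t: "corr_rep A E \<pi> t" and \<xi>: "\<xi> \<in> E"
  shows "norm (t \<xi> h) \<le> onorm \<xi> * norm h"
proof -
  have tb: "bounded_clinear (t \<xi>)" using corr_rep_linear[OF t] \<xi> by (rule linear_rep_bounded)
  have \<xi>b: "bounded_clinear \<xi>" by (rule E_bounded[OF \<xi>])
  note n0 = bounded_clinear_onorm_nonneg[OF \<xi>b]
  have "onorm (adj \<xi> \<circ> \<xi>) \<le> onorm \<xi> * onorm \<xi>"
  proof (rule onorm_bound)
    show "norm ((adj \<xi> \<circ> \<xi>) h) \<le> onorm \<xi> * onorm \<xi> * norm h" for h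
      using order_trans[OF norm_adj_le[OF \<xi>b n0 bounded_clinear_norm_le[OF \<xi>b]]
          mult_left_mono[OF bounded_clinear_norm_le[OF \<xi>b] n0]]
      by (simp add: mult.assoc)
  qed (simp add: n0)
  then have le: "norm (\<pi> (adj \<xi> \<circ> \<xi>) h) \<le> onorm \<xi> * onorm \<xi> * norm h"
    using corr_rep_A_le[OF t E_E_A[OF \<xi> \<xi>], of h] by (meson mult_right_mono norm_ge_zero order_trans)
  have "complex_of_real ((norm (t \<xi> h))\<^sup>2) = cinner h (\<pi> (adj \<xi> \<circ> \<xi>) h)"
    using norm_sq_eq_adj[OF tb, of h] fun_cong[OF corr_rep_inner[OF t \<xi> \<xi>], of h] by simp
  then have "(norm (t \<xi> h))\<^sup>2 = cmod (cinner h (\<pi> (adj \<xi> \<circ> \<xi>) h))"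
    by (metis abs_of_nonneg norm_of_real zero_le_power2)
  also have "\<dots> \<le> norm h * (onorm \<xi> * onorm \<xi> * norm h)"
    using cinner_cauchy_schwarz mult_left_mono[OF le norm_ge_zero] order_trans by blast
  finally have "(norm (t \<xi> h))\<^sup>2 \<le> (onorm \<xi> * norm h)\<^sup>2" by (simp add: power2_eq_square ac_simps)
  then show ?thesis by (rule power2_le_imp_le) (simp add: n0)
qed

text \<open>The relation \<open>t(\<xi>)\<^sup>* t(\<eta>) = \<pi>(\<xi>\<^sup>* \<eta>)\<close> makes the norm of the difference of the two sides vanish on every
  vector.\<close>

lemma corr_rep_right:
  assumes t: "corr_rep A E \<pi> t" and a: "a \<in> A"
  shows "t (T i \<circ> a) = t (T i) \<circ> \<pi> a"
proof
  fix h
  have b: "bounded_clinear (t (T i \<circ> a))" "bounded_clinear (t (T i))"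
    by (intro linear_rep_bounded[OF corr_rep_linear[OF t]] T_E T_A_E a)+
  note ins = corr_rep_inner[OF t]
  have hom: "\<pi> (x \<circ> y) = \<pi> x \<circ> \<pi> y" if "x \<in> A" "y \<in> A" for x y
    using corr_rep_star[OF t] that by (rule star_rep_comp)
  define u where "u = t (T i \<circ> a) h"
  define w where "w = t (T i) (\<pi> a h)"
  have star: "\<pi> (adj a) = adj (\<pi> a)" using corr_rep_star[OF t] a by (rule star_rep_adj)
  have \<pi>b: "bounded_clinear (\<pi> a)" using corr_rep_star[OF t] a by (rule star_rep_bounded)
  have TaT: "adj (T i \<circ> a) \<circ> T i = adj a \<circ> (adj (T i) \<circ> T i)"
    "adj (T i) \<circ> (T i \<circ> a) = (adj (T i) \<circ> T i) \<circ> a"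
    "adj (T i \<circ> a) \<circ> (T i \<circ> a) = adj a \<circ> ((adj (T i) \<circ> T i) \<circ> a)"
    by (simp_all add: adj_comp T_bounded A_bounded a fun_eq_iff)
  let ?g = "\<pi> (adj (T i) \<circ> T i)"
  have uu: "cinner u u = cinner (\<pi> a h) (?g (\<pi> a h))"
    using fun_cong[OF ins[OF T_A_E[OF a, of i] T_A_E[OF a, of i]], of h]
    by (simp add: u_def cinner_adj_right[OF b(1), symmetric] TaT hom cstar_adj[OF A_cstar a] T_T_A a
        cstar_comp[OF A_cstar] star cinner_adj_right[OF \<pi>b] del: o_apply)
      (simp add: cinner_adj_right[OF \<pi>b])
  have wu: "cinner w u = cinner (\<pi> a h) (?g (\<pi> a h))"
    using fun_cong[OF ins[OF T_E[of i] T_A_E[OF a, of i]], of h]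
    by (simp add: u_def w_def cinner_adj_right[OF b(2), symmetric] TaT(2) hom T_T_A a)
  have ww: "cinner w w = cinner (\<pi> a h) (?g (\<pi> a h))"
    using fun_cong[OF ins[OF T_E[of i] T_E[of i]], of "\<pi> a h"]
    by (simp add: w_def cinner_adj_right[OF b(2), symmetric])
  have "(norm (u - w))\<^sup>2 = 0"
    using uu wu ww unfolding norm_diff_sq Re_cinner_commute[of u w] by (simp add: power2_norm_eq_cinner)
  then show "t (T i \<circ> a) h = (t (T i) \<circ> \<pi> a) h" by (simp add: u_def w_def)
qed

lemma induced_map_frame_op:
  assumes \<psi>: "induced_map E t \<psi>"
  shows "\<psi> (frame_op F) = (\<lambda>h. \<Sum>i\<in>F. t (T i) (adj (t (T i)) h))"
proof (induction F rule: finite_induct[OF finite])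
  case 1
  have "\<psi> (\<lambda>\<zeta> h. 0 *\<^sub>C frame_op {} \<zeta> h) = (\<lambda>h. 0 *\<^sub>C \<psi> (frame_op {}) h)"
    using \<psi> frame_op_compact unfolding induced_map_def by blast
  then show ?case by (simp add: frame_op_def)
next
  case (2 i F)
  have single: "frame_op {i} = theta E (T i) (T i)" by (simp add: frame_op_def)
  have "\<psi> (\<lambda>\<zeta> h. frame_op {i} \<zeta> h + frame_op F \<zeta> h) = (\<lambda>h. \<psi> (frame_op {i}) h + \<psi> (frame_op F) h)"
    using \<psi> frame_op_compact unfolding induced_map_def by blast
  moreover have "(\<lambda>\<zeta> h. frame_op {i} \<zeta> h + frame_op F \<zeta> h) = frame_op (insert i F)"
    using 2 by (simp add: frame_op_def)
  moreover have "\<psi> (theta E (T i) (T i)) = t (T i) \<circ> adj (t (T i))"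
    using \<psi> T_E unfolding induced_map_def by blast
  ultimately show ?case using 2 by (simp add: single)
qed

text \<open>Katsura's covariance, applied to the identity of \<open>E\<close>, is the Cuntz-Krieger relation
  \<open>P = \<Sum>\<^sub>i S\<^sub>i S\<^sub>i\<^sup>*\<close>.\<close>

lemma covariant_rep_frame:
  assumes t: "covariant_rep A E \<pi> t"
    and p: "p \<in> A" "\<And>b. b \<in> left_kernel A E \<Longrightarrow> p \<circ> b = (\<lambda>_. 0)" "\<And>\<zeta>. \<zeta> \<in> E \<Longrightarrow> p \<circ> \<zeta> = \<zeta>"
  shows "\<pi> p h = (\<Sum>i\<in>UNIV. t (T i) (adj (t (T i)) h))"
proof -
  note la = left_action_identity[OF p(3)]
  have "p \<in> katsura_ideal A E"
    using p(1,2) frame_op_compact[of UNIV] by (auto simp: katsura_ideal_def la)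
  then obtain \<psi> where "induced_map E t \<psi>" "\<pi> p = \<psi> (left_action E p)"
    using t unfolding covariant_rep_def by blast
  then show ?thesis using induced_map_frame_op[of t \<psi> UNIV] by (simp add: la)
qed

end

lemma completely_contractiveD:
  assumes "completely_contractive M \<rho>" "\<And>i j. i < n \<Longrightarrow> j < n \<Longrightarrow> X i j \<in> M" "mat_bounded n X b"
  shows "mat_bounded n (\<lambda>i j. \<rho> (X i j)) b"
  using assms(1)[unfolded completely_contractive_def, rule_format, of n X b] assms(2,3) by simp

lemma linear_rep_compose:
  assumes "linear_rep M \<sigma>" "\<And>x. x \<in> N \<Longrightarrow> f x \<in> M"
    and "\<And>x y. x \<in> N \<Longrightarrow> y \<in> N \<Longrightarrow> f (\<lambda>h. x h + y h) = (\<lambda>h. f x h + f y h)"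
    and "\<And>c x. x \<in> N \<Longrightarrow> f (\<lambda>h. c *\<^sub>C x h) = (\<lambda>h. c *\<^sub>C f x h)"
  shows "linear_rep N (\<lambda>x. \<sigma> (f x))"
  using assms by (simp add: linear_rep_def)

lemma norm_sum_orthogonal_sq:
  assumes "finite J" "\<And>i j. i \<in> J \<Longrightarrow> j \<in> J \<Longrightarrow> i \<noteq> j \<Longrightarrow> cinner (w i) (w j) = 0"
  shows "(norm (\<Sum>j\<in>J. w j))\<^sup>2 = (\<Sum>j\<in>J. (norm (w j :: 'h::chilbert_space))\<^sup>2)"
  using assms
proof (induction J)
  case (insert i J)
  have "cinner (w i) (\<Sum>j\<in>J. w j) = 0"
    unfolding cinner_sum_right using insert.hyps insert.prems by (intro sum.neutral) auto
  then show ?case using insert by (simp add: norm_add_sq)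
qed simp

section \<open>The universal algebras\<close>

context monomial_correspondence
begin

text \<open>The summand of index \<open>r = (\<pi>, t)\<close> is \<open>\<pi> a\<close> or \<open>t \<xi>\<close>.\<close>

definition univ_A where "univ_A R a = dsum R (\<lambda>r. fst r a)"
definition univ_E where "univ_E R \<xi> = dsum R (\<lambda>r. snd r \<xi>)"

lemma univ_gens_eq: "univ_gens A E R = univ_A R ` A \<union> univ_E R ` E"
  by (auto simp: univ_gens_def univ_A_def univ_E_def case_prod_beta')

lemma covariant_subset: "covariant_reps A E \<subseteq> corr_reps A E"
  by (auto simp: covariant_reps_def corr_reps_def covariant_rep_def)

context
  fixes R assumes R: "R \<subseteq> corr_reps A E"
begin

lemma rep_in: "r \<in> R \<Longrightarrow> corr_rep A E (fst r) (snd r)"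
  using R by (auto simp: corr_reps_def)

lemma bounded_family_A: "a \<in> A \<Longrightarrow> uniformly_bounded R (\<lambda>r. fst r a) (onorm a)"
  unfolding uniformly_bounded_def
  using corr_rep_A_le[OF rep_in] star_rep_bounded[OF corr_rep_star[OF rep_in]]
  by (simp add: bounded_clinear_onorm_nonneg A_bounded)

lemma bounded_family_E: "\<xi> \<in> E \<Longrightarrow> uniformly_bounded R (\<lambda>r. snd r \<xi>) (onorm \<xi>)"
  unfolding uniformly_bounded_def
  using corr_rep_E_le[OF rep_in] linear_rep_bounded[OF corr_rep_linear[OF rep_in]]
  by (simp add: bounded_clinear_onorm_nonneg E_bounded)

lemma univ_A_bounded: "a \<in> A \<Longrightarrow> bounded_clinear (univ_A R a)"
  unfolding univ_A_def by (rule bounded_clinear_dsum[OF bounded_family_A])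

lemma univ_E_bounded: "\<xi> \<in> E \<Longrightarrow> bounded_clinear (univ_E R \<xi>)"
  unfolding univ_E_def by (rule bounded_clinear_dsum[OF bounded_family_E])

lemma univ_A_le: "a \<in> A \<Longrightarrow> onorm (univ_A R a) \<le> onorm a"
  unfolding univ_A_def by (rule onorm_dsum_le[OF bounded_family_A])

lemma univ_E_le: "\<xi> \<in> E \<Longrightarrow> onorm (univ_E R \<xi>) \<le> onorm \<xi>"
  unfolding univ_E_def by (rule onorm_dsum_le[OF bounded_family_E])

lemma univ_A_plus:
  assumes "a \<in> A" "b \<in> A"
  shows "univ_A R (\<lambda>h. a h + b h) = (\<lambda>f. univ_A R a f + univ_A R b f)"
  unfolding univ_A_def dsum_plus[OF bounded_family_A[OF assms(1)] bounded_family_A[OF assms(2)], symmetric]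
  by (rule dsum_cong) (simp add: linear_rep_plus[OF star_rep_linear[OF corr_rep_star[OF rep_in]]] assms)

lemma univ_A_scale:
  assumes "a \<in> A"
  shows "univ_A R (\<lambda>h. c *\<^sub>C a h) = (\<lambda>f. c *\<^sub>C univ_A R a f)"
  unfolding univ_A_def dsum_scale[OF bounded_family_A[OF assms], symmetric]
  by (rule dsum_cong) (simp add: linear_rep_scale[OF star_rep_linear[OF corr_rep_star[OF rep_in]]] assms)

lemma univ_E_plus:
  assumes "\<xi> \<in> E" "\<eta> \<in> E"
  shows "univ_E R (\<lambda>h. \<xi> h + \<eta> h) = (\<lambda>f. univ_E R \<xi> f + univ_E R \<eta> f)"
  unfolding univ_E_def dsum_plus[OF bounded_family_E[OF assms(1)] bounded_family_E[OF assms(2)], symmetric]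
  by (rule dsum_cong) (simp add: linear_rep_plus[OF corr_rep_linear[OF rep_in]] assms)

lemma univ_E_scale:
  assumes "\<xi> \<in> E"
  shows "univ_E R (\<lambda>h. c *\<^sub>C \<xi> h) = (\<lambda>f. c *\<^sub>C univ_E R \<xi> f)"
  unfolding univ_E_def dsum_scale[OF bounded_family_E[OF assms], symmetric]
  by (rule dsum_cong) (simp add: linear_rep_scale[OF corr_rep_linear[OF rep_in]] assms)

lemma univ_A_comp:
  assumes "a \<in> A" "b \<in> A"
  shows "univ_A R a \<circ> univ_A R b = univ_A R (a \<circ> b)"
  unfolding univ_A_def dsum_comp[OF bounded_family_A[OF assms(1)] bounded_family_A[OF assms(2)]] Int_absorb
  by (rule dsum_cong) (simp add: star_rep_comp[OF corr_rep_star[OF rep_in]] assms)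

lemma univ_A_adj:
  assumes "a \<in> A"
  shows "adj (univ_A R a) = univ_A R (adj a)"
  unfolding univ_A_def adj_dsum[OF bounded_family_A[OF assms]]
  by (rule dsum_cong) (simp add: star_rep_adj[OF corr_rep_star[OF rep_in]] assms)

lemma univ_E_A:
  assumes "a \<in> A"
  shows "univ_E R (T i) \<circ> univ_A R a = univ_E R (T i \<circ> a)"
  unfolding univ_E_def univ_A_def dsum_comp[OF bounded_family_E[OF T_E] bounded_family_A[OF assms]] Int_absorb
  by (rule dsum_cong) (simp add: corr_rep_right[OF rep_in] assms)

lemma univ_E_inner:
  assumes "\<xi> \<in> E" "\<eta> \<in> E"
  shows "adj (univ_E R \<xi>) \<circ> univ_E R \<eta> = univ_A R (adj \<xi> \<circ> \<eta>)"
  unfolding univ_E_def univ_A_def adj_dsum[OF bounded_family_E[OF assms(1)]]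
    dsum_comp[OF uniformly_bounded_adj[OF bounded_family_E[OF assms(1)]] bounded_family_E[OF assms(2)]]
    Int_absorb
  by (rule dsum_cong) (simp add: corr_rep_inner[OF rep_in] assms)

lemma univ_A_E_identity:
  assumes "p \<in> A" "\<And>\<zeta>. \<zeta> \<in> E \<Longrightarrow> p \<circ> \<zeta> = \<zeta>" "\<xi> \<in> E"
  shows "univ_A R p \<circ> univ_E R \<xi> = univ_E R \<xi>"
  unfolding univ_E_def univ_A_def dsum_comp[OF bounded_family_A[OF assms(1)] bounded_family_E[OF assms(3)]]
    Int_absorb
  by (rule dsum_cong) (use assms(2)[OF assms(3)] in
    \<open>simp add: corr_rep_left[OF rep_in] assms(1,3) left_action_def on_E_def\<close>)

lemma univ_A_zero: "univ_A R (\<lambda>_. 0) = (\<lambda>_. 0)"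
  using univ_A_scale[OF id_A, of 0] by simp

text \<open>The images of the \<open>T\<^sub>i\<close> are contractions with orthogonal ranges.\<close>

lemma univ_row:
  assumes J: "finite J" "inj_on f J"
  shows "(norm (\<Sum>j\<in>J. univ_E R (T (f j)) (v j)))\<^sup>2 \<le> (\<Sum>j\<in>J. (norm (v j))\<^sup>2)"
proof -
  have orth: "cinner (univ_E R (T (f i)) (v i)) (univ_E R (T (f j)) (v j)) = 0"
    if "i \<in> J" "j \<in> J" "i \<noteq> j" for i j
  proof -
    have "f i \<noteq> f j" using that J(2) by (auto dest: inj_onD)
    then have "adj (univ_E R (T (f i))) \<circ> univ_E R (T (f j)) = (\<lambda>_. 0)"
      by (simp add: univ_E_inner[OF T_E T_E] T_T univ_A_zero)
    from fun_cong[OF this, of "v j"] show ?thesis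
      by (simp add: cinner_adj_right[OF univ_E_bounded[OF T_E], symmetric])
  qed
  have le: "norm (univ_E R (T i) h) \<le> norm h" for i h
  proof -
    have "(norm (univ_E R (T i) h))\<^sup>2 = Re (cinner h (univ_A R (proj [i]) h))"
      using norm_sq_eq_Re_adj[OF univ_E_bounded[OF T_E], of i h]
        fun_cong[OF univ_E_inner[OF T_E T_E, of i i], of h]
      by (simp add: T_T)
    also have "\<dots> = (norm (univ_A R (proj [i]) h))\<^sup>2"
    proof -
      have pA: "proj [i] \<in> A" by (rule proj_A[OF single_allowed])
      have "adj (univ_A R (proj [i])) (univ_A R (proj [i]) h) = univ_A R (proj [i]) h"
        using fun_cong[OF univ_A_comp[OF pA pA], of h] by (simp add: univ_A_adj[OF pA] proj_adj proj_idem)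
      with norm_sq_eq_Re_adj[OF univ_A_bounded[OF pA], of h] show ?thesis by simp
    qed
    finally have eq: "(norm (univ_E R (T i) h))\<^sup>2 = (norm (univ_A R (proj [i]) h))\<^sup>2"
      "Re (cinner h (univ_A R (proj [i]) h)) = (norm (univ_A R (proj [i]) h))\<^sup>2"
      using \<open>(norm (univ_E R (T i) h))\<^sup>2 = Re (cinner h (univ_A R (proj [i]) h))\<close> by simp_all
    have "0 \<le> (norm (h - univ_A R (proj [i]) h))\<^sup>2" by simp
    then have "(norm (univ_E R (T i) h))\<^sup>2 \<le> (norm h)\<^sup>2" using eq by (simp add: norm_diff_sq)
    then show ?thesis by simp
  qed
  have "(norm (\<Sum>j\<in>J. univ_E R (T (f j)) (v j)))\<^sup>2 = (\<Sum>j\<in>J. (norm (univ_E R (T (f j)) (v j)))\<^sup>2)"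
    by (rule norm_sum_orthogonal_sq[OF J(1) orth])
  also have "\<dots> \<le> (\<Sum>j\<in>J. (norm (v j))\<^sup>2)"
    by (intro sum_mono power_mono le norm_ge_zero)
  finally show ?thesis .
qed

end

abbreviation all_reps where "all_reps \<equiv> corr_reps A E"
abbreviation cov_reps where "cov_reps \<equiv> covariant_reps A E"
abbreviation N where "N \<equiv> tensor_algebra A E"
abbreviation C where "C \<equiv> cuntz_pimsner_algebra A E"

definition cov_proj where "cov_proj = dsum cov_reps (\<lambda>_ (h::l2). h)"

lemma cp_quotient_eq: "cp_quotient A E x = cov_proj \<circ> x"
  by (simp add: cp_quotient_def cov_proj_def)

lemma bounded_family_q: "uniformly_bounded cov_reps (\<lambda>_ h. h) 1"
  by (simp add: uniformly_bounded_def)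

lemma q_bounded: "bounded_clinear cov_proj"
  unfolding cov_proj_def by (rule bounded_clinear_dsum[OF bounded_family_q])

lemma q_le: "norm (cov_proj h) \<le> norm h"
  using norm_dsum_le[OF bounded_family_q, of h] by (simp add: cov_proj_def)

lemma q_adj: "adj cov_proj = cov_proj"
  by (simp add: cov_proj_def adj_dsum[OF bounded_family_q])

lemma q_idem: "cov_proj \<circ> cov_proj = cov_proj"
  using dsum_comp[OF bounded_family_q bounded_family_q] by (simp add: cov_proj_def o_def)

lemma covariant_Int: "cov_reps \<inter> all_reps = cov_reps" "all_reps \<inter> cov_reps = cov_reps"
  using covariant_subset by auto

lemma q_univ_A:
  assumes "a \<in> A" shows "cov_proj \<circ> univ_A all_reps a = univ_A cov_reps a" "univ_A all_reps a \<circ> cov_proj = univ_A cov_reps a"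
  unfolding cov_proj_def univ_A_def dsum_comp[OF bounded_family_q bounded_family_A[OF order_refl assms]]
    dsum_comp[OF bounded_family_A[OF order_refl assms] bounded_family_q] covariant_Int
  by (simp_all add: comp_def)

lemma q_univ_E:
  assumes "\<xi> \<in> E" shows "cov_proj \<circ> univ_E all_reps \<xi> = univ_E cov_reps \<xi>" "univ_E all_reps \<xi> \<circ> cov_proj = univ_E cov_reps \<xi>"
  unfolding cov_proj_def univ_E_def dsum_comp[OF bounded_family_q bounded_family_E[OF order_refl assms]]
    dsum_comp[OF bounded_family_E[OF order_refl assms] bounded_family_q] covariant_Int
  by (simp_all add: comp_def)

lemma N_closed: "closed_subalgebra N"
  unfolding tensor_algebra_def univ_gens_eq
  by (rule closed_subalgebra_hull) (auto simp: univ_A_bounded univ_E_bounded)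

lemmas N_subspace = closed_subalgebra_subspace[OF N_closed]

lemma N_bounded: "x \<in> N \<Longrightarrow> bounded_clinear x"
  by (rule closed_subspace_bounded[OF N_subspace])

lemma C_cstar: "cstar_subalgebra C"
  unfolding cuntz_pimsner_algebra_def univ_gens_eq
  by (rule cstar_subalgebra_hull) (auto simp: univ_A_bounded univ_E_bounded covariant_subset)

lemma univ_N: "a \<in> A \<Longrightarrow> univ_A all_reps a \<in> N" "\<xi> \<in> E \<Longrightarrow> univ_E all_reps \<xi> \<in> N"
  unfolding tensor_algebra_def univ_gens_eq by (auto intro: hull_inc)

lemma univ_C: "a \<in> A \<Longrightarrow> univ_A cov_reps a \<in> C" "\<xi> \<in> E \<Longrightarrow> univ_E cov_reps \<xi> \<in> C"
  unfolding cuntz_pimsner_algebra_def univ_gens_eq by (auto intro: hull_inc)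

lemma univ_M:
  "a \<in> A \<Longrightarrow> univ_A cov_reps a \<in> cp_quotient A E ` N" "\<xi> \<in> E \<Longrightarrow> univ_E cov_reps \<xi> \<in> cp_quotient A E ` N"
  using univ_N q_univ_A(1) q_univ_E(1) by (metis cp_quotient_eq image_eqI)+

lemma N_induct:
  assumes "closed_subalgebra {x \<in> N. P x}" "\<And>a. a \<in> A \<Longrightarrow> P (univ_A all_reps a)"
    "\<And>\<xi>. \<xi> \<in> E \<Longrightarrow> P (univ_E all_reps \<xi>)" "x \<in> N"
  shows "P x"
proof -
  have "closed_subalgebra hull (univ_A all_reps ` A \<union> univ_E all_reps ` E) \<subseteq> {x \<in> N. P x}"
    by (rule hull_minimal) (use assms(1-3) univ_N in auto)
  with assms(4) show ?thesis by (auto simp: tensor_algebra_def univ_gens_eq)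
qed

lemma N_commutes: "x \<in> N \<Longrightarrow> x \<circ> cov_proj = cov_proj \<circ> x"
proof -
  assume x: "x \<in> N"
  have "N \<subseteq> {x. bounded_clinear x \<and> x \<circ> cov_proj = cov_proj \<circ> x}"
    unfolding tensor_algebra_def univ_gens_eq
  proof (rule hull_minimal)
    show "closed_subalgebra {x. bounded_clinear x \<and> x \<circ> cov_proj = cov_proj \<circ> x}"
      by (rule cstar_closed_subalgebra[OF cstar_subalgebra_commutant[OF q_bounded q_adj]])
  qed (auto simp: univ_A_bounded univ_E_bounded q_univ_A q_univ_E)
  with x show ?thesis by blast
qed

lemma q_mult: "x \<in> N \<Longrightarrow> cov_proj \<circ> (x \<circ> y) = (cov_proj \<circ> x) \<circ> (cov_proj \<circ> y)"
  using fun_cong[OF N_commutes[of x]] fun_cong[OF q_idem] by (auto simp: fun_eq_iff)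

lemma q_N_C: "x \<in> N \<Longrightarrow> cov_proj \<circ> x \<in> C"
proof (rule N_induct[where P = "\<lambda>x. cov_proj \<circ> x \<in> C"])
  show "closed_subalgebra {x \<in> N. cov_proj \<circ> x \<in> C}"
  proof (rule closed_subalgebraI)
    show "closed_subspace {x \<in> N. cov_proj \<circ> x \<in> C}"
      by (intro closed_subspace_left_mult_vimage N_subspace cstar_closed_subspace C_cstar q_bounded)
    fix x y assume "x \<in> {x \<in> N. cov_proj \<circ> x \<in> C}" "y \<in> {x \<in> N. cov_proj \<circ> x \<in> C}"
    then show "x \<circ> y \<in> {x \<in> N. cov_proj \<circ> x \<in> C}"
      using closed_subalgebra_comp[OF N_closed] cstar_comp[OF C_cstar] by (simp add: q_mult)
  qed
qed (simp_all add: q_univ_A q_univ_E univ_C)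

lemma generates: "C = cstar_subalgebra hull (cp_quotient A E ` N)"
proof
  have M: "cp_quotient A E ` N \<subseteq> C" using q_N_C by (auto simp: cp_quotient_eq)
  then show "cstar_subalgebra hull (cp_quotient A E ` N) \<subseteq> C" using C_cstar by (rule hull_minimal)
  show "C \<subseteq> cstar_subalgebra hull (cp_quotient A E ` N)"
    unfolding cuntz_pimsner_algebra_def
    by (rule hull_mono) (use univ_M in \<open>auto simp: univ_gens_eq\<close>)
qed

lemma univ_covariance:
  assumes p: "p \<in> A" "\<And>b. b \<in> left_kernel A E \<Longrightarrow> p \<circ> b = (\<lambda>_. 0)" "\<And>\<zeta>. \<zeta> \<in> E \<Longrightarrow> p \<circ> \<zeta> = \<zeta>"
  shows "univ_A cov_reps p = (\<lambda>f. \<Sum>i\<in>UNIV. (univ_E cov_reps (T i) \<circ> adj (univ_E cov_reps (T i))) f)"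
proof (rule ext, rule hsum_eqI)
  fix f r
  have bE: "uniformly_bounded cov_reps (\<lambda>r. snd r (T i)) (onorm (T i))" for i
    by (rule bounded_family_E[OF covariant_subset T_E])
  have sum: "hcoord (\<Sum>i\<in>F. x i) r = (\<Sum>i\<in>F. hcoord (x i) r)" for F :: "'d set" and x :: "'d \<Rightarrow> 'f univ_space"
    by (induction F rule: finite_induct[OF finite]) (simp_all add: zero_hsum.rep_eq plus_hsum.rep_eq)
  have "fst r p h = (\<Sum>i\<in>UNIV. snd r (T i) (adj (snd r (T i)) h))" if "r \<in> cov_reps" for h
    by (rule covariant_rep_frame[OF _ p]) (use that in \<open>auto simp: covariant_reps_def\<close>)
  then show "hcoord (univ_A cov_reps p f) r
      = hcoord (\<Sum>i\<in>UNIV. (univ_E cov_reps (T i) \<circ> adj (univ_E cov_reps (T i))) f) r"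
    by (simp add: sum univ_A_def univ_E_def hcoord_dsum[OF bounded_family_A[OF covariant_subset p(1)]]
        adj_dsum[OF bE] hcoord_dsum[OF uniformly_bounded_adj[OF bE]] hcoord_dsum[OF bE])
qed

section \<open>Dilations are trivial\<close>

text \<open>The range of \<open>V\<close> is shown to reduce the images of \<open>A\<close>, then of the \<open>T\<^sub>i\<close>, of \<open>E\<close> and of the tensor
  algebra. The closure arguments are about linear representations of \<open>A\<close>, \<open>E\<close> and the tensor algebra
  of the Toeplitz algebra, which are known to be closed; the image of the latter under the quotient
  map is only used as the domain of \<open>\<rho>\<close>.\<close>

lemma maximal:
  fixes \<pi> :: "'f univ_space op \<Rightarrow> 'h::chilbert_space op" and V :: "'h \<Rightarrow> 'k::chilbert_space"
  assumes \<pi>: "star_rep C \<pi>" and dil: "dilation (cp_quotient A E ` N) V \<rho> \<pi>"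
  shows "trivial_dilation (cp_quotient A E ` N) V \<rho>"
proof -
  let ?M = "cp_quotient A E ` N"
  have V: "isometry V" and hom: "homomorphism ?M \<rho>" and cc: "completely_contractive ?M \<rho>"
    and comp: "\<And>a g h. a \<in> ?M \<Longrightarrow> cinner (V g) (\<rho> a (V h)) = cinner g (\<pi> a h)"
    using dil by (auto simp: dilation_def oa_rep_def)
  have lin: "linear_rep ?M \<rho>" and mult: "\<And>x y. x \<in> ?M \<Longrightarrow> y \<in> ?M \<Longrightarrow> \<rho> (x \<circ> y) = \<rho> x \<circ> \<rho> y"
    using hom by (auto simp: homomorphism_def)
  have Vn: "\<And>h. norm (V h) = norm h" using V by (simp add: isometry_def)
  have MC: "x \<in> C" if "x \<in> ?M" for x using that q_N_C by (auto simp: cp_quotient_eq)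
  have M_b: "bounded_clinear x" if "x \<in> ?M" for x using cstar_bounded[OF C_cstar MC[OF that]] .
  note \<pi>lin = star_rep_linear[OF \<pi>]
  have \<rho>_le: "norm (\<rho> x k) \<le> onorm x * norm k" if x: "x \<in> ?M" for x k
  proof -
    have n0: "0 \<le> onorm x" by (rule bounded_clinear_onorm_nonneg[OF M_b[OF x]])
    have "mat_bounded 1 (\<lambda>_ _. x) (onorm x)"
      unfolding mat_bounded_def
      using power_mono[OF bounded_clinear_norm_le[OF M_b[OF x]] norm_ge_zero, of _ 2]
      by (simp add: power_mult_distrib)
    then have "mat_bounded 1 (\<lambda>_ _. \<rho> x) (onorm x)"
      by (rule completely_contractiveD[OF cc x])
    then have "(norm (\<rho> x k))\<^sup>2 \<le> (onorm x * norm k)\<^sup>2"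
      unfolding mat_bounded_def by (auto dest: spec[of _ "\<lambda>_. k"] simp: power_mult_distrib)
    then show ?thesis by (rule power2_le_imp_le) (simp add: n0)
  qed
  have \<pi>_le: "norm (\<pi> x h) \<le> onorm x * norm h" if x: "x \<in> ?M" for x h
  proof -
    \<comment> \<open>\<open>\<pi>\<close> is a compression of \<open>\<rho>\<close> and inherits the bound.\<close>
    have "(norm (\<pi> x h))\<^sup>2 = cmod (cinner (V (\<pi> x h)) (\<rho> x (V h)))"
      using comp[OF x, of "\<pi> x h" h] by (simp add: cinner_same norm_power)
    also have "\<dots> \<le> norm (\<pi> x h) * norm (\<rho> x (V h))" using cinner_cauchy_schwarz[of "V (\<pi> x h)"] by (simp add: Vn)
    also have "\<dots> \<le> norm (\<pi> x h) * (onorm x * norm h)"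
      using \<rho>_le[OF x, of "V h"] by (intro mult_left_mono) (simp_all add: Vn)
    finally show ?thesis
      using bounded_clinear_onorm_nonneg[OF M_b[OF x]]
      by (cases "\<pi> x h = 0") (simp_all add: power2_eq_square)
  qed
  note cs = covariant_subset
  have A_red: "reduces V (\<rho> (univ_A cov_reps a)) (\<pi> (univ_A cov_reps a))" if "a \<in> A" for a
  proof -
    have lr: "linear_rep A (\<lambda>a. \<rho> (univ_A cov_reps a))" "linear_rep A (\<lambda>a. \<pi> (univ_A cov_reps a))"
      unfolding linear_rep_def
      by (simp_all add: univ_A_plus[OF cs] univ_A_scale[OF cs] linear_repD[OF lin] univ_M
          linear_repD[OF \<pi>lin] univ_C)
    note mono = mult_right_mono[OF univ_A_le[OF cs] norm_ge_zero]
    have le: "norm (\<rho> (univ_A cov_reps a) k) \<le> onorm a * norm k" "norm (\<pi> (univ_A cov_reps a) h) \<le> onorm a * norm h"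
      if "a \<in> A" for a k h
      using order_trans[OF \<rho>_le mono] order_trans[OF \<pi>_le mono] univ_M(1)[OF that] that by auto
    have "closed_subalgebra {a \<in> A. reduces V (\<rho> (univ_A cov_reps a)) (\<pi> (univ_A cov_reps a))}"
    proof (rule closed_subalgebraI)
      show "closed_subspace {a \<in> A. reduces V (\<rho> (univ_A cov_reps a)) (\<pi> (univ_A cov_reps a))}"
        by (rule closed_subspace_reduces[OF A_closed lr le V])
      fix a b assume ab: "a \<in> {a \<in> A. reduces V (\<rho> (univ_A cov_reps a)) (\<pi> (univ_A cov_reps a))}"
        "b \<in> {a \<in> A. reduces V (\<rho> (univ_A cov_reps a)) (\<pi> (univ_A cov_reps a))}"
      then have "reduces V (\<rho> (univ_A cov_reps a) \<circ> \<rho> (univ_A cov_reps b)) (\<pi> (univ_A cov_reps a) \<circ> \<pi> (univ_A cov_reps b))"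
        by (intro reduces_comp) (auto intro!: linear_rep_bounded[OF lin] linear_rep_bounded[OF \<pi>lin] univ_M univ_C)
      then show "a \<circ> b \<in> {a \<in> A. reduces V (\<rho> (univ_A cov_reps a)) (\<pi> (univ_A cov_reps a))}"
        using ab by (simp add: cstar_comp[OF A_cstar] univ_A_comp[OF cs, symmetric] mult univ_M
            star_rep_comp[OF \<pi>] univ_C)
    qed
    moreover have "proj \<mu> \<in> {a \<in> A. reduces V (\<rho> (univ_A cov_reps a)) (\<pi> (univ_A cov_reps a))}" if "\<mu> \<in> L" for \<mu>
    proof -
      have pA: "proj \<mu> \<in> A" by (rule proj_A[OF that])
      let ?g = "univ_A cov_reps (proj \<mu>)"
      have gg: "?g \<circ> ?g = ?g" "adj ?g = ?g"
        by (simp_all add: univ_A_comp[OF cs] univ_A_adj[OF cs] pA proj_idem proj_adj)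
      have g_le: "onorm ?g \<le> 1"
      proof (rule onorm_bound)
        show "norm (?g h) \<le> 1 * norm h" for h
        proof -
          have "(norm (?g h))\<^sup>2 = Re (cinner h (?g h))"
            using norm_sq_eq_Re_adj[OF univ_A_bounded[OF cs pA], of h] fun_cong[OF gg(1), of h] gg(2)
            by simp
          moreover have "0 \<le> (norm (h - ?g h))\<^sup>2" by simp
          ultimately have "(norm (?g h))\<^sup>2 \<le> (norm h)\<^sup>2" by (simp add: norm_diff_sq)
          then show ?thesis by simp
        qed
      qed simp
      have "reduces V (\<rho> ?g) (\<pi> ?g)"
      proof (rule reduces_projection[OF V])
        show "norm (\<rho> ?g k) \<le> norm k" for k
          using order_trans[OF \<rho>_le[OF univ_M(1)[OF pA]] mult_right_mono[OF g_le norm_ge_zero]] by simp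
        show "\<rho> ?g \<circ> \<rho> ?g = \<rho> ?g" using mult[OF univ_M(1)[OF pA] univ_M(1)[OF pA]] gg(1) by simp
        show "\<pi> ?g \<circ> \<pi> ?g = \<pi> ?g" using star_rep_comp[OF \<pi> univ_C(1)[OF pA] univ_C(1)[OF pA]] gg(1) by simp
        show "adj (\<pi> ?g) = \<pi> ?g" using star_rep_adj[OF \<pi> univ_C(1)[OF pA]] gg(2) by simp
      qed (use pA in \<open>auto intro!: linear_rep_bounded[OF lin] linear_rep_bounded[OF \<pi>lin] univ_M univ_C comp\<close>)
      with pA show ?thesis by simp
    qed
    ultimately have "A \<subseteq> {a \<in> A. reduces V (\<rho> (univ_A cov_reps a)) (\<pi> (univ_A cov_reps a))}"
      by (subst A_eq_projections) (rule hull_minimal, auto)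
    with that show ?thesis by blast
  qed
  have T_red: "reduces V (\<rho> (univ_E cov_reps (T i))) (\<pi> (univ_E cov_reps (T i)))" for i
  proof -
    obtain p where p: "p \<in> A" "\<And>b. b \<in> left_kernel A E \<Longrightarrow> p \<circ> b = (\<lambda>_. 0)" "\<And>\<zeta>. \<zeta> \<in> E \<Longrightarrow> p \<circ> \<zeta> = \<zeta>"
      using identity_on_E_orthogonal_to_kernel by blast
    let ?s = "\<lambda>i. univ_E cov_reps (T i)"
    have sM: "?s i \<in> ?M" and sC: "?s i \<in> C" and pM: "univ_A cov_reps (proj [i]) \<in> ?M"
      and pC: "univ_A cov_reps (proj [i]) \<in> C" for i
      by (simp_all add: univ_M univ_C T_E proj_A single_allowed)
    have row: "(norm (\<Sum>i\<in>UNIV. \<rho> (?s i) (v i)))\<^sup>2 \<le> (\<Sum>i\<in>UNIV. (norm (v i))\<^sup>2)" for v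
    proof -
      let ?n = "card (UNIV :: 'd set)"
      obtain f :: "nat \<Rightarrow> 'd" where f: "bij_betw f {..<?n} UNIV"
        using ex_bij_betw_nat_finite[of "UNIV :: 'd set"] by (auto simp: atLeast0LessThan)
      \<comment> \<open>The row is filled up with zero rows to a square matrix.\<close>
      define X where "X = (\<lambda>i j. if i = (0::nat) then ?s (f j) else (\<lambda>_. 0))"
      have zM: "(\<lambda>_. 0) \<in> ?M"
        using univ_M(1)[OF closed_subspace_zero[OF A_closed]] by (simp add: univ_A_zero[OF cs])
      have n: "0 < ?n" by (simp add: card_gt_0_iff)
      have X_sum: "(\<Sum>i<?n. (norm (\<Sum>j<?n. X i j (w j)))\<^sup>2) = (norm (\<Sum>j<?n. ?s (f j) (w j)))\<^sup>2" for w
      proof -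
        have "(\<Sum>i<?n. (norm (\<Sum>j<?n. X i j (w j)))\<^sup>2)
            = (\<Sum>i<?n. if i = 0 then (norm (\<Sum>j<?n. ?s (f j) (w j)))\<^sup>2 else 0)"
          by (rule sum.cong) (auto simp: X_def)
        then show ?thesis using n by simp
      qed
      have "mat_bounded ?n X 1"
        unfolding mat_bounded_def X_sum
        using univ_row[OF cs finite_lessThan bij_betw_imp_inj_on[OF f]] by simp
      moreover have "X i j \<in> ?M" for i j using sM zM by (simp add: X_def)
      ultimately have mb: "mat_bounded ?n (\<lambda>i j. \<rho> (X i j)) 1"
        by (intro completely_contractiveD[OF cc])
      have "(norm (\<Sum>i\<in>UNIV. \<rho> (?s i) (v i)))\<^sup>2 = (norm (\<Sum>j<?n. \<rho> (X 0 j) (v (f j))))\<^sup>2"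
        using sum.reindex_bij_betw[OF f, of "\<lambda>i. \<rho> (?s i) (v i)"] by (simp add: X_def)
      also have "\<dots> \<le> (\<Sum>i<?n. (norm (\<Sum>j<?n. \<rho> (X i j) (v (f j))))\<^sup>2)"
        by (rule member_le_sum[where f = "\<lambda>i. (norm (\<Sum>j<?n. \<rho> (X i j) (v (f j))))\<^sup>2"]) (use n in auto)
      also have "\<dots> \<le> 1\<^sup>2 * (\<Sum>j<?n. (norm (v (f j)))\<^sup>2)"
        using mb unfolding mat_bounded_def by (rule allE[where x = "\<lambda>j. v (f j)"])
      also have "\<dots> = (\<Sum>i\<in>UNIV. (norm (v i))\<^sup>2)"
        using sum.reindex_bij_betw[OF f, of "\<lambda>i. (norm (v i))\<^sup>2"] by simp
      finally show ?thesis .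
    qed
    show ?thesis
    proof (rule reduces_row[OF V finite[of UNIV], where y = "\<lambda>i. \<rho> (?s i)" and z = "\<lambda>i. \<pi> (?s i)"
          and Qy = "\<lambda>i. \<rho> (univ_A cov_reps (proj [i]))" and Qz = "\<lambda>i. \<pi> (univ_A cov_reps (proj [i]))"
          and Py = "\<rho> (univ_A cov_reps p)" and Pz = "\<pi> (univ_A cov_reps p)"])
      fix j
      show "norm (\<rho> (?s j) k) \<le> norm k" for k
      proof -
        have "(\<Sum>i\<in>UNIV. \<rho> (?s i) (if i = j then k else 0)) = \<rho> (?s j) k"
        proof -
          have "(\<Sum>i\<in>UNIV. \<rho> (?s i) (if i = j then k else 0)) = (\<Sum>i\<in>UNIV. if i = j then \<rho> (?s j) k else 0)"
            by (rule sum.cong) (auto simp: bounded_clinear_zero[OF linear_rep_bounded[OF lin sM]])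
          then show ?thesis by simp
        qed
        moreover have "(\<Sum>i\<in>UNIV. (norm (if i = j then k else 0))\<^sup>2) = (norm k)\<^sup>2"
          by (simp add: if_distrib[of "\<lambda>x. (norm x)\<^sup>2"] cong: if_cong)
        ultimately have "(norm (\<rho> (?s j) k))\<^sup>2 \<le> (norm k)\<^sup>2" using row[of "\<lambda>i. if i = j then k else 0"] by simp
        then show ?thesis by simp
      qed
      show "\<rho> (?s j) \<circ> \<rho> (univ_A cov_reps (proj [j])) = \<rho> (?s j)"
        using mult[OF sM[of j] pM[of j]] by (simp add: univ_E_A[OF cs] proj_A single_allowed T_proj)
      show "\<pi> (?s j) \<circ> \<pi> (univ_A cov_reps (proj [j])) = \<pi> (?s j)"
        using star_rep_comp[OF \<pi> sC[of j] pC[of j]] by (simp add: univ_E_A[OF cs] proj_A single_allowed T_proj)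
      show "adj (\<pi> (?s j)) \<circ> \<pi> (?s j) = \<pi> (univ_A cov_reps (proj [j]))"
        using star_rep_comp[OF \<pi> cstar_adj[OF C_cstar sC] sC, of j j] star_rep_adj[OF \<pi> sC, of j]
        by (simp add: univ_E_inner[OF cs T_E T_E] T_T)
      show "\<rho> (univ_A cov_reps p) \<circ> \<rho> (?s j) = \<rho> (?s j)"
        using mult[OF univ_M(1)[OF p(1)] sM[of j]] by (simp add: univ_A_E_identity[OF cs p(1,3) T_E])
      show "\<pi> (univ_A cov_reps p) \<circ> \<pi> (?s j) = \<pi> (?s j)"
        using star_rep_comp[OF \<pi> univ_C(1)[OF p(1)] sC[of j]] by (simp add: univ_A_E_identity[OF cs p(1,3) T_E])
    next
      fix h
      have "\<pi> (\<lambda>f. \<Sum>i\<in>UNIV. (?s i \<circ> adj (?s i)) f) = (\<lambda>k. \<Sum>i\<in>UNIV. \<pi> (?s i \<circ> adj (?s i)) k)"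
      proof (rule linear_rep_sum[OF \<pi>lin cstar_closed_subspace[OF C_cstar]])
        show "?s i \<circ> adj (?s i) \<in> C" for i by (intro cstar_comp cstar_adj C_cstar sC)
      qed simp
      moreover have "univ_A cov_reps p = (\<lambda>f. \<Sum>i\<in>UNIV. (?s i \<circ> adj (?s i)) f)"
        by (rule univ_covariance[OF p])
      ultimately have "\<pi> (univ_A cov_reps p) = (\<lambda>k. \<Sum>i\<in>UNIV. \<pi> (?s i \<circ> adj (?s i)) k)" by simp
      then show "\<pi> (univ_A cov_reps p) h = (\<Sum>i\<in>UNIV. \<pi> (?s i) (adj (\<pi> (?s i)) h))"
        by (simp add: star_rep_comp[OF \<pi> sC cstar_adj[OF C_cstar sC]] star_rep_adj[OF \<pi> sC])
    qed (simp_all add: row A_red p(1) proj_A single_allowed linear_rep_bounded[OF lin]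
        linear_rep_bounded[OF \<pi>lin] sM sC univ_M univ_C comp)
  qed
  have E_red: "reduces V (\<rho> (univ_E cov_reps \<xi>)) (\<pi> (univ_E cov_reps \<xi>))" if "\<xi> \<in> E" for \<xi>
    using _ _ that
  proof (rule E_induct)
    have lr: "linear_rep E (\<lambda>a. \<rho> (univ_E cov_reps a))" "linear_rep E (\<lambda>a. \<pi> (univ_E cov_reps a))"
      unfolding linear_rep_def
      by (simp_all add: univ_E_plus[OF cs] univ_E_scale[OF cs] linear_repD[OF lin] univ_M
          linear_repD[OF \<pi>lin] univ_C)
    note mono = mult_right_mono[OF univ_E_le[OF cs] norm_ge_zero]
    have le: "norm (\<rho> (univ_E cov_reps a) k) \<le> onorm a * norm k" "norm (\<pi> (univ_E cov_reps a) h) \<le> onorm a * norm h"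
      if "a \<in> E" for a k h
      using order_trans[OF \<rho>_le mono] order_trans[OF \<pi>_le mono] univ_M(2)[OF that] that by auto
    show "closed_subspace {\<xi> \<in> E. reduces V (\<rho> (univ_E cov_reps \<xi>)) (\<pi> (univ_E cov_reps \<xi>))}"
      by (rule closed_subspace_reduces[OF E_closed lr le V])
    fix i a assume a: "a \<in> A"
    have "reduces V (\<rho> (univ_E cov_reps (T i)) \<circ> \<rho> (univ_A cov_reps a)) (\<pi> (univ_E cov_reps (T i)) \<circ> \<pi> (univ_A cov_reps a))"
      by (intro reduces_comp T_red A_red a linear_rep_bounded[OF lin] linear_rep_bounded[OF \<pi>lin]
          univ_M univ_C T_E)
    then show "reduces V (\<rho> (univ_E cov_reps (T i \<circ> a))) (\<pi> (univ_E cov_reps (T i \<circ> a)))"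
      by (simp add: univ_E_A[OF cs a, symmetric] mult univ_M T_E a star_rep_comp[OF \<pi>] univ_C)
  qed
  have qM: "cov_proj \<circ> x \<in> ?M" if "x \<in> N" for x using that by (auto simp: cp_quotient_eq)
  have red: "reduces V (\<rho> (cov_proj \<circ> x)) (\<pi> (cov_proj \<circ> x))" if "x \<in> N" for x
    using _ _ _ that
  proof (rule N_induct)
    have q_plus: "cov_proj \<circ> (\<lambda>h. x h + y h) = (\<lambda>h. (cov_proj \<circ> x) h + (cov_proj \<circ> y) h)"
      and q_scale: "cov_proj \<circ> (\<lambda>h. c *\<^sub>C x h) = (\<lambda>h. c *\<^sub>C (cov_proj \<circ> x) h)" for x y c
      by (simp_all add: fun_eq_iff bounded_clinear_add[OF q_bounded] bounded_clinear_scaleC[OF q_bounded])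
    have lr\<rho>: "linear_rep N (\<lambda>x. \<rho> (cov_proj \<circ> x))"
      by (rule linear_rep_compose[OF lin]) (auto simp only: q_plus q_scale qM)
    have lr\<pi>: "linear_rep N (\<lambda>x. \<pi> (cov_proj \<circ> x))"
      by (rule linear_rep_compose[OF \<pi>lin]) (auto simp only: q_plus q_scale q_N_C)
    have "onorm (cov_proj \<circ> x) \<le> onorm x" if "x \<in> N" for x
    proof (rule onorm_bound)
      show "norm ((cov_proj \<circ> x) h) \<le> onorm x * norm h" for h
        using order_trans[OF q_le bounded_clinear_norm_le[OF N_bounded[OF that]]] by simp
    qed (simp add: bounded_clinear_onorm_nonneg N_bounded that)
    note mono = mult_right_mono[OF this norm_ge_zero]
    have le: "norm (\<rho> (cov_proj \<circ> x) k) \<le> onorm x * norm k" "norm (\<pi> (cov_proj \<circ> x) h) \<le> onorm x * norm h"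
      if "x \<in> N" for x k h
      using order_trans[OF \<rho>_le mono] order_trans[OF \<pi>_le mono] qM[OF that] that by auto
    show "closed_subalgebra {x \<in> N. reduces V (\<rho> (cov_proj \<circ> x)) (\<pi> (cov_proj \<circ> x))}"
    proof (rule closed_subalgebraI)
      show "closed_subspace {x \<in> N. reduces V (\<rho> (cov_proj \<circ> x)) (\<pi> (cov_proj \<circ> x))}"
        by (rule closed_subspace_reduces[OF N_subspace lr\<rho> lr\<pi> le V])
      fix x y assume xy: "x \<in> {x \<in> N. reduces V (\<rho> (cov_proj \<circ> x)) (\<pi> (cov_proj \<circ> x))}"
        "y \<in> {x \<in> N. reduces V (\<rho> (cov_proj \<circ> x)) (\<pi> (cov_proj \<circ> x))}"
      then have "reduces V (\<rho> (cov_proj \<circ> x) \<circ> \<rho> (cov_proj \<circ> y)) (\<pi> (cov_proj \<circ> x) \<circ> \<pi> (cov_proj \<circ> y))"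
        by (intro reduces_comp linear_rep_bounded[OF lin] linear_rep_bounded[OF \<pi>lin] qM q_N_C) auto
      then show "x \<circ> y \<in> {x \<in> N. reduces V (\<rho> (cov_proj \<circ> x)) (\<pi> (cov_proj \<circ> x))}"
        using xy by (simp add: closed_subalgebra_comp[OF N_closed] q_mult mult qM
            star_rep_comp[OF \<pi>] q_N_C)
    qed
  qed (simp_all add: q_univ_A q_univ_E A_red E_red)
  show ?thesis
    unfolding trivial_dilation_def
    using red by (auto simp: cp_quotient_eq reduces_def)
qed

end

theorem theorem7p4:
  fixes I :: "('d::finite list \<Rightarrow>\<^sub>0 complex) set"
    and e :: "'d list \<Rightarrow> 'f::chilbert_space"
    and T :: "'d \<Rightarrow> 'f op"
    and A E :: "'f op set"
  assumes "monomial_ideal I"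
    and "monomial_shifts I e T"
    and "A = monomial_A I T"
    and "E = monomial_E I T"
  shows "hyperrigid TYPE('h::chilbert_space) TYPE('k::chilbert_space)
           (cuntz_pimsner_algebra A E) (cp_quotient A E ` tensor_algebra A E)"
proof -
  interpret monomial_correspondence I e T A E by unfold_locales (rule assms)+
  show ?thesis
    unfolding hyperrigid_def maximal_rep_def
    using generates maximal by blast
qed

end
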